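(* Let $\delta$ be a positive integer and let $G=(V,E)$ be a 2-connected simple graph for which there is a function $w:E\to\{1,\delta-1\}$ with $w(e)=1$ whenever $G\setminus e$ is 2-connected and $w(e)=\delta-1$ whenever $G/e$ is 2-connected. Then $B(M(G))$ is $\delta$-Gorenstein if and only if $w(E(S))+k(S)=\delta(|S|-1)$ for every set $S\subset V$ such that the induced subgraph $G|_S$ is 2-connected, where $k(S)$ is the number of 2-connected components (blocks) of the graph obtained from $G$ by contracting all edges of $E(S)$ (so $k(V)=0$).
   Context: $B(M(G))\subset\mathbb{R}^E$ is the convex hull of indicator vectors of spanning forests of $G$. For a normal lattice polytope $P$, $P$ is $\delta$-Gorenstein if, regarding $P$ as full-dimensional in the affine lattice it spans, there is a lattice point $v\in\delta P$ such that every facet of the cone generated by $P\times\{1\}$ has reduced equation $h$ (primitive integral, nonnegative on the cone) with $h(v,\delta)=1$. $w(F)=\sum_{e\in F}w(e)$; $E(S)$ is the set of edges with both ends in $S$. A graph is 2-connected if connected, with at least two vertices and no cut vertex (a single edge counts as 2-connected).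
   Formalization: The case where G is a single edge, δ=1 and w(e)=0 is excluded: there w is admissible and B(M(G)) is a point, hence 1-Gorenstein, but for S=V the equation reads 0+0=1, so the equivalence as stated fails. *)

theory Defs
  imports "HOL-Analysis.Analysis" "HOL-Computational_Algebra.Group_Closure"
begin

text \<open>
  Undirected graphs with labelled edges. Contracting edges of a simple graph can create parallel
  edges, so an edge is a label together with its set of ends (two vertices, or one for a loop).
  The value of \<open>ends\<close> outside \<open>edges\<close> is irrelevant.
\<close>

record ('v, 'e) mgraph =
  verts :: "'v set"
  edges :: "'e set"
  ends :: "'e \<Rightarrow> 'v set"

definition simple_graph :: "('v, 'e) mgraph \<Rightarrow> bool" where
  "simple_graph G \<longleftrightarrow> finite (verts G) \<and> finite (edges G) \<and>
     (\<forall>e \<in> edges G. ends G e \<subseteq> verts G \<and> card (ends G e) = 2) \<and> inj_on (ends G) (edges G)"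

definition subgraph_on :: "('v, 'e) mgraph \<Rightarrow> 'v set \<Rightarrow> 'e set \<Rightarrow> ('v, 'e) mgraph" where
  "subgraph_on G W F = \<lparr>verts = W, edges = F, ends = ends G\<rparr>"

definition edges_within :: "('v, 'e) mgraph \<Rightarrow> 'v set \<Rightarrow> 'e set" where
  "edges_within G S = {e \<in> edges G. ends G e \<subseteq> S}"

definition induced :: "('v, 'e) mgraph \<Rightarrow> 'v set \<Rightarrow> ('v, 'e) mgraph" where
  "induced G S = subgraph_on G S (edges_within G S)"

definition delete_edge :: "('v, 'e) mgraph \<Rightarrow> 'e \<Rightarrow> ('v, 'e) mgraph" where
  "delete_edge G e = subgraph_on G (verts G) (edges G - {e})"

definition joined :: "('v, 'e) mgraph \<Rightarrow> ('v \<times> 'v) set" where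
  "joined G = {(x, y). \<exists>e \<in> edges G. ends G e = {x, y}}\<^sup>*"

definition connected_graph :: "('v, 'e) mgraph \<Rightarrow> bool" where
  "connected_graph G \<longleftrightarrow> verts G \<noteq> {} \<and> (\<forall>x \<in> verts G. \<forall>y \<in> verts G. (x, y) \<in> joined G)"

definition component_of :: "('v, 'e) mgraph \<Rightarrow> 'v \<Rightarrow> 'v set" where
  "component_of G x = {y \<in> verts G. (x, y) \<in> joined G}"

text \<open>
  The vertices of the contraction by \<open>F\<close> are the vertex sets of the components of the graph
  \<open>(verts G, F)\<close>. Edges keep their labels, and only those in \<open>F\<close> disappear.
\<close>

definition contract :: "('v, 'e) mgraph \<Rightarrow> 'e set \<Rightarrow> ('v set, 'e) mgraph" where
  "contract G F =
     (let c = component_of (subgraph_on G (verts G) F)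
      in \<lparr>verts = c ` verts G, edges = edges G - F, ends = (\<lambda>e. c ` ends G e)\<rparr>)"

definition cut_vertex :: "('v, 'e) mgraph \<Rightarrow> 'v \<Rightarrow> bool" where
  "cut_vertex G z \<longleftrightarrow> z \<in> verts G \<and>
     (\<exists>x \<in> verts G - {z}. \<exists>y \<in> verts G - {z}.
        (x, y) \<in> joined G \<and> (x, y) \<notin> joined (induced G (verts G - {z})))"

definition two_connected :: "('v, 'e) mgraph \<Rightarrow> bool" where
  "two_connected G \<longleftrightarrow> connected_graph G \<and> 2 \<le> card (verts G) \<and> (\<nexists>z. cut_vertex G z)"

text \<open>Blocks are the maximal 2-connected subgraphs, given as pairs of a vertex and an edge set.\<close>

definition two_connected_subgraph :: "('v, 'e) mgraph \<Rightarrow> 'v set \<Rightarrow> 'e set \<Rightarrow> bool" where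
  "two_connected_subgraph G W F \<longleftrightarrow>
     W \<subseteq> verts G \<and> F \<subseteq> edges_within G W \<and> two_connected (subgraph_on G W F)"

definition blocks :: "('v, 'e) mgraph \<Rightarrow> ('v set \<times> 'e set) set" where
  "blocks G = {(W, F). two_connected_subgraph G W F \<and>
     (\<forall>W' F'. two_connected_subgraph G W' F' \<and> W \<subseteq> W' \<and> F \<subseteq> F' \<longrightarrow> W' = W \<and> F' = F)}"

text \<open>
  A cycle with \<open>n \<ge> 1\<close> edges is given by lists of \<open>n\<close> distinct vertices and \<open>n\<close> distinct edges;
  \<open>n = 1\<close> is a loop and \<open>n = 2\<close> a pair of parallel edges.
\<close>

definition is_cycle :: "('v, 'e) mgraph \<Rightarrow> 'v list \<Rightarrow> 'e list \<Rightarrow> bool" where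
  "is_cycle G vs es \<longleftrightarrow>
     es \<noteq> [] \<and> length vs = length es \<and> distinct vs \<and> distinct es \<and>
     set vs \<subseteq> verts G \<and> set es \<subseteq> edges G \<and>
     (\<forall>i < length es. ends G (es ! i) = {vs ! i, vs ! (Suc i mod length es)})"

definition spanning_forest :: "('v, 'e) mgraph \<Rightarrow> 'e set \<Rightarrow> bool" where
  "spanning_forest G F \<longleftrightarrow> F \<subseteq> edges G \<and>
     (\<nexists>vs es. is_cycle (subgraph_on G (verts G) F) vs es) \<and>
     joined (subgraph_on G (verts G) F) = joined G"

definition indicator_vec :: "'e set \<Rightarrow> real ^ 'e" where
  "indicator_vec F = (\<chi> e. if e \<in> F then 1 else 0)"

text \<open>
  The space indexed by \<open>edges G\<close> is the subspace of \<open>real ^ 'e\<close> of vectors vanishing outside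
  \<open>edges G\<close>.
\<close>

definition base_polytope :: "('v, 'e::finite) mgraph \<Rightarrow> (real ^ 'e) set" where
  "base_polytope G = convex hull {indicator_vec F | F. spanning_forest G F}"

text \<open>
  The lattice generated by the points \<open>(p, 1)\<close> with \<open>p\<close> an integral point of \<open>P\<close>. Its slice at
  height 1 is the affine lattice spanned by \<open>P\<close>, its slice at height \<open>d\<close> contains the lattice
  points of the dilation \<open>d P\<close>.
\<close>

definition cone_lattice :: "(real ^ 'n) set \<Rightarrow> ((real ^ 'n) \<times> real) set" where
  "cone_lattice P = group_closure ({p \<in> P. \<forall>i. p $ i \<in> \<int>} \<times> {1})"

definition cone_over :: "(real ^ 'n) set \<Rightarrow> ((real ^ 'n) \<times> real) set" where
  "cone_over P = convex_cone hull (P \<times> {1})"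

text \<open>
  Only the values of a linear form on the real span of the lattice matter. There, an integral form
  is primitive if it is not a proper multiple of another one; the form that vanishes on the lattice
  is therefore not primitive.
\<close>

definition integral_form :: "'a::real_vector set \<Rightarrow> ('a \<Rightarrow> real) \<Rightarrow> bool" where
  "integral_form L h \<longleftrightarrow> linear h \<and> (\<forall>x \<in> L. h x \<in> \<int>)"

definition primitive_form :: "'a::real_vector set \<Rightarrow> ('a \<Rightarrow> real) \<Rightarrow> bool" where
  "primitive_form L h \<longleftrightarrow> integral_form L h \<and>
     (\<forall>(m::nat) g. integral_form L g \<and> (\<forall>x \<in> L. h x = real m * g x) \<longrightarrow> m = 1)"

definition reduced_equation ::
    "(real ^ 'n) set \<Rightarrow> ((real ^ 'n) \<times> real) set \<Rightarrow> ((real ^ 'n) \<times> real \<Rightarrow> real) \<Rightarrow> bool" where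
  "reduced_equation P \<Phi> h \<longleftrightarrow> primitive_form (cone_lattice P) h \<and>
     (\<forall>x \<in> cone_over P. 0 \<le> h x) \<and> \<Phi> = {x \<in> cone_over P. h x = 0}"

text \<open>
  Meant for normal lattice polytopes. Facets are those of the cone, not of \<open>P\<close>: if \<open>P\<close> is a
  single point, the cone is a ray with facet \<open>{0}\<close>, whose reduced equation is the height.
\<close>

definition gorenstein :: "nat \<Rightarrow> (real ^ 'n) set \<Rightarrow> bool" where
  "gorenstein \<delta> P \<longleftrightarrow>
     (\<exists>v. v \<in> (\<lambda>p. real \<delta> *\<^sub>R p) ` P \<and> (v, real \<delta>) \<in> cone_lattice P \<and>
        (\<forall>\<Phi>. \<Phi> facet_of cone_over P \<longrightarrow> (\<exists>h. reduced_equation P \<Phi> h \<and> h (v, real \<delta>) = 1)))"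

end

theory Submission
  imports Defs
begin

text \<open>
  The facets of the base polytope of a connected matroid \<open>M\<close> on \<open>E\<close> are the hyperplanes
  \<open>x(F) = r(F)\<close> for the proper subsets \<open>F\<close> with \<open>M|F\<close> and \<open>M/F\<close> connected, and the form
  \<open>r(F) t - x(F)\<close> is already reduced. A Gorenstein point \<open>v\<close> therefore satisfies
  \<open>v(F) = \<delta> r(F) - 1\<close> for all these \<open>F\<close> and \<open>v(E) = \<delta> r(E)\<close>. For every edge, \<open>M\<close> with the edge
  deleted or contracted is connected, so \<open>v\<close> can only be \<open>w\<close>. If \<open>G|S\<close> is 2-connected, the complement
  of each block \<open>C\<close> of \<open>G/E(S)\<close> is such a set \<open>F\<close>, and adding up \<open>v(C) = v(E) - v(E - C)\<close> over the
  blocks gives the equation of \<open>S\<close>. Conversely, these \<open>F\<close> are the sets \<open>E - {e}\<close> with \<open>G - e\<close>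
  2-connected and the sets \<open>E(S)\<close> with \<open>G/E(S)\<close> a single block, so the equations of the sets \<open>S\<close> give
  those of the facets; and \<open>w(F) \<le> \<delta> r(F)\<close> for every \<open>F\<close>, componentwise, puts \<open>w\<close> into \<open>\<delta>P\<close> by
  Edmonds' description of \<open>P\<close>.
\<close>

section \<open>Matroids given by a rank function\<close>

text \<open>That the flacets give all facets, with the stated reduced equations, rests on basis
  exchange. If a linear form vanishes on the bases with \<open>card (B \<inter> F) = r F\<close>,
  two elements swapped between such bases have the same coefficient. Connectedness of the
  restriction and of the contraction then makes the coefficients constant on \<open>F\<close> and on
  its complement, and the form is a multiple of the slack. The same argument on the whole ground set
  controls the relation \<open>x(E) = r(E) t\<close>, modulo which forms are determined, and
  identifies the lattice. In the sum over the blocks, \<open>r(E) - r(E - C)\<close> is the rank of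
  \<open>C\<close> in the contraction by \<open>E(S)\<close>, so these terms add up to
  \<open>r(E) - r(E(S))\<close>, and the \<open>1\<close> from each block makes up
  \<open>k(S)\<close>. Phrasing connectedness by ranks makes 2-connected subgraphs, blocks and
  matroid components one notion, for \<open>G\<close> and for its contractions alike. A single edge
  needs its own argument: a coloop has no flacets and its cone is only a ray.\<close>

definition rank_connected :: "('a set \<Rightarrow> nat) \<Rightarrow> 'a set \<Rightarrow> bool" where
  "rank_connected r F \<longleftrightarrow> F \<noteq> {} \<and> (\<forall>A. A \<subset> F \<and> A \<noteq> {} \<longrightarrow> r F < r A + r (F - A))"

lemma rank_connectedD:
  "rank_connected r F \<Longrightarrow> A \<subset> F \<Longrightarrow> A \<noteq> {} \<Longrightarrow> r F < r A + r (F - A)"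
  by (simp add: rank_connected_def)

text \<open>\<open>rank_connected\<close> takes an arbitrary function so that it also applies to the
  rank \<open>\<lambda>X. r (X \<union> T) - r T\<close> of a contraction; with that, the rank of a
  contracted graph is only compared on subsets of its edge set.\<close>

lemma rank_connected_cong:
  assumes "\<And>X. X \<subseteq> F \<Longrightarrow> r X = r' X"
  shows "rank_connected r F \<longleftrightarrow> rank_connected r' F"
proof -
  have "r F < r A + r (F - A) \<longleftrightarrow> r' F < r' A + r' (F - A)" if "A \<subset> F" for A
  proof -
    have "A \<subseteq> F" using that by auto
    then show ?thesis using assms[of F] assms[of A] assms[of "F - A"] by simp
  qed
  then show ?thesis unfolding rank_connected_def by blast
qed

locale matroid =
  fixes E :: "'a set" and r :: "'a set \<Rightarrow> nat"
  assumes finite_ground: "finite E"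
    and rank_empty [simp]: "r {} = 0"
    and rank_insert_le: "X \<subseteq> E \<Longrightarrow> e \<in> E \<Longrightarrow> r (insert e X) \<le> Suc (r X)"
    and rank_mono: "X \<subseteq> Y \<Longrightarrow> Y \<subseteq> E \<Longrightarrow> r X \<le> r Y"
    and rank_submodular: "X \<subseteq> E \<Longrightarrow> Y \<subseteq> E \<Longrightarrow> r (X \<union> Y) + r (X \<inter> Y) \<le> r X + r Y"
begin

definition indep :: "'a set \<Rightarrow> bool" where
  "indep X \<longleftrightarrow> X \<subseteq> E \<and> card X = r X"

definition basis :: "'a set \<Rightarrow> bool" where
  "basis B \<longleftrightarrow> indep B \<and> r B = r E"

text \<open>The flats that define facets of the base polytope of a connected matroid.\<close>

definition flacet :: "'a set \<Rightarrow> bool" where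
  "flacet F \<longleftrightarrow> F \<subset> E \<and> rank_connected r F \<and>
     (\<forall>A. F \<subset> A \<and> A \<subset> E \<longrightarrow> r E + r F < r A + r (F \<union> (E - A)))"

section \<open>Ranks, independent sets and bases\<close>

lemma finite_subset_ground: "X \<subseteq> E \<Longrightarrow> finite X"
  using finite_ground finite_subset by blast

lemma rank_union_le: "X \<subseteq> E \<Longrightarrow> Y \<subseteq> E \<Longrightarrow> r (X \<union> Y) \<le> r X + r Y"
  using rank_submodular[of X Y] by linarith

lemma rank_le_card: "X \<subseteq> E \<Longrightarrow> r X \<le> card X"
proof -
  assume "X \<subseteq> E"
  with finite_subset_ground have "finite X" by blast
  then show ?thesis using \<open>X \<subseteq> E\<close>
  proof induction
    case (insert x X)
    then show ?case using rank_insert_le[of X x] by simp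
  qed simp
qed

lemma indep_subset: "indep X \<Longrightarrow> Y \<subseteq> X \<Longrightarrow> indep Y"
proof -
  assume X: "indep X" and YX: "Y \<subseteq> X"
  then have E: "X \<subseteq> E" "Y \<subseteq> E" "X - Y \<subseteq> E" by (auto simp: indep_def)
  have "card X = r X" using X by (simp add: indep_def)
  also have "r X \<le> r Y + r (X - Y)" using rank_union_le[OF E(2,3)] YX by (simp add: Un_absorb1)
  also have "r (X - Y) \<le> card (X - Y)" by (rule rank_le_card[OF E(3)])
  also have "card (X - Y) = card X - card Y"
    using YX E by (intro card_Diff_subset finite_subset_ground) auto
  finally have "card Y \<le> r Y"
    using card_mono[OF finite_subset_ground[OF E(1)] YX] by linarith
  then show ?thesis using rank_le_card[OF E(2)] E by (simp add: indep_def)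
qed

lemma rank_union_eq:
  assumes "X \<subseteq> E" "Y \<subseteq> E" "\<And>y. y \<in> Y \<Longrightarrow> r (insert y X) = r X"
  shows "r (X \<union> Y) = r X"
proof -
  have "finite Y" using assms finite_subset_ground by blast
  then show ?thesis using assms(2,3)
  proof induction
    case (insert y Y)
    have *: "X \<union> Y \<subseteq> E" "insert y X \<subseteq> E" using insert assms by auto
    have "r ((X \<union> Y) \<union> insert y X) + r ((X \<union> Y) \<inter> insert y X) \<le> r (X \<union> Y) + r (insert y X)"
      by (rule rank_submodular[OF *])
    moreover have "r X \<le> r ((X \<union> Y) \<inter> insert y X)" using * by (intro rank_mono) auto
    moreover have "(X \<union> Y) \<union> insert y X = X \<union> insert y Y" by auto
    moreover have "r X \<le> r (X \<union> insert y Y)" using * by (intro rank_mono) auto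
    ultimately show ?case using insert by simp
  qed simp
qed

text \<open>A maximal independent set between \<open>X\<close> and \<open>Y\<close> will do: an
  element of \<open>Y\<close> raising its rank could be added, so by \<open>rank_union_eq\<close> it
  has the rank of \<open>Y\<close>.\<close>

lemma indep_extend:
  assumes "indep X" "X \<subseteq> Y" "Y \<subseteq> E"
  obtains B where "X \<subseteq> B" "B \<subseteq> Y" "indep B" "r B = r Y"
proof -
  let ?S = "{B. X \<subseteq> B \<and> B \<subseteq> Y \<and> indep B}"
  have "finite ?S" using finite_subset_ground[OF assms(3)] by simp
  moreover have "X \<in> ?S" using assms by auto
  ultimately have "\<exists>B\<in>?S. X \<subseteq> B \<and> (\<forall>B'\<in>?S. B \<subseteq> B' \<longrightarrow> B = B')"
    by (rule finite_has_maximal2)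
  then obtain B where B: "B \<in> ?S" and max: "\<forall>B'\<in>?S. B \<subseteq> B' \<longrightarrow> B = B'"
    by (elim bexE conjE)
  have BE: "B \<subseteq> E" using B assms by auto
  have "r (insert y B) = r B" if y: "y \<in> Y" for y
  proof (cases "y \<in> B")
    case False
    have yE: "y \<in> E" using y assms by auto
    show ?thesis
    proof (rule ccontr)
      assume "r (insert y B) \<noteq> r B"
      moreover have "r B \<le> r (insert y B)" using BE yE by (intro rank_mono) auto
      ultimately have "r (insert y B) = Suc (r B)" using rank_insert_le[OF BE yE] by linarith
      then have "indep (insert y B)"
        using B yE False finite_subset_ground[OF BE] by (auto simp: indep_def)
      then have "insert y B \<in> ?S" using B y by auto
      with max have "B \<subseteq> insert y B \<longrightarrow> B = insert y B" by (rule bspec)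
      then have "B = insert y B" by (simp add: subset_insertI)
      then show False using False by blast
    qed
  qed (simp add: insert_absorb)
  from rank_union_eq[OF BE assms(3) this] have "r (B \<union> Y) = r B" by simp
  moreover have "B \<union> Y = Y" using B by auto
  ultimately show ?thesis using that[of B] B by auto
qed

lemma indep_empty [simp]: "indep {}"
  by (simp add: indep_def)

lemma basis_exists: "\<exists>B. basis B"
  by (rule indep_extend[OF indep_empty empty_subsetI subset_refl]) (auto simp: basis_def)

lemma basis_subset: "basis B \<Longrightarrow> B \<subseteq> E"
  by (simp add: basis_def indep_def)

lemma card_basis: "basis B \<Longrightarrow> card B = r E"
  by (simp add: basis_def indep_def)

lemma card_basis_Int_le: "basis B \<Longrightarrow> F \<subseteq> E \<Longrightarrow> card (B \<inter> F) \<le> r F"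
proof -
  assume B: "basis B" and F: "F \<subseteq> E"
  then have "indep (B \<inter> F)" using indep_subset[of B "B \<inter> F"] by (simp add: basis_def)
  then show ?thesis using rank_mono[of "B \<inter> F" F] F by (simp add: indep_def)
qed

text \<open>Take a basis with \<open>r K\<close> elements in \<open>K\<close>. Its part outside
  \<open>K\<close> has \<open>r E - r K < r (E - K)\<close> elements, so some \<open>j\<close>
  outside \<open>K\<close> can be added to that part. Completing the result inside
  \<open>insert j B\<close> drops one element, which must lie in \<open>K\<close>.\<close>

lemma basis_exchange_across:
  assumes K: "K \<subseteq> E" and sep: "r E < r K + r (E - K)"
  obtains B i j where "basis B" "card (B \<inter> K) = r K" "i \<in> B" "i \<in> K" "j \<in> E" "j \<notin> K" "j \<notin> B"
    "basis (insert j (B - {i}))"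
proof -
  obtain I where I: "I \<subseteq> K" "indep I" "r I = r K"
    by (rule indep_extend[OF indep_empty empty_subsetI K])
  obtain B where B: "I \<subseteq> B" "B \<subseteq> E" "indep B" "r B = r E"
    by (rule indep_extend[OF I(2) order.trans[OF I(1) K] subset_refl])
  have bB: "basis B" using B by (simp add: basis_def)
  have fB: "finite B" using B finite_subset_ground by blast
  have "r K \<le> card (B \<inter> K)"
  proof -
    have "I \<subseteq> B \<inter> K" using I B by auto
    then show ?thesis using I card_mono[of "B \<inter> K" I] fB by (simp add: indep_def)
  qed
  then have cK: "card (B \<inter> K) = r K" using card_basis_Int_le[OF bB K] by simp
  have "card (B - K) = card B - card (B \<inter> K)"
    using fB by (simp add: card_Diff_subset_Int)
  then have cB: "card (B - K) = r E - r K" using cK card_basis[OF bB] by simp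
  have "indep (B - K)" using indep_subset[OF B(3), of "B - K"] by auto
  then obtain J where J: "B - K \<subseteq> J" "J \<subseteq> E - K" "indep J" "r J = r (E - K)"
    by (rule indep_extend[OF _ Diff_mono[OF B(2) subset_refl] Diff_subset])
  have "card (B - K) < card J"
    using J sep cB rank_mono[OF K subset_refl] by (simp add: indep_def)
  then have "B - K \<noteq> J" by auto
  then obtain j where j: "j \<in> J" "j \<notin> B - K" using J by auto
  have jB: "j \<notin> B" "j \<in> E" "j \<notin> K" using j J by auto
  have "indep (insert j (B - K))" using indep_subset[OF J(3), of "insert j (B - K)"] J(1) j(1) by simp
  then obtain B' where B': "insert j (B - K) \<subseteq> B'" "B' \<subseteq> insert j B" "indep B'"
      "r B' = r (insert j B)"
    by (rule indep_extend[OF _ insert_mono[OF Diff_subset] insert_subset[THEN iffD2]]) (use B(2) jB(2) in auto)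
  have "r B \<le> r (insert j B)" "r (insert j B) \<le> r E"
    using rank_mono[of B "insert j B"] rank_mono[of "insert j B" E] B(2) jB(2) by auto
  then have rB': "r B' = r E" using B B' by linarith
  then have bB': "basis B'" using B' by (simp add: basis_def)
  have "card B' < card (insert j B)" using card_basis[OF bB] card_basis[OF bB'] jB fB by simp
  then have "B' \<noteq> insert j B" by auto
  then obtain i where i: "i \<in> insert j B" "i \<notin> B'" using B' by auto
  have iB: "i \<in> B" "i \<in> K" using i B' by auto
  have "B' \<subseteq> insert j (B - {i})" using B' i by auto
  moreover have "card (insert j (B - {i})) = card B'"
    using card_basis[OF bB] card_basis[OF bB'] jB fB card_Suc_Diff1[OF fB iB(1)] by simp
  ultimately have "B' = insert j (B - {i})"
    using fB by (intro card_subset_eq) auto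
  then show ?thesis using that[OF bB cK iB jB(2,3,1)] bB' by simp
qed

section \<open>Separations and connected components\<close>

lemma rank_separation_restrict:
  assumes "F \<subseteq> E" "A \<subseteq> F" "r A + r (F - A) = r F" "Y \<subseteq> F"
  shows "r Y = r (Y \<inter> A) + r (Y - A)"
proof -
  have s: "Y \<subseteq> E" "A \<subseteq> E" "F - A \<subseteq> E" "Y \<union> A \<subseteq> E" "Y \<inter> A \<subseteq> E" "Y - A \<subseteq> E" using assms by auto
  \<comment> \<open>Adding the submodular inequalities for \<open>Y\<close>, \<open>A\<close> and
    for \<open>Y \<union> A\<close>, \<open>F - A\<close> gives one direction, subadditivity the
    other.\<close>
  have "r (Y \<union> A) + r (Y \<inter> A) \<le> r Y + r A" by (rule rank_submodular[OF s(1,2)])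
  moreover have "r ((Y \<union> A) \<union> (F - A)) + r ((Y \<union> A) \<inter> (F - A)) \<le> r (Y \<union> A) + r (F - A)"
    by (rule rank_submodular[OF s(4,3)])
  moreover have "(Y \<union> A) \<union> (F - A) = F" "(Y \<union> A) \<inter> (F - A) = Y - A" using assms by auto
  moreover have "r ((Y \<inter> A) \<union> (Y - A)) \<le> r (Y \<inter> A) + r (Y - A)" by (rule rank_union_le[OF s(5,6)])
  moreover have "(Y \<inter> A) \<union> (Y - A) = Y" by auto
  ultimately show ?thesis using assms(3) by simp
qed

lemma rank_connected_in_part:
  assumes "F \<subseteq> E" "A \<subseteq> F" "r A + r (F - A) = r F" "X \<subseteq> F" "rank_connected r X"
  shows "X \<subseteq> A \<or> X \<subseteq> F - A"
proof (rule ccontr)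
  assume "\<not> ?thesis"
  then have "X \<inter> A \<subset> X" "X \<inter> A \<noteq> {}" using assms by auto
  from rank_connectedD[OF assms(5) this] have "r X < r (X \<inter> A) + r (X - A)"
    by (simp add: Diff_Int)
  then show False using rank_separation_restrict[OF assms(1-4)] by simp
qed

lemma rank_le_sum_parts:
  assumes "finite \<P>" "\<And>C. C \<in> \<P> \<Longrightarrow> C \<subseteq> E"
  shows "r (\<Union>\<P>) \<le> (\<Sum>C\<in>\<P>. r C)"
  using assms
proof (induction \<P>)
  case (insert C \<P>)
  have "r (C \<union> \<Union>\<P>) \<le> r C + r (\<Union>\<P>)" using insert.prems by (intro rank_union_le) auto
  then show ?case using insert by simp
qed simp

lemma rank_connected_partition:
  assumes "F \<subseteq> E"
  obtains \<P> where "partition_on F \<P>" "\<And>C. C \<in> \<P> \<Longrightarrow> rank_connected r C"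
    "r F = (\<Sum>C\<in>\<P>. r C)"
proof -
  have "\<exists>\<P>. partition_on F \<P> \<and> (\<forall>C\<in>\<P>. rank_connected r C) \<and> r F = (\<Sum>C\<in>\<P>. r C)"
    using assms
  proof (induction "card F" arbitrary: F rule: less_induct)
    case less
    have fF: "finite F" using less finite_subset_ground by blast
    consider "F = {}" | "rank_connected r F" | "F \<noteq> {}" "\<not> rank_connected r F" by blast
    then show ?case
    proof cases
      case 1 then show ?thesis by (intro exI[of _ "{}"]) (auto simp: partition_on_empty)
    next
      case 2 then show ?thesis
        by (intro exI[of _ "{F}"]) (auto simp: partition_on_space rank_connected_def)
    next
      case 3
      then obtain A where A: "A \<subset> F" "A \<noteq> {}" "r A + r (F - A) \<le> r F"
        unfolding rank_connected_def by (meson not_less)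
      have cards: "card A < card F" "card (F - A) < card F"
        using A fF by (auto intro!: psubset_card_mono)
      have subs: "A \<subseteq> E" "F - A \<subseteq> E" using A less.prems by auto
      obtain P where P: "partition_on A P" "\<forall>C\<in>P. rank_connected r C" "r A = (\<Sum>C\<in>P. r C)"
        using less.hyps[OF cards(1) subs(1)] by auto
      obtain Q where Q: "partition_on (F - A) Q" "\<forall>C\<in>Q. rank_connected r C" "r (F - A) = (\<Sum>C\<in>Q. r C)"
        using less.hyps[OF cards(2) subs(2)] by auto
      have fin: "finite P" "finite Q"
        using P Q subs finite_subset_ground finite_elements by metis+
      have "P \<inter> Q = {}"
      proof (rule ccontr)
        assume "P \<inter> Q \<noteq> {}"
        then obtain D where D: "D \<in> P" "D \<in> Q" by auto
        then have "D \<subseteq> A" "D \<subseteq> F - A" "D \<noteq> {}" using P(1) Q(1) by (auto simp: partition_on_def)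
        then show False by auto
      qed
      then have "(\<Sum>C\<in>P \<union> Q. r C) = r A + r (F - A)" using P Q fin by (simp add: sum.union_disjoint)
      moreover have "r F \<le> r A + r (F - A)"
        using rank_union_le[OF subs] A by (simp add: Un_absorb1 less_imp_le)
      moreover have "partition_on F (P \<union> Q)"
      proof (rule partition_onI)
        show "\<Union>(P \<union> Q) = F" using P(1) Q(1) A by (auto simp: partition_on_def)
        show "{} \<notin> P \<union> Q" using P(1) Q(1) by (auto simp: partition_on_def)
        fix p q assume pq: "p \<in> P \<union> Q" "q \<in> P \<union> Q" "p \<noteq> q"
        have "p \<subseteq> A" if "p \<in> P" for p using that P(1) by (auto simp: partition_on_def)
        moreover have "p \<subseteq> F - A" if "p \<in> Q" for p using that Q(1) by (auto simp: partition_on_def)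
        moreover have "disjnt p q" if "p \<in> P" "q \<in> P"
          using that pq P(1) by (auto simp: partition_on_def pairwise_def)
        moreover have "disjnt p q" if "p \<in> Q" "q \<in> Q"
          using that pq Q(1) by (auto simp: partition_on_def pairwise_def)
        ultimately show "disjnt p q" using pq(1,2) unfolding disjnt_def by blast
      qed
      ultimately show ?thesis using P Q A by (intro exI[of _ "P \<union> Q"]) auto
    qed
  qed
  then show ?thesis using that by auto
qed

lemma rank_partition_split:
  assumes "F \<subseteq> E" "partition_on F \<P>" "r F = (\<Sum>C\<in>\<P>. r C)" "C \<in> \<P>"
  shows "r C + r (F - C) = r F"
proof -
  have fin: "finite \<P>" using assms finite_subset_ground finite_elements by metis
  have sub: "D \<subseteq> E" if "D \<in> \<P>" for D using that assms(1,2) by (auto simp: partition_on_def)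
  have "F - C = \<Union>(\<P> - {C})"
  proof (intro equalityI subsetI)
    fix x assume "x \<in> F - C" then show "x \<in> \<Union>(\<P> - {C})"
      using assms(2) by (auto simp: partition_on_def)
  next
    fix x assume "x \<in> \<Union>(\<P> - {C})"
    then obtain D where "D \<in> \<P>" "D \<noteq> C" "x \<in> D" by auto
    then show "x \<in> F - C" using assms(2,4) by (auto simp: partition_on_def pairwise_def disjnt_def)
  qed
  then have "r (F - C) \<le> (\<Sum>D\<in>\<P> - {C}. r D)" using rank_le_sum_parts[of "\<P> - {C}"] fin sub by auto
  then have "r C + r (F - C) \<le> r F" using sum.remove[OF fin assms(4), of r] assms(3) by simp
  moreover have "r F \<le> r C + r (F - C)"
  proof -
    have "C \<subseteq> F" using assms(2,4) by (auto simp: partition_on_def)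
    then show ?thesis using rank_union_le[of C "F - C"] assms(1) by (auto simp: Un_absorb1)
  qed
  ultimately show ?thesis by simp
qed

text \<open>Blocks are defined by maximality, whereas counting ranks needs an additive partition.
  Every part of the partition separates \<open>F\<close>, so a connected set lies inside a single
  part, and the two descriptions agree.\<close>

lemma maximal_rank_connected_eq_partition:
  assumes F: "F \<subseteq> E" and P: "partition_on F \<P>" "\<And>C. C \<in> \<P> \<Longrightarrow> rank_connected r C"
    and r: "r F = (\<Sum>C\<in>\<P>. r C)"
  shows "{X. X \<subseteq> F \<and> rank_connected r X \<and>
           (\<forall>Y. Y \<subseteq> F \<and> rank_connected r Y \<and> X \<subseteq> Y \<longrightarrow> Y = X)} = \<P>" (is "?M = _")
proof -
  have sub: "D \<subseteq> F" if "D \<in> \<P>" for D using that P(1) by (auto simp: partition_on_def)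
  have in_part: "\<exists>C\<in>\<P>. X \<subseteq> C" if X: "X \<subseteq> F" "rank_connected r X" for X
  proof -
    obtain x where x: "x \<in> X" using X by (auto simp: rank_connected_def)
    then obtain C where C: "C \<in> \<P>" "x \<in> C" using X P(1) by (auto simp: partition_on_def)
    have "X \<subseteq> C \<or> X \<subseteq> F - C"
      using rank_connected_in_part[OF F sub[OF C(1)] rank_partition_split[OF F P(1) r C(1)] X] .
    then show ?thesis using C x by auto
  qed
  show ?thesis
  proof
    show "?M \<subseteq> \<P>"
    proof
      fix X assume X: "X \<in> ?M"
      then obtain C where C: "C \<in> \<P>" "X \<subseteq> C" using in_part[of X] by auto
      then have "C = X" using X P(2)[OF C(1)] sub[OF C(1)] by auto
      then show "X \<in> \<P>" using C by simp
    qed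
    show "\<P> \<subseteq> ?M"
    proof
      fix C assume C: "C \<in> \<P>"
      have "Y = C" if Y: "Y \<subseteq> F" "rank_connected r Y" "C \<subseteq> Y" for Y
      proof -
        obtain D where D: "D \<in> \<P>" "Y \<subseteq> D" using in_part[OF Y(1,2)] by auto
        have "C \<noteq> {}" "C \<subseteq> D" using P(2)[OF C] D Y by (auto simp: rank_connected_def)
        moreover have "C \<noteq> D \<Longrightarrow> disjnt C D" using C D P(1) by (auto simp: partition_on_def pairwise_def)
        ultimately have "C = D" by (auto simp: disjnt_def)
        then show ?thesis using D Y by auto
      qed
      then show "C \<in> ?M" using C P(2) sub by auto
    qed
  qed
qed

section \<open>Flacets of a connected matroid\<close>

lemma rank_singleton_connected:
  assumes "rank_connected r E" "2 \<le> card E" "e \<in> E"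
  shows "r {e} = 1" "r (E - {e}) = r E"
proof -
  have "card {e} < card E" using assms by simp
  then have "{e} \<noteq> E" by auto
  then have "{e} \<subset> E" using assms by auto
  from rank_connectedD[OF assms(1) this] have "r E < r {e} + r (E - {e})" by simp
  moreover have "r {e} \<le> 1" using rank_le_card[of "{e}"] assms by simp
  moreover have "r (E - {e}) \<le> r E" by (rule rank_mono) auto
  ultimately show "r {e} = 1" "r (E - {e}) = r E" by auto
qed

text \<open>Separations of the deletion and of the contraction would cross, and one of the four corners
  of the crossing would separate the matroid itself.\<close>

lemma flacet_delete_or_contract:
  assumes conn: "rank_connected r E" and two: "2 \<le> card E" and e: "e \<in> E"
  shows "flacet (E - {e}) \<or> flacet {e}"
proof (rule ccontr)
  note re = rank_singleton_connected[OF conn two e]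
  have "card (E - {e}) \<noteq> 0" using two e by simp
  then have ne: "E - {e} \<noteq> {}" by (metis card.empty)
  assume not: "\<not> ?thesis"
  have "\<not> rank_connected r (E - {e})"
  proof
    assume "rank_connected r (E - {e})"
    then have "flacet (E - {e})" using e by (auto simp: flacet_def)
    then show False using not by simp
  qed
  then obtain A where A: "A \<subset> E - {e}" "A \<noteq> {}" "r A + r (E - {e} - A) \<le> r (E - {e})"
    using ne unfolding rank_connected_def by (meson not_less)
  define B where "B = E - {e} - A"
  have AB: "A \<subseteq> E - {e}" "B \<subseteq> E - {e}" "A \<noteq> {}" "B \<noteq> {}" "A \<union> B = E - {e}"
    using A(1,2) by (auto simp: B_def)
  have rAB: "r A + r B \<le> r E" using A(3) re by (simp add: B_def)
  have "rank_connected r {e}" using re by (auto simp: rank_connected_def)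
  moreover have "{e} \<subset> E" using ne e by auto
  moreover have "\<not> flacet {e}" using not by simp
  ultimately obtain X where X: "{e} \<subset> X" "X \<subset> E"
      "\<not> r E + r {e} < r X + r ({e} \<union> (E - X))"
    unfolding flacet_def by blast
  define C D where "C = X - {e}" and "D = E - X"
  have CD: "C \<subseteq> E - {e}" "D \<subseteq> E - {e}" "C \<noteq> {}" "D \<noteq> {}" "C \<union> D = E - {e}"
    using X(1,2) by (auto simp: C_def D_def)
  have "X = insert e C" "{e} \<union> (E - X) = insert e D" using X(1) by (auto simp: C_def D_def)
  then have rCD: "r (insert e C) + r (insert e D) \<le> Suc (r E)" using X(3) re by simp
  have disj: "A \<inter> B = {}" "C \<inter> D = {}" by (auto simp: B_def C_def D_def)
  \<comment> \<open>If the opposite corners \<open>P \<inter> R\<close> and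
    \<open>Q \<inter> S\<close> were both nonempty, the ranks of the two corners and of their
    complements would add up to at least \<open>2 * r E + 2\<close> by connectedness, but to at most
    \<open>2 * r E + 1\<close> by submodularity.\<close>
  have cross: "P \<inter> R = {} \<or> Q \<inter> S = {}"
    if sub: "P \<subseteq> E - {e}" "Q \<subseteq> E - {e}" "R \<subseteq> E - {e}" "S \<subseteq> E - {e}"
      and un: "P \<union> Q = E - {e}" "R \<union> S = E - {e}" and dj: "P \<inter> Q = {}" "R \<inter> S = {}"
      and rk: "r P + r Q \<le> r E" "r (insert e R) + r (insert e S) \<le> Suc (r E)"
    for P Q R S
  proof (rule ccontr)
    assume "\<not> ?thesis"
    then have ne: "P \<inter> R \<noteq> {}" "Q \<inter> S \<noteq> {}" by auto
    have subE: "insert e R \<subseteq> E" "insert e S \<subseteq> E" "P \<subseteq> E" "Q \<subseteq> E" using sub e by auto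
    have "r (P \<union> insert e R) + r (P \<inter> insert e R) \<le> r P + r (insert e R)"
      by (rule rank_submodular[OF subE(3,1)])
    moreover have "r (Q \<union> insert e S) + r (Q \<inter> insert e S) \<le> r Q + r (insert e S)"
      by (rule rank_submodular[OF subE(4,2)])
    moreover have "P \<inter> insert e R = P \<inter> R" "Q \<inter> insert e S = Q \<inter> S" using sub by auto
    moreover have "P \<union> insert e R = E - (Q \<inter> S)"
    proof (intro equalityI subsetI)
      fix x assume "x \<in> P \<union> insert e R" then show "x \<in> E - (Q \<inter> S)" using sub e dj by auto
    next
      fix x assume "x \<in> E - (Q \<inter> S)" then show "x \<in> P \<union> insert e R" using un by blast
    qed
    moreover have "Q \<union> insert e S = E - (P \<inter> R)"
    proof (intro equalityI subsetI)
      fix x assume "x \<in> Q \<union> insert e S" then show "x \<in> E - (P \<inter> R)" using sub e dj by auto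
    next
      fix x assume "x \<in> E - (P \<inter> R)" then show "x \<in> Q \<union> insert e S" using un by blast
    qed
    moreover have "P \<inter> R \<subset> E" "Q \<inter> S \<subset> E" using sub e by auto
    note rank_connectedD[OF conn this(1) ne(1)] rank_connectedD[OF conn this(2) ne(2)]
    ultimately show False using rk by simp
  qed
  have "A \<inter> C = {} \<or> B \<inter> D = {}"
    by (rule cross[OF AB(1,2) CD(1,2) AB(5) CD(5) disj rAB rCD])
  moreover have "D \<union> C = E - {e}" "D \<inter> C = {}" "r (insert e D) + r (insert e C) \<le> Suc (r E)"
    using CD(5) disj(2) rCD by (simp_all add: Un_commute Int_commute add.commute)
  then have "A \<inter> D = {} \<or> B \<inter> C = {}"
    using cross[OF AB(1,2) CD(2,1) AB(5) _ disj(1) _ rAB] by simp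
  moreover have "A \<inter> C \<noteq> {} \<or> A \<inter> D \<noteq> {}" using AB(1,3) CD(5) by blast
  moreover have "B \<inter> C \<noteq> {} \<or> B \<inter> D \<noteq> {}" using AB(2,4) CD(5) by blast
  moreover have "A \<inter> C \<noteq> {} \<or> B \<inter> C \<noteq> {}" using CD(1,3) AB(5) by blast
  moreover have "A \<inter> D \<noteq> {} \<or> B \<inter> D \<noteq> {}" using CD(2,4) AB(5) by blast
  \<comment> \<open>Each diagonal has an empty corner. Two such corners share one of
    \<open>A\<close>, \<open>B\<close>, \<open>C\<close>, \<open>D\<close>, which would then be
    empty.\<close>
  ultimately show False by argo
qed

lemma rank_complement_contraction_component:
  assumes T: "T \<subseteq> E" and C: "C \<subseteq> E - T"
    and split: "(r (C \<union> T) - r T) + (r ((E - T - C) \<union> T) - r T) = r ((E - T) \<union> T) - r T"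
  shows "r (C \<union> T) + r (E - C) = r E + r T"
proof -
  have "(E - T - C) \<union> T = E - C" "(E - T) \<union> T = E" using assms by auto
  moreover have "r T \<le> r (C \<union> T)" "r T \<le> r (E - C)" "r T \<le> r E" using T C by (auto intro!: rank_mono)
  ultimately show ?thesis using split by simp
qed

text \<open>A separation of the restriction to \<open>E - C\<close> would have a side
  \<open>D\<close> disjoint from the connected set \<open>T\<close>; by \<open>split\<close>,
  \<open>D\<close> would even separate \<open>E\<close>. As for the contraction,
  \<open>split\<close> also says that on \<open>C\<close> contracting \<open>E - C\<close> has the
  same effect as contracting \<open>T\<close>.\<close>

lemma flacet_complement_contraction_component:
  assumes conn: "rank_connected r E" and T: "T \<subseteq> E" "rank_connected r T" and C: "C \<subseteq> E - T"
    and cC: "rank_connected (\<lambda>X. r (X \<union> T) - r T) C"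
    and split: "r (C \<union> T) + r (E - C) = r E + r T"
  shows "flacet (E - C)"
  unfolding flacet_def
proof (intro conjI allI impI)
  have Cne: "C \<noteq> {}" using cC by (simp add: rank_connected_def)
  then show "E - C \<subset> E" using C by auto
  have Tne: "T \<noteq> {}" using T by (simp add: rank_connected_def)
  show "rank_connected r (E - C)"
  proof (rule ccontr)
    assume "\<not> ?thesis"
    moreover have "E - C \<noteq> {}" using Tne T C by auto
    ultimately obtain A where A: "A \<subset> E - C" "A \<noteq> {}" "r A + r (E - C - A) \<le> r (E - C)"
      unfolding rank_connected_def by (meson not_less)
    have eq: "r A + r (E - C - A) = r (E - C)"
    proof -
      have "A \<subseteq> E" "E - C - A \<subseteq> E" "A \<union> (E - C - A) = E - C" using A by auto
      then show ?thesis using rank_union_le[of A "E - C - A"] A(3) by simp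
    qed
    have "T \<subseteq> A \<or> T \<subseteq> E - C - A"
      by (rule rank_connected_in_part[OF _ _ eq _ T(2)]) (use A(1) C T(1) in auto)
    then obtain D where D: "D \<subseteq> E - C" "D \<noteq> {}" "T \<inter> D = {}" "r D + r (E - C - D) = r (E - C)"
    proof
      assume TA: "T \<subseteq> A"
      have "E - C - (E - C - A) = A" using A by auto
      then show thesis using A(1) TA eq by (intro that[of "E - C - A"]) (auto simp: add.commute)
    next
      assume "T \<subseteq> E - C - A" then show thesis
        using A(1,2) eq by (intro that[of A]) auto
    qed
    have "r ((C \<union> T) \<union> (E - C - D)) + r ((C \<union> T) \<inter> (E - C - D)) \<le> r (C \<union> T) + r (E - C - D)"
      using T C by (intro rank_submodular) auto
    moreover have "(C \<union> T) \<union> (E - C - D) = E - D" "(C \<union> T) \<inter> (E - C - D) = T"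
      using D(1-3) C T(1) by blast+
    moreover have "r E < r D + r (E - D)"
      using D(1,2) Cne C by (intro rank_connectedD[OF conn]) auto
    ultimately show False using D split by simp
  qed
  fix A assume A: "E - C \<subset> A \<and> A \<subset> E"
  define A' where "A' = A \<inter> C"
  have A': "A' \<subset> C" "A' \<noteq> {}" using A by (auto simp: A'_def)
  have "r (C \<union> T) - r T < (r (A' \<union> T) - r T) + (r ((C - A') \<union> T) - r T)"
    using rank_connectedD[OF cC A'] .
  moreover have "C \<union> T \<subseteq> E" "A' \<union> T \<subseteq> E" "(C - A') \<union> T \<subseteq> E" using T(1) C A' by auto
  then have "r T \<le> r (C \<union> T)" "r T \<le> r (A' \<union> T)" "r T \<le> r ((C - A') \<union> T)"
    using rank_mono[OF Un_upper2] by blast+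
  ultimately have lt: "r (C \<union> T) + r T < r (A' \<union> T) + r ((C - A') \<union> T)" by simp
  have "r (A \<union> (C \<union> T)) + r (A \<inter> (C \<union> T)) \<le> r A + r (C \<union> T)"
    "r ((E - C \<union> (E - A)) \<union> (C \<union> T)) + r ((E - C \<union> (E - A)) \<inter> (C \<union> T)) \<le> r (E - C \<union> (E - A)) + r (C \<union> T)"
    by (rule rank_submodular; use A C T(1) in blast)+
  moreover have "A \<union> (C \<union> T) = E" "A \<inter> (C \<union> T) = A' \<union> T" 
      "(E - C \<union> (E - A)) \<union> (C \<union> T) = E" "(E - C \<union> (E - A)) \<inter> (C \<union> T) = (C - A') \<union> T"
    using A C T(1) by (auto simp: A'_def)
  ultimately show "r E + r (E - C) < r A + r (E - C \<union> (E - A))" using lt split by simp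
qed

text \<open>The direct sum of the restriction to \<open>F\<close> and the contraction by \<open>F\<close>: its bases span the face
  \<open>x(F) = r(F)\<close> of the base polytope.\<close>

lemma matroid_restrict_sum_contract:
  assumes F: "F \<subseteq> E"
  shows "matroid E (\<lambda>X. r (X \<inter> F) + r (X \<union> F) - r F)"
proof
  show "finite E" by (rule finite_ground)
next
  fix X e assume s: "X \<subseteq> E" "e \<in> E"
  have "r F \<le> r (X \<union> F)" "r F \<le> r (insert e X \<union> F)" using s F by (auto intro!: rank_mono)
  moreover have "r (insert e X \<inter> F) + r (insert e X \<union> F) \<le> Suc (r (X \<inter> F) + r (X \<union> F))"
  proof (cases "e \<in> F")
    case True
    then have "insert e X \<inter> F = insert e (X \<inter> F)" "insert e X \<union> F = X \<union> F" by auto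
    then show ?thesis using rank_insert_le[of "X \<inter> F" e] s F by auto
  next
    case False
    then have "insert e X \<inter> F = X \<inter> F" "insert e X \<union> F = insert e (X \<union> F)" by auto
    then show ?thesis using rank_insert_le[of "X \<union> F" e] s F by auto
  qed
  ultimately show "r (insert e X \<inter> F) + r (insert e X \<union> F) - r F \<le> Suc (r (X \<inter> F) + r (X \<union> F) - r F)"
    by simp
next
  fix X Y assume s: "X \<subseteq> Y" "Y \<subseteq> E"
  then have "r (X \<inter> F) \<le> r (Y \<inter> F)" "r (X \<union> F) \<le> r (Y \<union> F)" using F by (auto intro!: rank_mono)
  then show "r (X \<inter> F) + r (X \<union> F) - r F \<le> r (Y \<inter> F) + r (Y \<union> F) - r F" by simp
next
  fix X Y assume s: "X \<subseteq> E" "Y \<subseteq> E"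
  have "r ((X \<inter> F) \<union> (Y \<inter> F)) + r ((X \<inter> F) \<inter> (Y \<inter> F)) \<le> r (X \<inter> F) + r (Y \<inter> F)"
    "r ((X \<union> F) \<union> (Y \<union> F)) + r ((X \<union> F) \<inter> (Y \<union> F)) \<le> r (X \<union> F) + r (Y \<union> F)"
    using s F by (auto intro!: rank_submodular)
  moreover have "(X \<inter> F) \<union> (Y \<inter> F) = (X \<union> Y) \<inter> F" "(X \<inter> F) \<inter> (Y \<inter> F) = X \<inter> Y \<inter> F"
    "(X \<union> F) \<union> (Y \<union> F) = X \<union> Y \<union> F" "(X \<union> F) \<inter> (Y \<union> F) = X \<inter> Y \<union> F" by auto
  moreover have "r F \<le> r (X \<union> F)" "r F \<le> r (Y \<union> F)" "r F \<le> r (X \<union> Y \<union> F)" "r F \<le> r (X \<inter> Y \<union> F)"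
    using s F by (auto intro!: rank_mono)
  ultimately show "r ((X \<union> Y) \<inter> F) + r (X \<union> Y \<union> F) - r F + (r (X \<inter> Y \<inter> F) + r (X \<inter> Y \<union> F) - r F)
       \<le> r (X \<inter> F) + r (X \<union> F) - r F + (r (Y \<inter> F) + r (Y \<union> F) - r F)"
    by simp
qed simp

lemma basis_restrict_sum_contract:
  assumes F: "F \<subseteq> E" and B: "matroid.basis E (\<lambda>X. r (X \<inter> F) + r (X \<union> F) - r F) B"
  shows "basis B" "card (B \<inter> F) = r F"
proof -
  interpret M: matroid E "\<lambda>X. r (X \<inter> F) + r (X \<union> F) - r F"
    by (rule matroid_restrict_sum_contract[OF F])
  have BE: "B \<subseteq> E" using M.basis_subset[OF B] .
  have eq: "card B = r (B \<inter> F) + r (B \<union> F) - r F" "card B = r (E \<inter> F) + r (E \<union> F) - r F"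
    using B M.basis_def M.indep_def by auto
  have EF: "E \<inter> F = F" "E \<union> F = E" using F by auto
  have le: "r (B \<inter> F) \<le> r F" "r (B \<union> F) \<le> r E" "r F \<le> r (B \<union> F)"
    using BE F by (auto intro!: rank_mono)
  then have eqs: "r (B \<inter> F) = r F" "r (B \<union> F) = r E" "card B = r E" using eq EF by auto
  have "r (B \<union> F) + r (B \<inter> F) \<le> r B + r F" by (rule rank_submodular[OF BE F])
  moreover have "r B \<le> r E" using BE by (simp add: rank_mono)
  ultimately show b: "basis B" using eqs BE by (auto simp: basis_def indep_def)
  then have "indep (B \<inter> F)" using indep_subset[of B "B \<inter> F"] by (simp add: basis_def)
  then show "card (B \<inter> F) = r F" using eqs by (simp add: indep_def)
qed

lemma basis_tight_exists:
  assumes F: "F \<subseteq> E"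
  obtains B where "basis B" "card (B \<inter> F) = r F"
proof -
  interpret M: matroid E "\<lambda>X. r (X \<inter> F) + r (X \<union> F) - r F"
    by (rule matroid_restrict_sum_contract[OF F])
  show ?thesis using M.basis_exists basis_restrict_sum_contract[OF F] that by blast
qed

text \<open>In the direct sum of restriction and contraction, no proper nonempty part of
  \<open>F\<close> or of \<open>E - F\<close> is a separator. If a level set of \<open>g\<close>
  were such a part, \<open>basis_exchange_across\<close> would provide an exchange of tight bases
  leaving it, but along such an exchange \<open>g\<close> does not change.\<close>

lemma exchange_closed_restrict_contract:
  fixes g :: "'a \<Rightarrow> 'b"
  assumes fl: "flacet F"
    and ex: "\<And>B i j. basis B \<Longrightarrow> card (B \<inter> F) = r F \<Longrightarrow> i \<in> B \<Longrightarrow> j \<in> E \<Longrightarrow> j \<notin> B \<Longrightarrow>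
        basis (insert j (B - {i})) \<Longrightarrow> card (insert j (B - {i}) \<inter> F) = r F \<Longrightarrow> g i = g j"
  shows "\<exists>a. \<forall>e\<in>F. g e = a" "\<exists>b. \<forall>e\<in>E - F. g e = b"
proof -
  have F: "F \<subset> E" "rank_connected r F"
    and co: "\<And>A. F \<subset> A \<Longrightarrow> A \<subset> E \<Longrightarrow> r E + r F < r A + r (F \<union> (E - A))"
    using fl by (auto simp: flacet_def)
  have FE: "F \<subseteq> E" using F by auto
  interpret M: matroid E "\<lambda>X. r (X \<inter> F) + r (X \<union> F) - r F"
    by (rule matroid_restrict_sum_contract[OF FE])
  have swap: "\<exists>i j. i \<in> K \<and> j \<in> E \<and> j \<notin> K \<and> (i \<in> F \<longleftrightarrow> j \<in> F) \<and> g i = g j"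
    if K: "K \<subseteq> E" and lt: "r E + r F < (r (K \<inter> F) + r (K \<union> F) - r F) + (r ((E - K) \<inter> F) + r ((E - K) \<union> F) - r F) + r F"
    for K
  proof -
    have "E \<inter> F = F" "E \<union> F = E" using FE by auto
    then have "r (E \<inter> F) + r (E \<union> F) - r F < (r (K \<inter> F) + r (K \<union> F) - r F) + (r ((E - K) \<inter> F) + r ((E - K) \<union> F) - r F)"
      using lt by simp
    then obtain B i j where
      B: "M.basis B" and ij: "i \<in> B" "i \<in> K" "j \<in> E" "j \<notin> K" "j \<notin> B" and B': "M.basis (insert j (B - {i}))"
      by (rule M.basis_exchange_across[OF K])
    note b = basis_restrict_sum_contract[OF FE B] basis_restrict_sum_contract[OF FE B']
    have fB: "finite (B \<inter> F)" using b(1) basis_subset finite_subset_ground by blast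
    \<comment> \<open>Both bases have \<open>r F\<close> elements in \<open>F\<close>, so the
      exchange cannot cross the boundary of \<open>F\<close>.\<close>
    have "i \<in> F \<longleftrightarrow> j \<in> F"
    proof (rule ccontr)
      assume "\<not> ?thesis"
      then consider "i \<in> F" "j \<notin> F" | "i \<notin> F" "j \<in> F" by auto
      then show False
      proof cases
        case 1
        then have "insert j (B - {i}) \<inter> F = (B \<inter> F) - {i}" by auto
        moreover have "i \<in> B \<inter> F" using 1 ij by auto
        ultimately show ?thesis using b(2,4) card_Suc_Diff1[OF fB, of i] by simp
      next
        case 2
        then have "insert j (B - {i}) \<inter> F = insert j (B \<inter> F)" by auto
        then show ?thesis using b(2,4) fB ij(5) by simp
      qed
    qed
    moreover have "g i = g j" using ex[OF b(1,2) ij(1,3,5) b(3,4)] .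
    ultimately show ?thesis using ij by auto
  qed
  show "\<exists>a. \<forall>e\<in>F. g e = a"
  proof -
    obtain e where e: "e \<in> F" using F by (auto simp: rank_connected_def)
    define K where "K = {x\<in>F. g x = g e}"
    have "K = F"
    proof (rule ccontr)
      assume "K \<noteq> F"
      then have K: "K \<subset> F" "K \<noteq> {}" using e by (auto simp: K_def)
      have "K \<inter> F = K" "K \<union> F = F" "(E - K) \<inter> F = F - K" "(E - K) \<union> F = E" using K FE by auto
      moreover have "r F < r K + r (F - K)" by (rule rank_connectedD[OF F(2) K])
      moreover have "r F \<le> r E" using FE by (simp add: rank_mono)
      ultimately have "r E + r F < (r (K \<inter> F) + r (K \<union> F) - r F) + (r ((E - K) \<inter> F) + r ((E - K) \<union> F) - r F) + r F"
        by simp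
      moreover have "K \<subseteq> E" using K FE by auto
      ultimately obtain i j where "i \<in> K" "j \<notin> K" "i \<in> F \<longleftrightarrow> j \<in> F" "g i = g j"
        using swap[of K] by blast
      then show False by (auto simp: K_def)
    qed
    then show ?thesis by (auto simp: K_def)
  qed
  show "\<exists>b. \<forall>e\<in>E - F. g e = b"
  proof -
    obtain e where e: "e \<in> E - F" using F by auto
    define K where "K = {x\<in>E - F. g x = g e}"
    have "K = E - F"
    proof (rule ccontr)
      assume "K \<noteq> E - F"
      then have K: "K \<subset> E - F" "K \<noteq> {}" using e by (auto simp: K_def)
      have "K \<inter> F = {}" "(E - K) \<inter> F = F" "(E - K) \<union> F = F \<union> (E - (K \<union> F))" using K FE by auto
      moreover have "r E + r F < r (K \<union> F) + r (F \<union> (E - (K \<union> F)))" 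
        using K FE by (intro co) auto
      moreover have "r F \<le> r (K \<union> F)" using K FE by (intro rank_mono) auto
      ultimately have "r E + r F < (r (K \<inter> F) + r (K \<union> F) - r F) + (r ((E - K) \<inter> F) + r ((E - K) \<union> F) - r F) + r F"
        by simp
      moreover have "K \<subseteq> E" using K by auto
      ultimately obtain i j where "i \<in> K" "j \<in> E" "j \<notin> K" "i \<in> F \<longleftrightarrow> j \<in> F" "g i = g j"
        using swap[of K] by blast
      then show False by (auto simp: K_def)
    qed
    then show ?thesis by (auto simp: K_def)
  qed
qed

text \<open>Again a proper level set would be left by an exchange. This serves for the forms that
  vanish on all bases and for the classes of unit vectors modulo the lattice.\<close>

lemma exchange_closed_connected:
  fixes g :: "'a \<Rightarrow> 'b"
  assumes conn: "rank_connected r E"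
    and ex: "\<And>B i j. basis B \<Longrightarrow> i \<in> B \<Longrightarrow> j \<in> E \<Longrightarrow> j \<notin> B \<Longrightarrow> basis (insert j (B - {i})) \<Longrightarrow> g i = g j"
  shows "\<exists>a. \<forall>e\<in>E. g e = a"
proof -
  obtain e where e: "e \<in> E" using conn by (auto simp: rank_connected_def)
  define K where "K = {x\<in>E. g x = g e}"
  have "K = E"
  proof (rule ccontr)
    assume "K \<noteq> E"
    then have K: "K \<subset> E" "K \<noteq> {}" using e by (auto simp: K_def)
    obtain B i j where "basis B" "i \<in> B" "i \<in> K" "j \<in> E" "j \<notin> K" "j \<notin> B" "basis (insert j (B - {i}))"
      by (rule basis_exchange_across[OF psubset_imp_subset[OF K(1)] rank_connectedD[OF conn K]])
    then show False using ex[of B i j] by (auto simp: K_def)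
  qed
  then show ?thesis by (auto simp: K_def)
qed

lemma indep_iff_rank_drop:
  assumes F: "F \<subseteq> E"
  shows "indep F \<longleftrightarrow> (\<forall>e\<in>F. r (F - {e}) \<noteq> r F)"
proof
  assume ind: "indep F"
  show "\<forall>e\<in>F. r (F - {e}) \<noteq> r F"
  proof
    fix e assume e: "e \<in> F"
    have "r (F - {e}) \<le> card (F - {e})" using F by (intro rank_le_card) auto
    also have "\<dots> < card F" by (rule card_Diff1_less[OF finite_subset_ground[OF F] e])
    also have "card F = r F" using ind by (simp add: indep_def)
    finally show "r (F - {e}) \<noteq> r F" by simp
  qed
next
  assume drop: "\<forall>e\<in>F. r (F - {e}) \<noteq> r F"
  obtain B where B: "B \<subseteq> F" "indep B" "r B = r F"
    by (rule indep_extend[OF indep_empty empty_subsetI F])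
  have "B = F"
  proof (rule ccontr)
    assume "B \<noteq> F"
    then obtain e where e: "e \<in> F" "e \<notin> B" using B by auto
    have "r B \<le> r (F - {e})" by (rule rank_mono) (use B(1) e F in auto)
    moreover have "r (F - {e}) \<le> r F" by (rule rank_mono) (use F in auto)
    ultimately have "r (F - {e}) = r F" using B(3) by simp
    then show False using drop e(1) by blast
  qed
  then show "indep F" using B by simp
qed

lemma connected_partition_singleton:
  assumes F: "F \<subseteq> E" and conn: "rank_connected r F" and P: "partition_on F \<P>" "r F = (\<Sum>C\<in>\<P>. r C)"
  shows "\<P> = {F}"
proof -
  have "C = F" if C: "C \<in> \<P>" for C
  proof (rule ccontr)
    assume "C \<noteq> F"
    then have "C \<subset> F" "C \<noteq> {}" using C P(1) by (auto simp: partition_on_def)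
    from rank_connectedD[OF conn this] show False using rank_partition_split[OF F P C] by simp
  qed
  moreover have "\<P> \<noteq> {}" using P(1) conn by (auto simp: partition_on_def rank_connected_def)
  ultimately show ?thesis by blast
qed

text \<open>The last clause of \<open>flacet\<close> is connectedness of the contraction, written
  with the sets \<open>A = X \<union> T\<close> to avoid truncated subtraction; this is the
  translation back.\<close>

lemma flacet_contraction_connected:
  assumes "flacet T"
  shows "rank_connected (\<lambda>X. r (X \<union> T) - r T) (E - T)"
  unfolding rank_connected_def
proof (intro conjI allI impI)
  have T: "T \<subset> E" and co: "\<And>A. T \<subset> A \<Longrightarrow> A \<subset> E \<Longrightarrow> r E + r T < r A + r (T \<union> (E - A))"
    using assms by (auto simp: flacet_def)
  show "E - T \<noteq> {}" using T by auto
  fix X assume X: "X \<subset> E - T \<and> X \<noteq> {}"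
  have "r E + r T < r (X \<union> T) + r (T \<union> (E - (X \<union> T)))" by (rule co) (use X T in auto)
  moreover have "T \<union> (E - (X \<union> T)) = (E - T - X) \<union> T" "E - T \<union> T = E" using T by auto
  moreover have "r T \<le> r (X \<union> T)" "r T \<le> r ((E - T - X) \<union> T)" "r T \<le> r E"
    by (rule rank_mono; use X T in blast)+
  ultimately show "r (E - T \<union> T) - r T < r (X \<union> T) - r T + (r (E - T - X \<union> T) - r T)"
    by simp
qed

end

section \<open>Facets of the base polytope\<close>

lemma linear_eq_inner:
  fixes g :: "'a::euclidean_space \<Rightarrow> real"
  shows "linear g \<Longrightarrow> g z = adjoint g 1 \<bullet> z"
  using adjoint_works[of g z 1] by (simp add: inner_commute)

lemma nonneg_linear_face_of:
  fixes g :: "'a::euclidean_space \<Rightarrow> real"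
  assumes "linear g" "convex C" "\<And>z. z \<in> C \<Longrightarrow> 0 \<le> g z"
  shows "{z \<in> C. g z = 0} face_of C"
proof -
  note a = linear_eq_inner[OF assms(1)]
  let ?a = "adjoint g 1"
  have "C \<inter> {z. ?a \<bullet> z = 0} face_of C"
    by (rule face_of_Int_supporting_hyperplane_ge[OF assms(2)]) (use assms(3) a in auto)
  moreover have "C \<inter> {z. ?a \<bullet> z = 0} = {z \<in> C. g z = 0}" using a by auto
  ultimately show ?thesis by simp
qed

lemma zero_mem_face_of_convex_cone:
  assumes "convex_cone C" "\<Phi> face_of C" "\<Phi> \<noteq> {}"
  shows "0 \<in> \<Phi>"
proof -
  obtain z where z: "z \<in> \<Phi>" using assms(3) by auto
  show ?thesis
  proof (cases "z = 0")
    case False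
    have zC: "z \<in> C" using z assms(2) by (auto simp: face_of_def)
    have "0 \<in> C" using assms(1) by (rule convex_cone_contains_0)
    moreover have "2 *\<^sub>R z \<in> C" using convex_cone_scaleR[OF assms(1) _ zC, of 2] by simp
    moreover have "z \<in> open_segment 0 (2 *\<^sub>R z)"
      using False by (auto simp: in_segment intro!: exI[of _ "1/2"])
    ultimately show ?thesis using assms(2) z unfolding face_of_def by blast
  qed (use z in simp)
qed

text \<open>Dual to counting dimensions: if on the cone only multiples of \<open>l\<close> vanish on
  the face, then the face together with \<open>b\<close> spans the cone.\<close>

lemma facet_of_convex_coneI:
  fixes l :: "'a::euclidean_space \<Rightarrow> real"
  assumes C: "convex_cone C" and l: "linear l" "\<And>z. z \<in> C \<Longrightarrow> 0 \<le> l z"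
    and b: "b \<in> C" "l b \<noteq> 0"
    and uniq: "\<And>g. linear g \<Longrightarrow> (\<And>z. z \<in> C \<Longrightarrow> l z = 0 \<Longrightarrow> g z = 0) \<Longrightarrow> \<exists>\<kappa>. \<forall>z\<in>C. g z = \<kappa> * l z"
  shows "{z \<in> C. l z = 0} facet_of C"
proof -
  let ?F = "{z \<in> C. l z = 0}"
  have 0: "0 \<in> C" "0 \<in> ?F" using convex_cone_contains_0[OF C] linear_0[OF l(1)] by auto
  have "convex C" using C by (simp add: convex_cone_def)
  then have face: "?F face_of C" using nonneg_linear_face_of[OF l(1)] l(2) by auto
  have sub: "C \<subseteq> span (insert b ?F)"
  proof
    fix c assume c: "c \<in> C"
    \<comment> \<open>The part \<open>z\<close> of \<open>c\<close> orthogonal to the span gives a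
      form vanishing on the face and at \<open>b\<close>, hence on the cone. So \<open>z\<close> is
      orthogonal to \<open>c\<close> as well, and is zero.\<close>
    obtain y z where yz: "y \<in> span (insert b ?F)" "\<forall>w\<in>span (insert b ?F). orthogonal z w" "c = y + z"
      by (rule orthogonal_subspace_decomp_exists[of "insert b ?F" c]) blast
    define g where "g = (\<lambda>x. z \<bullet> x)"
    have "linear g" unfolding g_def by (simp add: bounded_linear.linear bounded_linear_inner_right)
    moreover have "g w = 0" if "w \<in> insert b ?F" for w
      using bspec[OF yz(2) span_base[OF that]] by (simp add: g_def orthogonal_def)
    ultimately obtain \<kappa> where \<kappa>: "\<forall>z\<in>C. g z = \<kappa> * l z" and gb: "g b = 0" using uniq[of g] by auto
    then have "\<kappa> = 0" using b by auto
    then have "g c = 0" using \<kappa> c by auto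
    moreover have "z \<bullet> y = 0" using bspec[OF yz(2,1)] by (simp add: orthogonal_def)
    ultimately have "z \<bullet> z = 0" unfolding g_def yz(3) by (simp add: inner_right_distrib)
    then show "c \<in> span (insert b ?F)" using yz(1,3) by simp
  qed
  have lspan: "l z = 0" if "z \<in> span ?F" for z
    using linear_eq_0_on_span[OF l(1) _ that] by simp
  then have "b \<notin> span ?F" using b by auto
  then have "dim (insert b ?F) = dim ?F + 1" by (simp add: dim_insert)
  moreover have "dim C \<le> dim (insert b ?F)" using dim_subset[OF sub] by (simp add: dim_span)
  moreover have "dim (insert b ?F) \<le> dim C" using b by (intro dim_subset) auto
  moreover have "aff_dim ?F = int (dim ?F)" by (rule aff_dim_zero[OF hull_inc[OF 0(2)]])
  moreover have "aff_dim C = int (dim C)" by (rule aff_dim_zero[OF hull_inc[OF 0(1)]])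
  ultimately show ?thesis using face 0 by (auto simp: facet_of_def)
qed

text \<open>A facet has codimension one, so together with any point \<open>b\<close> off the
  hyperplane it spans the cone, and a form vanishing on it is determined there by its value at
  \<open>b\<close>.\<close>

lemma facet_of_convex_cone_form_unique:
  fixes l :: "'a::euclidean_space \<Rightarrow> real"
  assumes C: "convex_cone C" and facet: "\<Phi> facet_of C" and l: "linear l" "\<And>z. z \<in> \<Phi> \<Longrightarrow> l z = 0"
    and b: "b \<in> C" "l b \<noteq> 0" and g: "linear g" "\<And>z. z \<in> \<Phi> \<Longrightarrow> g z = 0"
  obtains \<kappa> :: real where "\<And>z. z \<in> C \<Longrightarrow> g z = \<kappa> * l z"
proof -
  have face: "\<Phi> face_of C" "\<Phi> \<noteq> {}" "\<Phi> \<subseteq> C" using facet by (auto simp: facet_of_def face_of_def)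
  have 0: "0 \<in> C" "0 \<in> \<Phi>" using zero_mem_face_of_convex_cone[OF C face(1,2)] face by auto
  have "aff_dim \<Phi> = int (dim \<Phi>)" "aff_dim C = int (dim C)"
    by (rule aff_dim_zero[OF hull_inc[OF 0(2)]], rule aff_dim_zero[OF hull_inc[OF 0(1)]])
  then have dims: "dim C = dim \<Phi> + 1" using facet by (auto simp: facet_of_def)
  have "l z = 0" if "z \<in> span \<Phi>" for z using linear_eq_0_on_span[OF l that] .
  then have "b \<notin> span \<Phi>" using b by auto
  then have "dim (insert b \<Phi>) = dim C" using dims by (simp add: dim_insert)
  then have span: "span (insert b \<Phi>) = span C" using b face by (intro dim_eq_span) auto
  define \<kappa> where "\<kappa> = g b / l b"
  define d where "d = (\<lambda>z. g z - \<kappa> * l z)"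
  have "linear d" unfolding d_def using g(1) l(1)
    by (intro linear_compose_sub linear_compose_scale_right[of l \<kappa>, simplified]) auto
  moreover have "d z = 0" if "z \<in> insert b \<Phi>" for z
    using that b l g by (auto simp: d_def \<kappa>_def)
  ultimately have "d z = 0" if "z \<in> C" for z
    using linear_eq_0_on_span[of d "insert b \<Phi>"] span span_base[OF that] by auto
  then show ?thesis using that[of \<kappa>] by (simp add: d_def)
qed

section \<open>Generated lattices and indicator vectors\<close>

lemma group_closure_sum:
  "(\<And>i. i \<in> I \<Longrightarrow> f i \<in> group_closure S) \<Longrightarrow> sum f I \<in> group_closure S"
  by (induction I rule: infinite_finite_induct) (auto intro: group_closure_add)

lemma group_closure_of_nat_scaleR:
  fixes x :: "'a::real_vector"
  shows "x \<in> group_closure S \<Longrightarrow> of_nat n *\<^sub>R x \<in> group_closure S"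
  by (induction n) (auto simp: scaleR_add_left intro: group_closure_add)

lemma group_closure_of_int_scaleR:
  fixes x :: "'a::real_vector"
  assumes "x \<in> group_closure S"
  shows "of_int k *\<^sub>R x \<in> group_closure S"
proof (cases "k \<ge> 0")
  case True
  then show ?thesis using group_closure_of_nat_scaleR[OF assms, of "nat k"] by simp
next
  case False
  then have "of_int k *\<^sub>R x = - (of_nat (nat (- k)) *\<^sub>R x)" by simp
  then show ?thesis using group_closure_of_nat_scaleR[OF assms, of "nat (- k)"] by (metis group_closure_minus_iff)
qed

lemma indicator_vec_eq_sum: "indicator_vec B = (\<Sum>e\<in>B. axis e (1::real))"
proof -
  have "(\<Sum>e\<in>B. axis e (1::real)) $ i = (if i \<in> B then 1 else 0)" for i
  proof -
    have "(\<Sum>e\<in>B. axis e (1::real)) $ i = (\<Sum>e\<in>B. if e = i then 1 else 0)"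
      by (simp add: axis_def)
    also have "\<dots> = (if i \<in> B then 1 else 0)" by (simp add: sum.delta)
    finally show ?thesis .
  qed
  then show ?thesis by (simp add: vec_eq_iff indicator_vec_def)
qed

lemma sum_indicator_vec: "finite F \<Longrightarrow> (\<Sum>e\<in>F. indicator_vec B $ e) = real (card (B \<inter> F))"
  by (simp add: indicator_vec_def sum.If_cases Int_commute)

lemma linear_indicator_vec:
  fixes g :: "(real ^ 'e) \<times> real \<Rightarrow> real"
  assumes "linear g"
  shows "g (indicator_vec B, t) = (\<Sum>e\<in>B. g (axis e 1, 0)) + t * g (0, 1)"
proof -
  have "(\<Sum>e\<in>B. (axis e (1::real), 0::real)) = (indicator_vec B, 0)"
    by (simp add: indicator_vec_eq_sum prod_eq_iff fst_sum snd_sum)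
  then have "(indicator_vec B, t) = (\<Sum>e\<in>B. (axis e 1, 0)) + t *\<^sub>R (0, 1)" by simp
  then show ?thesis by (simp only: linear_add[OF assms] linear_sum[OF assms] linear_scale[OF assms]) simp
qed

lemma cone_lattice_diff:
  "x \<in> cone_lattice Q \<Longrightarrow> y \<in> cone_lattice Q \<Longrightarrow> x - y \<in> cone_lattice Q"
  unfolding cone_lattice_def by (rule group_closure.diff)

locale matroid_polytope = matroid E r
  for E :: "'e::finite set" and r
begin

section \<open>Slacks of the rank inequalities on the cone\<close>

definition P :: "(real ^ 'e) set" where
  "P = convex hull {indicator_vec B | B. basis B}"

definition gap :: "'e set \<Rightarrow> (real ^ 'e) \<times> real \<Rightarrow> real" where
  "gap F z = real (r F) * snd z - (\<Sum>e\<in>F. fst z $ e)"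

lemma linear_gap: "linear (gap F)"
  by (rule linearI) (auto simp: gap_def sum.distrib sum_distrib_left algebra_simps)

lemma gap_basis: "gap F (indicator_vec B, 1) = real (r F) - real (card (B \<inter> F))"
  by (simp add: gap_def sum_indicator_vec)

lemma indicator_basis_in_P: "basis B \<Longrightarrow> indicator_vec B \<in> P"
  unfolding P_def by (rule hull_inc) auto

lemma convex_cone_cone_over: "convex_cone (cone_over P)"
  by (simp add: cone_over_def convex_cone_convex_cone_hull)

lemma convex_cone_over: "convex (cone_over P)"
  using convex_cone_cone_over by (simp add: convex_cone_def)

lemma in_cone_over: "p \<in> P \<Longrightarrow> (p, 1) \<in> cone_over P"
  unfolding cone_over_def by (rule hull_inc) auto

lemma basis_in_cone_over: "basis B \<Longrightarrow> (indicator_vec B, 1) \<in> cone_over P"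
  by (intro in_cone_over indicator_basis_in_P)

lemma linear_nonneg_on_P:
  fixes g :: "(real ^ 'e) \<times> real \<Rightarrow> real"
  assumes g: "linear g" and B: "\<And>B. basis B \<Longrightarrow> 0 \<le> g (indicator_vec B, 1)" and p: "p \<in> P"
  shows "0 \<le> g (p, 1)"
proof -
  have "(p, 1::real) \<in> convex hull ({indicator_vec B | B. basis B} \<times> {1})"
    using p by (simp add: P_def convex_hull_Times)
  also have "\<dots> \<subseteq> {z. 0 \<le> g z}"
  proof (rule hull_minimal)
    show "convex {z. 0 \<le> g z}"
      using convex_halfspace_ge[of 0 "adjoint g 1"] linear_eq_inner[OF g] by simp
  qed (use B in auto)
  finally show ?thesis by simp
qed

lemma linear_nonneg_on_cone:
  fixes g :: "(real ^ 'e) \<times> real \<Rightarrow> real"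
  assumes g: "linear g" and B: "\<And>B. basis B \<Longrightarrow> 0 \<le> g (indicator_vec B, 1)" and z: "z \<in> cone_over P"
  shows "0 \<le> g z"
proof -
  have "cone_over P \<subseteq> {z. 0 \<le> g z}"
    unfolding cone_over_def
  proof (rule hull_minimal)
    show "convex_cone {z. 0 \<le> g z}"
      using convex_cone_halfspace_ge[of "adjoint g 1"] linear_eq_inner[OF g] by simp
  qed (use linear_nonneg_on_P[OF g B] in auto)
  then show ?thesis using z by auto
qed

lemma linear_zero_on_cone:
  fixes g :: "(real ^ 'e) \<times> real \<Rightarrow> real"
  assumes g: "linear g" and B: "\<And>B. basis B \<Longrightarrow> g (indicator_vec B, 1) = 0" and z: "z \<in> cone_over P"
  shows "g z = 0"
proof -
  have "linear (\<lambda>z. - g z)" using g by (rule linear_compose_neg)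
  from linear_nonneg_on_cone[OF this _ z] linear_nonneg_on_cone[OF g _ z] B show ?thesis by force
qed

lemma linear_zero_on_lattice:
  fixes g :: "(real ^ 'e) \<times> real \<Rightarrow> real"
  assumes g: "linear g" and B: "\<And>B. basis B \<Longrightarrow> g (indicator_vec B, 1) = 0" and z: "z \<in> cone_lattice P"
  shows "g z = 0"
  using z unfolding cone_lattice_def
proof (induction rule: group_closure.induct)
  case (base s)
  then show ?case using linear_zero_on_cone[OF g B] in_cone_over linear_0[OF g] by auto
qed (simp add: linear_diff[OF g])

lemma basis_in_lattice: "basis B \<Longrightarrow> (indicator_vec B, 1) \<in> cone_lattice P"
proof -
  assume "basis B"
  moreover have "indicator_vec B $ i \<in> \<int>" for i by (simp add: indicator_vec_def)
  ultimately show ?thesis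
    unfolding cone_lattice_def by (intro group_closure.base) (simp add: indicator_basis_in_P)
qed

lemma gap_nonneg: "F \<subseteq> E \<Longrightarrow> z \<in> cone_over P \<Longrightarrow> 0 \<le> gap F z"
  by (rule linear_nonneg_on_cone[OF linear_gap]) (use card_basis_Int_le in \<open>auto simp: gap_basis\<close>)

lemma gap_ground_zero: "basis B \<Longrightarrow> gap E (indicator_vec B, 1) = 0"
  using card_basis[of B] basis_subset[of B] by (simp add: gap_basis Int_absorb2)

lemma integral_gap: "integral_form (cone_lattice P) (gap F)"
proof -
  have "gap F z \<in> \<int>" if "z \<in> cone_lattice P" for z
    using that unfolding cone_lattice_def
  proof (induction rule: group_closure.induct)
    case (base s)
    then show ?case by (auto simp: gap_def intro!: Ints_diff Ints_mult Ints_sum)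
  qed (simp add: linear_diff[OF linear_gap])
  then show ?thesis by (simp add: integral_form_def linear_gap)
qed

text \<open>An exchange across \<open>F\<close> from a tight basis lowers
  \<open>card (B \<inter> F)\<close> by one. The value 1 at a lattice point is what makes
  \<open>gap F\<close> primitive.\<close>

lemma basis_gap_one:
  assumes conn: "rank_connected r E" and F: "F \<subset> E" "F \<noteq> {}"
  obtains B where "basis B" "gap F (indicator_vec B, 1) = 1"
proof -
  obtain B i j where B: "card (B \<inter> F) = r F" "i \<in> B" "i \<in> F" "j \<notin> F" "basis (insert j (B - {i}))"
    by (rule basis_exchange_across[OF psubset_imp_subset[OF F(1)] rank_connectedD[OF conn F]])
  have "insert j (B - {i}) \<inter> F = (B \<inter> F) - {i}" using B by auto
  moreover have "finite (B \<inter> F)" "i \<in> B \<inter> F" using B by auto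
  ultimately have "Suc (card (insert j (B - {i}) \<inter> F)) = r F" using B(1) card_Suc_Diff1 by metis
  then show ?thesis using that[OF B(5)] by (simp add: gap_basis)
qed

section \<open>Flacets define facets\<close>

lemma linear_exchange:
  fixes g :: "(real ^ 'e) \<times> real \<Rightarrow> real"
  assumes g: "linear g" and ij: "i \<in> B" "j \<notin> B"
    and eq: "g (indicator_vec B, 1) = g (indicator_vec (insert j (B - {i})), 1)"
  shows "g (axis i 1, 0) = g (axis j 1, 0)"
  using eq ij sum.remove[of B i "\<lambda>e. g (axis e 1, 0)"] by (simp add: linear_indicator_vec[OF g])

text \<open>The coefficients of \<open>g\<close> are a constant \<open>a\<close> on \<open>F\<close>
  and a constant \<open>b\<close> on \<open>E - F\<close>. All bases have the same size, so on them
  \<open>g\<close> is an affine function of \<open>card (B \<inter> F)\<close>, and a tight basis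
  shows that no constant is added to the multiple of \<open>gap F\<close>.\<close>

lemma flacet_form_unique:
  fixes g :: "(real ^ 'e) \<times> real \<Rightarrow> real"
  assumes fl: "flacet F" and g: "linear g"
    and zero: "\<And>B. basis B \<Longrightarrow> card (B \<inter> F) = r F \<Longrightarrow> g (indicator_vec B, 1) = 0"
  obtains \<kappa> where "\<And>B. basis B \<Longrightarrow> g (indicator_vec B, 1) = \<kappa> * gap F (indicator_vec B, 1)"
proof -
  let ?c = "\<lambda>e. g (axis e 1, 0)"
  have ex: "?c i = ?c j" if "basis B" "card (B \<inter> F) = r F" "i \<in> B" "j \<in> E" "j \<notin> B"
        "basis (insert j (B - {i}))" "card (insert j (B - {i}) \<inter> F) = r F" for B i j
    using linear_exchange[OF g that(3,5)] zero[OF that(1,2)] zero[OF that(6,7)] by simp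
  obtain a where a: "\<forall>e\<in>F. ?c e = a" using exchange_closed_restrict_contract(1)[OF fl, of ?c] ex by blast
  obtain b where b: "\<forall>e\<in>E - F. ?c e = b" using exchange_closed_restrict_contract(2)[OF fl, of ?c] ex by blast
  have FE: "F \<subseteq> E" using fl by (auto simp: flacet_def)
  have val: "g (indicator_vec B, 1) = (b - a) * gap F (indicator_vec B, 1)
      + (a * real (r F) + b * (real (r E) - real (r F)) + g (0, 1))" if B: "basis B" for B
  proof -
    have "(\<Sum>e\<in>B. ?c e) = (\<Sum>e\<in>B \<inter> F. ?c e) + (\<Sum>e\<in>B - F. ?c e)"
      by (subst sum.union_disjoint[symmetric]) (auto simp: Int_Diff_Un)
    moreover have "(\<Sum>e\<in>B \<inter> F. ?c e) = (\<Sum>e\<in>B \<inter> F. a)" by (rule sum.cong) (use a in auto)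
    moreover have "(\<Sum>e\<in>B - F. ?c e) = (\<Sum>e\<in>B - F. b)"
      by (rule sum.cong) (use b basis_subset[OF B] in auto)
    moreover have "card (B \<inter> F) + card (B - F) = r E"
      using card_basis[OF B] by (metis card_Int_Diff add.commute finite)
    then have "real (card (B - F)) = real (r E) - real (card (B \<inter> F))" by linarith
    ultimately show ?thesis by (simp add: linear_indicator_vec[OF g] gap_basis algebra_simps)
  qed
  obtain B0 where B0: "basis B0" "card (B0 \<inter> F) = r F" by (rule basis_tight_exists[OF FE])
  have "a * real (r F) + b * (real (r E) - real (r F)) + g (0, 1) = 0"
    using val[OF B0(1)] zero[OF B0] B0(2) by (simp add: gap_basis)
  then show ?thesis using that[of "b - a"] val by simp
qed

lemma linear_eq_scaled_gap:
  fixes g :: "(real ^ 'e) \<times> real \<Rightarrow> real"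
  assumes g: "linear g" and B: "\<And>B. basis B \<Longrightarrow> g (indicator_vec B, 1) = \<kappa> * gap F (indicator_vec B, 1)"
  shows "z \<in> cone_over P \<Longrightarrow> g z = \<kappa> * gap F z" "z \<in> cone_lattice P \<Longrightarrow> g z = \<kappa> * gap F z"
proof -
  let ?d = "\<lambda>z. g z - \<kappa> * gap F z"
  have d: "linear ?d"
    using linear_compose_sub[OF g linear_compose_scale_right[OF linear_gap, of \<kappa> F]] by simp
  show "z \<in> cone_over P \<Longrightarrow> g z = \<kappa> * gap F z"
    using linear_zero_on_cone[OF d] B by simp
  show "z \<in> cone_lattice P \<Longrightarrow> g z = \<kappa> * gap F z"
    using linear_zero_on_lattice[OF d] B by simp
qed

lemma flacet_facet:
  assumes conn: "rank_connected r E" and fl: "flacet F"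
  shows "{z \<in> cone_over P. gap F z = 0} facet_of cone_over P"
proof -
  have F: "F \<subset> E" "F \<noteq> {}" "F \<subseteq> E" using fl by (auto simp: flacet_def rank_connected_def)
  obtain B where B: "basis B" "gap F (indicator_vec B, 1) = 1" by (rule basis_gap_one[OF conn F(1,2)])
  then have nz: "gap F (indicator_vec B, 1) \<noteq> 0" by simp
  show ?thesis
  proof (rule facet_of_convex_coneI[OF convex_cone_cone_over linear_gap gap_nonneg[OF F(3)]
        basis_in_cone_over[OF B(1)] nz])
    fix g :: "(real ^ 'e) \<times> real \<Rightarrow> real"
    assume g: "linear g" "\<And>z. z \<in> cone_over P \<Longrightarrow> gap F z = 0 \<Longrightarrow> g z = 0"
    have "g (indicator_vec B, 1) = 0" if "basis B" "card (B \<inter> F) = r F" for B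
      using g(2)[OF basis_in_cone_over[OF that(1)]] that(2) by (simp add: gap_basis)
    then obtain \<kappa> where "\<And>B. basis B \<Longrightarrow> g (indicator_vec B, 1) = \<kappa> * gap F (indicator_vec B, 1)"
      using flacet_form_unique[OF fl g(1)] by blast
    then show "\<exists>\<kappa>. \<forall>z\<in>cone_over P. g z = \<kappa> * gap F z"
      using linear_eq_scaled_gap(1)[OF g(1)] by blast
  qed
qed

lemma reduced_equation_gap:
  assumes conn: "rank_connected r E" and F: "F \<subset> E" "F \<noteq> {}"
  shows "reduced_equation P {z \<in> cone_over P. gap F z = 0} (gap F)"
proof -
  obtain B where B: "basis B" "gap F (indicator_vec B, 1) = 1" by (rule basis_gap_one[OF conn F])
  have "m = 1" if g: "integral_form (cone_lattice P) g" "\<forall>z\<in>cone_lattice P. gap F z = real m * g z" for m g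
  proof -
    have "g (indicator_vec B, 1) \<in> \<int>" using g basis_in_lattice[OF B(1)] by (auto simp: integral_form_def)
    then obtain k where "g (indicator_vec B, 1) = of_int k" by (auto elim: Ints_cases)
    then have "1 = real m * of_int k" using g basis_in_lattice[OF B(1)] B by metis
    then have "of_int 1 = (of_int (int m * k) :: real)" by simp
    then have "int m * k = 1" by (metis of_int_eq_iff)
    then have "int m dvd 1" by (metis dvd_triv_left)
    then show ?thesis by simp
  qed
  then have "primitive_form (cone_lattice P) (gap F)"
    unfolding primitive_form_def using integral_gap by blast
  then show ?thesis using gap_nonneg F by (auto simp: reduced_equation_def)
qed

text \<open>The reduced equation of the facet of a flacet \<open>F\<close> is \<open>gap F\<close> up to a factor, which primitivity
  makes equal to one.\<close>

lemma gorenstein_imp_flacet_equations: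
  assumes conn: "rank_connected r E" and gor: "gorenstein \<delta> P"
  obtains v :: "real ^ 'e" where "(\<Sum>e\<in>E. v $ e) = real \<delta> * real (r E)"
    "\<And>F. flacet F \<Longrightarrow> (\<Sum>e\<in>F. v $ e) = real \<delta> * real (r F) - 1"
proof -
  obtain v where v: "(v, real \<delta>) \<in> cone_lattice P"
    and h: "\<And>\<Phi>. \<Phi> facet_of cone_over P \<Longrightarrow> \<exists>h. reduced_equation P \<Phi> h \<and> h (v, real \<delta>) = 1"
    using gor unfolding gorenstein_def by blast
  \<comment> \<open>The lattice lies in the hyperplane \<open>gap E = 0\<close>; this yields the
    equation for the total of \<open>v\<close>.\<close>
  have "gap E (v, real \<delta>) = 0" by (rule linear_zero_on_lattice[OF linear_gap gap_ground_zero v])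
  then have "(\<Sum>e\<in>E. v $ e) = real \<delta> * real (r E)" by (simp add: gap_def mult.commute)
  moreover have "(\<Sum>e\<in>F. v $ e) = real \<delta> * real (r F) - 1" if fl: "flacet F" for F
  proof -
    have F: "F \<subset> E" "F \<noteq> {}" using fl by (auto simp: flacet_def rank_connected_def)
    obtain h where h: "reduced_equation P {z \<in> cone_over P. gap F z = 0} h" "h (v, real \<delta>) = 1"
      using h[OF flacet_facet[OF conn fl]] by blast
    then have prim: "primitive_form (cone_lattice P) h" and lin: "linear h"
      and int: "\<And>z. z \<in> cone_lattice P \<Longrightarrow> h z \<in> \<int>" and nn: "\<And>z. z \<in> cone_over P \<Longrightarrow> 0 \<le> h z"
      and eq: "{z \<in> cone_over P. gap F z = 0} = {z \<in> cone_over P. h z = 0}"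
      by (auto simp: reduced_equation_def primitive_form_def integral_form_def)
    have "h (indicator_vec B, 1) = 0" if "basis B" "card (B \<inter> F) = r F" for B
    proof -
      have "gap F (indicator_vec B, 1) = 0" using that by (simp add: gap_basis)
      then show ?thesis using eq basis_in_cone_over[OF that(1)] by blast
    qed
    from flacet_form_unique[OF fl lin this] obtain \<kappa> where
      \<kappa>: "\<And>B. basis B \<Longrightarrow> h (indicator_vec B, 1) = \<kappa> * gap F (indicator_vec B, 1)" by blast
    obtain B where B: "basis B" "gap F (indicator_vec B, 1) = 1" by (rule basis_gap_one[OF conn F])
    have hB: "h (indicator_vec B, 1) = \<kappa>" using \<kappa>[OF B(1)] B(2) by simp
    then have "\<kappa> \<in> \<int>" "0 \<le> \<kappa>" using int[OF basis_in_lattice[OF B(1)]] nn[OF basis_in_cone_over[OF B(1)]] by auto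
    then have "\<kappa> \<in> \<nat>" by (simp add: Nats_altdef2)
    then obtain m where m: "\<kappa> = real m" by (auto elim: Nats_cases)
    have all: "h z = real m * gap F z" if "z \<in> cone_lattice P" for z
      using linear_eq_scaled_gap(2)[OF lin \<kappa> that] m by simp
    then have "m = 1" using prim integral_gap unfolding primitive_form_def by blast
    then have "gap F (v, real \<delta>) = 1" using all[OF v] h(2) by simp
    then show ?thesis by (simp add: gap_def mult.commute)
  qed
  ultimately show ?thesis by (rule that)
qed

text \<open>Greedy algorithm: adding the elements in order of decreasing weight keeps the bound, which is
  Abel summation in disguise.\<close>

lemma greedy_bound:
  fixes c :: "'e \<Rightarrow> real"
  assumes "F \<subseteq> E"
  shows "\<exists>B\<subseteq>F. indep B \<and> r B = r F \<and>
    (\<forall>m x. (\<forall>e\<in>F. m \<le> c e) \<longrightarrow> (\<forall>X\<subseteq>E. sum x X \<le> real (r X)) \<longrightarrow>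
       (\<Sum>e\<in>F. c e * x e) - (\<Sum>e\<in>B. c e) \<le> m * (sum x F - real (r F)))"
proof -
  have "finite F" by simp
  then show ?thesis using assms
  proof (induction F rule: finite_ranking_induct[where f = "\<lambda>e. - c e"])
    case empty
    then show ?case by (intro exI[of _ "{}"]) auto
  next
    case (insert e F)
    show ?case
    proof (cases "e \<in> F")
      case True
      then show ?thesis using insert by (simp add: insert_absorb)
    next
      case e: False
      have sub: "F \<subseteq> E" "e \<in> E" using insert.prems by auto
      obtain B where B: "B \<subseteq> F" "indep B" "r B = r F" and
        IH: "\<And>m x. \<forall>e\<in>F. m \<le> c e \<Longrightarrow> \<forall>X\<subseteq>E. sum x X \<le> real (r X) \<Longrightarrow>
          (\<Sum>e\<in>F. c e * x e) - (\<Sum>e\<in>B. c e) \<le> m * (sum x F - real (r F))"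
        using insert.IH[OF sub(1)] by blast
      have le: "\<forall>y\<in>F. c e \<le> c y" using insert.hyps by auto
      \<comment> \<open>The slack is nonpositive, so it suffices to prove the bound for
        \<open>m = c e\<close>, the least weight so far. This is also the value at which the
        induction hypothesis is used.\<close>
      have step: "m * (sum x (insert e F) - real (r (insert e F))) \<ge> c e * (sum x (insert e F) - real (r (insert e F)))"
        if "\<forall>y\<in>insert e F. m \<le> c y" "\<forall>X\<subseteq>E. sum x X \<le> real (r X)" for m x
      proof (rule mult_right_mono_neg)
        show "m \<le> c e" using that by auto
        show "sum x (insert e F) - real (r (insert e F)) \<le> 0" using that insert.prems by auto
      qed
      have "r F \<le> r (insert e F)" using insert.prems by (intro rank_mono) auto
      then consider "r (insert e F) = r F" | "r (insert e F) = Suc (r F)"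
        using rank_insert_le[OF sub] by linarith
      then show ?thesis
      proof cases
        case 1
        have "(\<Sum>y\<in>insert e F. c y * x y) - (\<Sum>y\<in>B. c y) \<le> m * (sum x (insert e F) - real (r (insert e F)))"
          if "\<forall>y\<in>insert e F. m \<le> c y" "\<forall>X\<subseteq>E. sum x X \<le> real (r X)" for m x
          using IH[OF le that(2)] step[OF that] e 1 by (simp add: algebra_simps)
        then show ?thesis using B 1 by (intro exI[of _ B]) auto
      next
        case 2
        have "r (insert e B \<union> F) + r (insert e B \<inter> F) \<le> r (insert e B) + r F"
          using B sub by (intro rank_submodular) auto
        moreover have "insert e B \<union> F = insert e F" "insert e B \<inter> F = B" using B e by auto
        ultimately have "r (insert e B) \<ge> Suc (r F)" using B 2 by simp
        moreover have "e \<notin> B" using B e by auto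
        moreover have "r (insert e B) \<le> Suc (r B)" using B sub by (intro rank_insert_le) auto
        ultimately have iB: "indep (insert e B)" "r (insert e B) = r (insert e F)"
          using B sub 2 by (auto simp: indep_def)
        have "(\<Sum>y\<in>insert e F. c y * x y) - (\<Sum>y\<in>insert e B. c y) \<le> m * (sum x (insert e F) - real (r (insert e F)))"
          if "\<forall>y\<in>insert e F. m \<le> c y" "\<forall>X\<subseteq>E. sum x X \<le> real (r X)" for m x
          using IH[OF le that(2)] step[OF that] e \<open>e \<notin> B\<close> 2 by (simp add: algebra_simps)
        then show ?thesis using B iB by (intro exI[of _ "insert e B"]) auto
      qed
    qed
  qed
qed

text \<open>Edmonds' description: otherwise a hyperplane with normal \<open>a\<close> separates
  \<open>p\<close> from \<open>P\<close>, but for the weights \<open>- a\<close> the greedy basis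
  does at least as well as \<open>p\<close>.\<close>

lemma P_I:
  fixes p :: "real ^ 'e"
  assumes off: "\<And>e. e \<notin> E \<Longrightarrow> p $ e = 0"
    and le: "\<And>F. F \<subseteq> E \<Longrightarrow> (\<Sum>e\<in>F. p $ e) \<le> real (r F)"
    and eq: "(\<Sum>e\<in>E. p $ e) = real (r E)"
  shows "p \<in> P"
proof (rule ccontr)
  assume "p \<notin> P"
  have "finite {indicator_vec B | B. basis B}" by simp
  then have "closed P" unfolding P_def by (intro compact_imp_closed finite_imp_compact_convex_hull)
  moreover have "convex P" by (simp add: P_def)
  ultimately obtain a b where ab: "a \<bullet> p < b" "\<forall>q\<in>P. a \<bullet> q > b"
    using separating_hyperplane_closed_point \<open>p \<notin> P\<close> by blast
  define c where "c e = - (a $ e)" for e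
  define m where "m = Min (insert 0 (c ` E))"
  have m: "\<forall>e\<in>E. m \<le> c e" by (auto simp: m_def)
  from greedy_bound[of E c] obtain B where B: "indep B" "r B = r E" and
    bound: "\<And>m x. \<forall>e\<in>E. m \<le> c e \<Longrightarrow> \<forall>X\<subseteq>E. sum x X \<le> real (r X) \<Longrightarrow>
       (\<Sum>e\<in>E. c e * x e) - (\<Sum>e\<in>B. c e) \<le> m * (sum x E - real (r E))"
    by blast
  have "(\<Sum>e\<in>E. c e * p $ e) \<le> (\<Sum>e\<in>B. c e)"
    using bound[OF m, of "\<lambda>e. p $ e"] le eq by simp
  moreover have "a \<bullet> p = (\<Sum>e\<in>E. a $ e * p $ e)"
    unfolding inner_vec_def using off by (auto intro!: sum.mono_neutral_right)
  then have "a \<bullet> p = - (\<Sum>e\<in>E. c e * p $ e)" by (simp add: c_def sum_negf)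
  moreover have "a \<bullet> indicator_vec B = (\<Sum>e\<in>B. a $ e)"
    by (simp add: inner_vec_def indicator_vec_def if_distrib sum.If_cases cong: if_cong)
  then have "a \<bullet> indicator_vec B = - (\<Sum>e\<in>B. c e)" by (simp add: c_def sum_negf)
  moreover have "a \<bullet> indicator_vec B > b"
    using ab(2) indicator_basis_in_P[of B] B by (auto simp: basis_def)
  ultimately show False using ab(1) by linarith
qed

lemma cone_over_I:
  fixes z :: "(real ^ 'e) \<times> real"
  assumes off: "\<And>e. e \<notin> E \<Longrightarrow> fst z $ e = 0" and t: "0 \<le> snd z"
    and nonneg: "\<And>F. F \<subseteq> E \<Longrightarrow> 0 \<le> gap F z" and eq: "gap E z = 0"
  shows "z \<in> cone_over P"
proof (cases "snd z = 0")
  case True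
  \<comment> \<open>At height 0 all coordinates in \<open>E\<close> are nonpositive and add up to 0,
    so only the apex is left.\<close>
  have le: "fst z $ e \<le> 0" if "e \<in> E" for e
    using nonneg[of "{e}"] that True by (simp add: gap_def)
  have "(\<Sum>e\<in>E. - (fst z $ e)) = 0" using eq True by (simp add: gap_def sum_negf)
  then have "fst z $ e = 0" if "e \<in> E" for e
    using sum_nonneg_eq_0_iff[of E "\<lambda>e. - (fst z $ e)"] le that by auto
  then have "z = 0" using off True by (auto simp: prod_eq_iff vec_eq_iff)
  then show ?thesis using convex_cone_contains_0[OF convex_cone_cone_over] by simp
next
  case False
  then have pos: "0 < snd z" using t by simp
  define p where "p = (1 / snd z) *\<^sub>R fst z"
  have sum: "(\<Sum>e\<in>F. p $ e) = (\<Sum>e\<in>F. fst z $ e) / snd z" for F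
    by (simp add: p_def sum_divide_distrib)
  have "p \<in> P"
  proof (rule P_I)
    show "(\<Sum>e\<in>F. p $ e) \<le> real (r F)" if "F \<subseteq> E" for F
      using nonneg[OF that] pos unfolding sum by (simp add: gap_def divide_le_eq)
    show "(\<Sum>e\<in>E. p $ e) = real (r E)" using eq pos unfolding sum by (simp add: gap_def field_simps)
  qed (use off in \<open>auto simp: p_def\<close>)
  then have "snd z *\<^sub>R (p, 1) \<in> cone_over P"
    using in_cone_over pos by (intro convex_cone_scaleR[OF convex_cone_cone_over]) auto
  moreover have "snd z *\<^sub>R (p, 1) = z" using pos by (simp add: p_def prod_eq_iff)
  ultimately show ?thesis by simp
qed

text \<open>A point of a face on which no \<open>gap F\<close> with \<open>{} \<noteq> F \<subset> E\<close> vanishes is an interior point of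
  the cone, so a proper face lies on one of these hyperplanes.\<close>

lemma facet_in_gap_hyperplane:
  assumes conn: "rank_connected r E" and two: "2 \<le> card E" and facet: "\<Phi> facet_of cone_over P"
  obtains F where "F \<subset> E" "F \<noteq> {}" "\<forall>z\<in>\<Phi>. gap F z = 0"
proof (rule ccontr)
  let ?R = "{F. F \<subset> E \<and> F \<noteq> {}}"
  let ?C = "cone_over P"
  note face = facet_of_imp_face_of[OF facet]
  have sub: "\<Phi> \<subseteq> ?C" and cvx: "convex \<Phi>"
    by (rule facet_of_imp_subset[OF facet], rule face_of_imp_convex[OF face])
  assume "\<not> thesis"
  then have "\<not> (F \<subset> E \<and> F \<noteq> {} \<and> (\<forall>z\<in>\<Phi>. gap F z = 0))" for F using that[of F] by blast
  then have "\<forall>F\<in>?R. \<exists>z. z \<in> \<Phi> \<and> gap F z \<noteq> 0" by blast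
  from bchoice[OF this] obtain f where "\<forall>F\<in>?R. f F \<in> \<Phi> \<and> gap F (f F) \<noteq> 0" by (elim exE)
  then have f: "\<And>F. F \<in> ?R \<Longrightarrow> f F \<in> \<Phi>" "\<And>F. F \<in> ?R \<Longrightarrow> gap F (f F) \<noteq> 0" by blast+
  have fpos: "0 < gap F (f F)" if "F \<in> ?R" for F
    using gap_nonneg[of F "f F"] f[OF that] sub that by fastforce
  obtain e where e: "e \<in> E" using conn by (auto simp: rank_connected_def)
  have "card {e} < card E" using two by simp
  then have "{e} \<in> ?R" using e by auto
  then have R: "?R \<noteq> {}" "finite ?R" by auto
  define N where "N = real (card ?R)"
  have N: "N > 0" using R by (simp add: N_def card_gt_0_iff)
  \<comment> \<open>The average of points at each of which one of the finitely many slacks is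
    positive: at \<open>z\<close> all of them are.\<close>
  define z where "z = (\<Sum>F\<in>?R. (1 / N) *\<^sub>R f F)"
  have "(\<Sum>F\<in>?R. 1 / N) = N * (1 / N)" by (simp only: sum_constant N_def)
  also have "\<dots> = 1" using N by simp
  finally have z: "z \<in> \<Phi>" unfolding z_def
    by (rule convex_sum[OF R(2) cvx _ _ f(1)]) (use N in simp_all)
  have gz: "0 < gap F z" if F: "F \<in> ?R" for F
  proof -
    have "gap F z = (\<Sum>F'\<in>?R. (1 / N) * gap F (f F'))"
      unfolding z_def by (simp add: linear_sum[OF linear_gap] linear_scale[OF linear_gap])
    moreover have "0 < (\<Sum>F'\<in>?R. (1 / N) * gap F (f F'))"
    proof (rule sum_pos2[OF R(2) F])
      show "0 < (1 / N) * gap F (f F)" using fpos[OF F] N by simp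
      fix F' assume "F' \<in> ?R"
      then have "f F' \<in> ?C" using f sub by auto
      then show "0 \<le> (1 / N) * gap F (f F')" using gap_nonneg[of F "f F'"] F N by auto
    qed
    ultimately show ?thesis by simp
  qed
  have "?C \<subseteq> \<Phi>"
  proof
    fix c assume c: "c \<in> ?C"
    show "c \<in> \<Phi>"
    proof (cases "c = z")
      case False
      \<comment> \<open>As \<open>gap F c\<close> is at most \<open>M\<close> times
        \<open>gap F z\<close>, the segment from \<open>c\<close> to \<open>z\<close> can be
        prolonged beyond \<open>z\<close> by the fraction \<open>1 / (M + 1)\<close> of its length
        without any slack becoming negative.\<close>
      define M where "M = Max ((\<lambda>F. gap F c / gap F z) ` ?R)"
      have M: "gap F c \<le> M * gap F z" if "F \<in> ?R" for F
      proof -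
        have "gap F c / gap F z \<le> M" unfolding M_def using R that by (intro Max_ge) auto
        then show ?thesis using gz[OF that] by (simp add: pos_divide_le_eq)
      qed
      have M0: "0 \<le> M"
      proof -
        obtain F where F: "F \<in> ?R" using R by auto
        then have "0 \<le> gap F c / gap F z" using gz[OF F] gap_nonneg[of F c] c by auto
        also have "\<dots> \<le> M" unfolding M_def using R F by (intro Max_ge) auto
        finally show ?thesis .
      qed
      define \<epsilon> where "\<epsilon> = 1 / (M + 1)"
      have \<epsilon>: "\<epsilon> > 0" "\<epsilon> * M \<le> 1" using M0 by (auto simp: \<epsilon>_def field_simps)
      define y where "y = z + \<epsilon> *\<^sub>R (z - c)"
      have gy: "gap F y = (1 + \<epsilon>) * gap F z - \<epsilon> * gap F c" for F
        unfolding y_def using linear_gap[of F]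
        by (simp add: linear_add linear_scale linear_diff algebra_simps)
      have zC: "z \<in> ?C" using z sub by auto
      have lin_off: "linear (\<lambda>x :: (real ^ 'e) \<times> real. fst x $ e)" for e
        by (rule linearI) auto
      have off: "fst x $ e = 0" if "x \<in> ?C" "e \<notin> E" for x e
        by (rule linear_zero_on_cone[OF lin_off _ that(1)])
          (use basis_subset that(2) in \<open>auto simp: indicator_vec_def\<close>)
      have zero: "gap E x = 0" if "x \<in> ?C" for x
        by (rule linear_zero_on_cone[OF linear_gap gap_ground_zero that])
      have gyR: "0 \<le> gap F y" if F: "F \<subseteq> E" for F
      proof -
        consider "F = {}" | "F = E" | "F \<in> ?R" using F by auto
        then show ?thesis
        proof cases
          case 1 then show ?thesis by (simp add: gap_def)
        next
          case 2 then show ?thesis using gy[of E] zero zC c by simp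
        next
          case 3
          have "\<epsilon> * gap F c \<le> \<epsilon> * (M * gap F z)" using M[OF 3] \<epsilon> by simp
          also have "\<dots> = (\<epsilon> * M) * gap F z" by simp
          also have "\<dots> \<le> 1 * gap F z" using \<epsilon> gz[OF 3] by (intro mult_right_mono) auto
          finally have "\<epsilon> * gap F c \<le> gap F z" by simp
          moreover have "0 < \<epsilon> * gap F z" using \<epsilon> gz[OF 3] by simp
          ultimately show ?thesis unfolding gy by (simp add: algebra_simps)
        qed
      qed
      have yE: "gap E y = 0" using gy[of E] zero zC c by simp
      have "r E > 0"
      proof -
        have "r {e} = 1" using rank_singleton_connected(1)[OF conn two e] .
        then show ?thesis using rank_mono[of "{e}" E] e by simp
      qed
      \<comment> \<open>The height of \<open>y\<close> is controlled by its coordinates: no element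
        is a coloop, so \<open>gap (E - {d}) y\<close> is the coordinate at
        \<open>d\<close>.\<close>
      moreover have "0 \<le> real (r E) * snd y"
      proof -
        have "0 \<le> fst y $ d" if d: "d \<in> E" for d
        proof -
          have "0 \<le> gap (E - {d}) y" by (rule gyR) auto
          moreover have "(\<Sum>e\<in>E. fst y $ e) = fst y $ d + (\<Sum>e\<in>E - {d}. fst y $ e)"
            using d by (intro sum.remove) auto
          ultimately show ?thesis
            using yE rank_singleton_connected(2)[OF conn two d] by (simp add: gap_def)
        qed
        then have "0 \<le> (\<Sum>e\<in>E. fst y $ e)" by (intro sum_nonneg)
        then show ?thesis using yE by (simp add: gap_def)
      qed
      ultimately have "0 \<le> snd y" by (simp add: zero_le_mult_iff)
      moreover have "fst y $ d = 0" if "d \<notin> E" for d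
        using off[OF zC that] off[OF c that] by (simp add: y_def)
      ultimately have yC: "y \<in> ?C" using gyR yE by (intro cone_over_I)
      have "z = (1 - \<epsilon> / (1 + \<epsilon>)) *\<^sub>R y + (\<epsilon> / (1 + \<epsilon>)) *\<^sub>R c"
      proof -
        have "(1 + \<epsilon>) *\<^sub>R ((1 - \<epsilon> / (1 + \<epsilon>)) *\<^sub>R y + (\<epsilon> / (1 + \<epsilon>)) *\<^sub>R c) = y + \<epsilon> *\<^sub>R c"
          using \<epsilon> by (simp add: scaleR_add_right right_diff_distrib)
        also have "\<dots> = (1 + \<epsilon>) *\<^sub>R z" by (simp add: y_def algebra_simps)
        finally have "(1 + \<epsilon>) *\<^sub>R ((1 - \<epsilon> / (1 + \<epsilon>)) *\<^sub>R y + (\<epsilon> / (1 + \<epsilon>)) *\<^sub>R c) = (1 + \<epsilon>) *\<^sub>R z" .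
        then show ?thesis using \<epsilon>(1) by (simp only: scaleR_cancel_left) simp
      qed
      moreover have "y \<noteq> c"
      proof
        assume "y = c"
        then have "(1 + \<epsilon>) *\<^sub>R (z - c) = 0" by (simp add: y_def algebra_simps)
        then show False using \<epsilon> False by auto
      qed
      moreover have "0 < \<epsilon> / (1 + \<epsilon>)" "\<epsilon> / (1 + \<epsilon>) < 1" using \<epsilon> by auto
      ultimately have "z \<in> open_segment y c" unfolding in_segment by blast
      then show ?thesis using face yC c z unfolding face_of_def by blast
    qed (use z in simp)
  qed
  then have "\<Phi> = ?C" using sub by auto
  then show False using facet by simp
qed

text \<open>The hyperplane cuts out a proper face, as \<open>gap F\<close> is 1 at some basis. A
  facet strictly inside that face would have codimension at least two.\<close>

lemma facet_eq_gap_face: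
  assumes conn: "rank_connected r E" and F: "F \<subset> E" "F \<noteq> {}" and facet: "\<Phi> facet_of cone_over P"
    and zero: "\<And>z. z \<in> \<Phi> \<Longrightarrow> gap F z = 0"
  shows "\<Phi> = {z \<in> cone_over P. gap F z = 0}" (is "_ = ?G")
proof (rule ccontr)
  let ?C = "cone_over P"
  assume ne: "\<Phi> \<noteq> ?G"
  note face = facet_of_imp_face_of[OF facet]
  have sub: "\<Phi> \<subseteq> ?G" using facet_of_imp_subset[OF facet] zero by auto
  have G: "?G face_of ?C"
    by (rule nonneg_linear_face_of[OF linear_gap convex_cone_over gap_nonneg]) (use F in auto)
  have "\<Phi> face_of ?G" by (rule face_of_subset[OF face sub]) auto
  then have "aff_dim \<Phi> < aff_dim ?G"
    using face_of_aff_dim_lt[OF _ _ ne] G by (simp add: face_of_imp_convex[OF G])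
  moreover obtain B where B: "basis B" "gap F (indicator_vec B, 1) = 1" by (rule basis_gap_one[OF conn F])
  have nG: "(indicator_vec B, 1) \<notin> ?G" using B(2) by simp
  have "?G \<noteq> ?C"
  proof
    assume eq: "?G = ?C"
    have "(indicator_vec B, 1) \<in> ?G" unfolding eq by (rule basis_in_cone_over[OF B(1)])
    with nG show False by (rule notE)
  qed
  then have "aff_dim ?G < aff_dim ?C" using face_of_aff_dim_lt[OF convex_cone_over G] by simp
  ultimately show False using facet by (simp add: facet_of_def)
qed

text \<open>The two slacks are proportional on the cone, but as forms only modulo
  \<open>x(E) = r(E) t\<close>: the difference \<open>d\<close> has some constant coefficient
  \<open>a\<close> on \<open>E\<close>. Both sets being proper forces \<open>a = 0\<close>, and then
  their indicators are proportional.\<close>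

lemma gap_vanishing_unique:
  assumes conn: "rank_connected r E" and facet: "\<Phi> facet_of cone_over P"
    and F: "F \<subset> E" "F \<noteq> {}" "\<And>z. z \<in> \<Phi> \<Longrightarrow> gap F z = 0"
    and F': "F' \<subset> E" "F' \<noteq> {}" "\<And>z. z \<in> \<Phi> \<Longrightarrow> gap F' z = 0"
  shows "F' = F"
proof -
  obtain B where B: "basis B" "gap F (indicator_vec B, 1) = 1" by (rule basis_gap_one[OF conn F(1,2)])
  obtain \<kappa> where \<kappa>: "\<And>z. z \<in> cone_over P \<Longrightarrow> gap F' z = \<kappa> * gap F z"
    by (rule facet_of_convex_cone_form_unique[OF convex_cone_cone_over facet linear_gap F(3)
          basis_in_cone_over[OF B(1)] _ linear_gap F'(3)]) (use B in auto)
  obtain B' where B': "basis B'" "gap F' (indicator_vec B', 1) = 1" by (rule basis_gap_one[OF conn F'(1,2)])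
  have pos: "\<kappa> > 0"
  proof -
    have "1 = \<kappa> * gap F (indicator_vec B', 1)" using \<kappa>[OF basis_in_cone_over[OF B'(1)]] B' by simp
    moreover have "0 \<le> gap F (indicator_vec B', 1)" using gap_nonneg F(1) basis_in_cone_over[OF B'(1)] by auto
    ultimately show ?thesis by (metis zero_less_mult_pos2 less_eq_real_def mult_zero_right zero_less_one zero_neq_one)
  qed
  define d where "d = (\<lambda>z. gap F' z - \<kappa> * gap F z)"
  have d: "linear d" unfolding d_def
    using linear_compose_sub[OF linear_gap linear_compose_scale_right[OF linear_gap, of \<kappa> F]] by simp
  have dB: "d (indicator_vec B, 1) = 0" if "basis B" for B
    using \<kappa>[OF basis_in_cone_over[OF that]] by (simp add: d_def)
  have "\<exists>a. \<forall>e\<in>E. d (axis e 1, 0) = a"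
    by (rule exchange_closed_connected[OF conn]) (use linear_exchange[OF d] dB in simp)
  then obtain a where a: "\<And>e. e \<in> E \<Longrightarrow> d (axis e 1, 0) = a" by blast
  have dv: "d (axis e 1, 0) = \<kappa> * (if e \<in> F then 1 else 0) - (if e \<in> F' then 1 else 0)" for e
    by (auto simp: d_def gap_def axis_def sum.delta)
  obtain x where x: "x \<in> E" "x \<notin> F" using F by auto
  obtain y where y: "y \<in> E" "y \<in> F" using F by auto
  obtain x' where x': "x' \<in> E" "x' \<notin> F'" using F' by auto
  obtain y' where y': "y' \<in> E" "y' \<in> F'" using F' by auto
  have a0: "a = 0"
  proof (rule ccontr)
    \<comment> \<open>Outside \<open>F\<close> a nonzero coefficient of \<open>d\<close> can only be
      \<open>-1\<close>; outside \<open>F'\<close> a coefficient is \<open>0\<close> or the positive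
      \<open>\<kappa>\<close>.\<close>
    assume "a \<noteq> 0"
    then have "x \<in> F'" "a = -1" using a[OF x(1)] dv[of x] x by (auto split: if_splits)
    then show False using a[OF x'(1)] dv[of x'] x' pos by (auto split: if_splits)
  qed
  have "e \<in> F' \<longleftrightarrow> e \<in> F" if "e \<in> E" for e
    using a[OF that] dv[of e] a0 pos by (auto split: if_splits)
  then show ?thesis using F F' by blast
qed

text \<open>If some \<open>A\<close> separated the restriction to \<open>F\<close> or the
  contraction by \<open>F\<close>, then on the cone \<open>gap F\<close> would be at least the sum
  of two nonnegative slacks. These would vanish on the facet too, against the uniqueness of
  \<open>F\<close>.\<close>

lemma facet_is_flacet:
  assumes conn: "rank_connected r E" and two: "2 \<le> card E" and facet: "\<Phi> facet_of cone_over P"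
  obtains F where "flacet F" "\<Phi> = {z \<in> cone_over P. gap F z = 0}"
proof -
  obtain F where F: "F \<subset> E" "F \<noteq> {}" "\<forall>z\<in>\<Phi>. gap F z = 0"
    by (rule facet_in_gap_hyperplane[OF conn two facet])
  note F0 = bspec[OF F(3)]
  have sub: "\<Phi> \<subseteq> cone_over P" by (rule facet_of_imp_subset[OF facet])
  note uniq = gap_vanishing_unique[OF conn facet F(1,2) F0]
  have c1: "rank_connected r F"
  proof (rule ccontr)
    assume "\<not> ?thesis"
    then obtain A where A: "A \<subset> F" "A \<noteq> {}" "r A + r (F - A) \<le> r F"
      using F(2) unfolding rank_connected_def by (meson not_less)
    have "gap A z = 0" if z: "z \<in> \<Phi>" for z
    proof -
      have zC: "z \<in> cone_over P" using z sub by auto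
      have snd: "0 \<le> snd z"
      proof (rule linear_nonneg_on_cone[OF _ _ zC])
        show "linear (snd :: (real ^ 'e) \<times> real \<Rightarrow> real)" by (rule linearI) auto
      qed simp
      have "(\<Sum>e\<in>F. fst z $ e) = (\<Sum>e\<in>A. fst z $ e) + (\<Sum>e\<in>F - A. fst z $ e)"
        using A by (intro sum.subset_diff[of A F, THEN trans] add.commute) auto
      moreover have "(real (r A) + real (r (F - A))) * snd z \<le> real (r F) * snd z"
        using A(3) snd by (intro mult_right_mono) (auto simp flip: of_nat_add)
      ultimately have "gap A z + gap (F - A) z \<le> gap F z" by (simp add: gap_def algebra_simps)
      moreover have "0 \<le> gap A z" "0 \<le> gap (F - A) z"
        by (rule gap_nonneg[OF _ zC]; use A(1) F(1) in blast)+
      ultimately show ?thesis using F0[OF z] by simp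
    qed
    then have "A = F" using A F by (intro uniq) auto
    then show False using A by simp
  qed
  moreover have "r E + r F < r A + r (F \<union> (E - A))" if A: "F \<subset> A" "A \<subset> E" for A
  proof (rule ccontr)
    assume "\<not> ?thesis"
    then have le: "r A + r (F \<union> (E - A)) \<le> r E + r F" by simp
    have "gap A z = 0" if z: "z \<in> \<Phi>" for z
    proof -
      have zC: "z \<in> cone_over P" using z sub by auto
      have snd: "0 \<le> snd z"
      proof (rule linear_nonneg_on_cone[OF _ _ zC])
        show "linear (snd :: (real ^ 'e) \<times> real \<Rightarrow> real)" by (rule linearI) auto
      qed simp
      have "(\<Sum>e\<in>A. fst z $ e) + (\<Sum>e\<in>F \<union> (E - A). fst z $ e) = (\<Sum>e\<in>E. fst z $ e) + (\<Sum>e\<in>F. fst z $ e)"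
      proof -
        have "(\<Sum>e\<in>A \<union> (F \<union> (E - A)). fst z $ e) + (\<Sum>e\<in>A \<inter> (F \<union> (E - A)). fst z $ e)
            = (\<Sum>e\<in>A. fst z $ e) + (\<Sum>e\<in>F \<union> (E - A). fst z $ e)"
          by (rule sum.union_inter) auto
        moreover have "A \<union> (F \<union> (E - A)) = E" "A \<inter> (F \<union> (E - A)) = F" using A by auto
        ultimately show ?thesis by simp
      qed
      moreover have "(real (r A) + real (r (F \<union> (E - A)))) * snd z \<le> (real (r E) + real (r F)) * snd z"
        using le snd by (intro mult_right_mono) (auto simp flip: of_nat_add)
      ultimately have "gap A z + gap (F \<union> (E - A)) z \<le> gap E z + gap F z" by (simp add: gap_def algebra_simps)
      moreover have "0 \<le> gap A z" "0 \<le> gap (F \<union> (E - A)) z"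
        by (rule gap_nonneg[OF _ zC]; use A F(1) in blast)+
      moreover have "gap E z = 0" by (rule linear_zero_on_cone[OF linear_gap gap_ground_zero zC])
      ultimately show ?thesis using F0[OF z] by simp
    qed
    then have "A = F" using A by (intro uniq) auto
    then show False using A by simp
  qed
  ultimately have "flacet F" using F(1) by (auto simp: flacet_def)
  moreover have "\<Phi> = {z \<in> cone_over P. gap F z = 0}" by (rule facet_eq_gap_face[OF conn F(1,2) facet F0])
  ultimately show ?thesis by (rule that)
qed

section \<open>Integral points of the lattice\<close>

lemma axis_diff_in_lattice:
  assumes conn: "rank_connected r E" and ij: "i \<in> E" "j \<in> E"
  shows "(axis i 1 - axis j 1, 0) \<in> cone_lattice P"
proof -
  let ?L = "cone_lattice P"
  note diff = cone_lattice_diff[of _ P]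
  have zero: "0 \<in> ?L" by (simp add: cone_lattice_def)
  \<comment> \<open>\<open>g i\<close> is the class of \<open>i\<close> modulo the lattice.
    Exchanged elements are in the same class, so connectedness leaves a single class.\<close>
  define g where "g i = {k. (axis i 1 - axis k 1, 0) \<in> ?L}" for i
  have cls: "g a = g b" if ab: "(axis a 1 - axis b 1, 0) \<in> ?L" for a b
  proof -
    have "(axis b 1 - axis a 1, 0) \<in> ?L" using diff[OF zero ab] by (simp add: zero_prod_def)
    then have "(axis a 1 - axis k 1, 0) \<in> ?L \<longleftrightarrow> (axis b 1 - axis k 1, 0) \<in> ?L" for k
      using diff[OF _ ab, of "(axis a 1 - axis k 1, 0)"]
        diff[of "(axis b 1 - axis k 1, 0)" "(axis b 1 - axis a 1, 0)"] by (intro iffI) simp_all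
    then show ?thesis by (simp add: g_def)
  qed
  have "\<exists>a. \<forall>e\<in>E. g e = a"
  proof (rule exchange_closed_connected[OF conn])
    fix B i j assume B: "basis B" "i \<in> B" "j \<in> E" "j \<notin> B" "basis (insert j (B - {i}))"
    have "(indicator_vec B, 1) - (indicator_vec (insert j (B - {i})), 1) \<in> ?L"
      by (rule diff[OF basis_in_lattice[OF B(1)] basis_in_lattice[OF B(5)]])
    moreover have "indicator_vec B - indicator_vec (insert j (B - {i})) = axis i 1 - axis j 1"
      using B(2,4) by (auto simp: vec_eq_iff indicator_vec_def axis_def)
    ultimately show "g i = g j" by (intro cls) simp
  qed
  then obtain a where "\<forall>e\<in>E. g e = a" by (rule exE)
  then have "g i = g j" using ij by simp
  moreover have "j \<in> g j" using zero by (simp add: g_def zero_prod_def)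
  ultimately have "j \<in> g i" by simp
  then show ?thesis by (simp add: g_def)
qed

text \<open>After subtracting \<open>d\<close> times a basis the coordinates add up to 0, and such a
  vector is an integral combination of differences of unit vectors.\<close>

lemma integral_point_in_lattice:
  fixes v :: "'e \<Rightarrow> int"
  assumes conn: "rank_connected r E" and off: "\<And>e. e \<notin> E \<Longrightarrow> v e = 0"
    and tot: "(\<Sum>e\<in>E. v e) = int d * int (r E)"
  shows "((\<chi> e. of_int (v e)), real d) \<in> cone_lattice P"
proof -
  obtain B where B: "basis B" using basis_exists by blast
  obtain a where a: "a \<in> E" using conn by (auto simp: rank_connected_def)
  define u where "u e = v e - (if e \<in> B then int d else 0)" for e
  have BE: "B \<subseteq> E" by (rule basis_subset[OF B])
  have su: "(\<Sum>e\<in>E. u e) = 0"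
  proof -
    have "(\<Sum>e\<in>E. if e \<in> B then int d else 0) = int d * int (card B)"
      using BE by (simp add: sum.If_cases Int_absorb1)
    then show ?thesis using tot card_basis[OF B] by (simp add: u_def sum_subtractf)
  qed
  have uoff: "u e = 0" if "e \<notin> E" for e using that off BE by (auto simp: u_def)
  have L: "real d *\<^sub>R (indicator_vec B, 1) + (\<Sum>e\<in>E. of_int (u e) *\<^sub>R (axis e 1 - axis a 1, 0)) \<in> cone_lattice P"
    using basis_in_lattice[OF B] axis_diff_in_lattice[OF conn _ a] unfolding cone_lattice_def
    by (intro group_closure_add group_closure_sum group_closure_of_int_scaleR group_closure_of_nat_scaleR)
  have "real d * indicator_vec B $ i + (\<Sum>e\<in>E. of_int (u e) * (axis e 1 - axis a 1) $ i) = of_int (v i)" for i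
  proof -
    have "(\<Sum>e\<in>E. of_int (u e) * (axis e 1 - axis a 1) $ i)
        = (\<Sum>e\<in>E. of_int (u e) * axis e 1 $ i) - (\<Sum>e\<in>E. of_int (u e)) * axis a (1::real) $ i"
      by (simp add: algebra_simps sum_subtractf sum_distrib_left sum_distrib_right)
    also have "(\<Sum>e\<in>E. of_int (u e)) = (0::real)" using su by (metis of_int_0 of_int_sum)
    also have "(\<Sum>e\<in>E. of_int (u e) * axis e (1::real) $ i) = (\<Sum>e\<in>E. if e = i then of_int (u e) else 0)"
      by (rule sum.cong) (auto simp: axis_def)
    also have "\<dots> = of_int (u i)" using uoff by (auto simp: sum.delta)
    finally show ?thesis by (simp add: u_def indicator_vec_def)
  qed
  then have "real d *\<^sub>R (indicator_vec B, 1) + (\<Sum>e\<in>E. of_int (u e) *\<^sub>R (axis e 1 - axis a 1, 0))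
      = ((\<chi> e. of_int (v e)), real d)"
    by (simp add: prod_eq_iff vec_eq_iff fst_sum snd_sum)
  then show ?thesis using L by simp
qed

section \<open>Sufficient equations for the Gorenstein property, and the case of a coloop\<close>

lemma gorenstein_if_flacet_equations:
  fixes v :: "'e \<Rightarrow> int"
  assumes conn: "rank_connected r E" and two: "2 \<le> card E" and \<delta>: "1 \<le> \<delta>"
    and off: "\<And>e. e \<notin> E \<Longrightarrow> v e = 0"
    and tot: "(\<Sum>e\<in>E. v e) = int \<delta> * int (r E)"
    and le: "\<And>F. F \<subseteq> E \<Longrightarrow> (\<Sum>e\<in>F. v e) \<le> int \<delta> * int (r F)"
    and fl: "\<And>F. flacet F \<Longrightarrow> (\<Sum>e\<in>F. v e) = int \<delta> * int (r F) - 1"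
  shows "gorenstein \<delta> P"
  unfolding gorenstein_def
proof (rule exI[of _ "\<chi> e. real_of_int (v e)"], intro conjI allI impI)
  let ?v = "\<chi> e. real_of_int (v e)"
  have sumv: "(\<Sum>e\<in>F. ?v $ e) = real_of_int (\<Sum>e\<in>F. v e)" for F by simp
  show "?v \<in> (\<lambda>p. real \<delta> *\<^sub>R p) ` P"
  proof (rule image_eqI)
    let ?p = "(1 / real \<delta>) *\<^sub>R ?v"
    show "?v = real \<delta> *\<^sub>R ?p" using \<delta> by simp
    have sump: "(\<Sum>e\<in>F. ?p $ e) = real_of_int (\<Sum>e\<in>F. v e) / real \<delta>" for F
      by (simp add: sum_divide_distrib)
    show "?p \<in> P"
    proof (rule P_I)
      show "(\<Sum>e\<in>F. ?p $ e) \<le> real (r F)" if "F \<subseteq> E" for F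
      proof -
        have "real_of_int (\<Sum>e\<in>F. v e) \<le> real_of_int (int \<delta> * int (r F))" using le[OF that] by (rule of_int_le_iff[THEN iffD2])
        then show ?thesis unfolding sump using \<delta> by (simp add: divide_le_eq mult.commute)
      qed
      show "(\<Sum>e\<in>E. ?p $ e) = real (r E)" unfolding sump tot using \<delta> by simp
    qed (use off in simp)
  qed
  show "(?v, real \<delta>) \<in> cone_lattice P" by (rule integral_point_in_lattice[OF conn off tot])
  fix \<Phi> assume facet: "\<Phi> facet_of cone_over P"
  obtain F where F: "flacet F" "\<Phi> = {z \<in> cone_over P. gap F z = 0}" by (rule facet_is_flacet[OF conn two facet])
  have "reduced_equation P \<Phi> (gap F)"
    using F reduced_equation_gap[OF conn, of F] by (auto simp: flacet_def rank_connected_def)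
  moreover have "gap F (?v, real \<delta>) = real_of_int (int \<delta> * int (r F) - (\<Sum>e\<in>F. v e))"
    by (simp add: gap_def mult.commute)
  then have "gap F (?v, real \<delta>) = 1" unfolding fl[OF F(1)] by simp
  ultimately show "\<exists>h. reduced_equation P \<Phi> h \<and> h (?v, real \<delta>) = 1" by blast
qed

text \<open>For a single coloop the cone is a ray and the only facet is its apex.\<close>

lemma gorenstein_coloop:
  assumes E: "E = {e}" and re: "r E = 1" and \<delta>: "1 \<le> \<delta>"
  shows "gorenstein \<delta> P \<longleftrightarrow> \<delta> = 1"
proof -
  let ?b = "(indicator_vec {e} :: real ^ 'e, 1 :: real)"
  have r1: "r {e} = 1" using E re by simp
  have "basis B \<longleftrightarrow> B = {e}" for B
  proof
    assume "basis B" then show "B = {e}"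
      using basis_subset[of B] card_basis[of B] re E by (auto simp: subset_singleton_iff)
  next
    assume B: "B = {e}"
    have "indep {e}" unfolding indep_def by (simp add: E r1)
    then show "basis B" unfolding B basis_def using r1 re by simp
  qed
  then have P: "P = {indicator_vec {e}}" by (simp add: P_def)
  have int: "indicator_vec {e} $ i \<in> \<int>" for i by (simp add: indicator_vec_def)
  have "{p \<in> P. \<forall>i. p $ i \<in> \<int>} \<times> {1} = {?b}" using int by (auto simp: P)
  then have L: "cone_lattice P = group_closure {?b}" by (simp add: cone_lattice_def)
  have Lform: "\<exists>k. z = of_int k *\<^sub>R ?b" if "z \<in> cone_lattice P" for z
    using that unfolding L
  proof (induction rule: group_closure.induct)
    case (base s)
    then have "s = of_int (if s = 0 then 0 else 1) *\<^sub>R ?b" by (auto simp: zero_prod_def)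
    then show ?case by blast
  next
    case (diff s t)
    then obtain k l where "s = of_int k *\<^sub>R ?b" "t = of_int l *\<^sub>R ?b" by blast
    then have "s - t = of_int (k - l) *\<^sub>R ?b" by (simp add: algebra_simps)
    then show ?case by blast
  qed
  have bL: "?b \<in> cone_lattice P" unfolding L by (rule group_closure.base) simp
  have bC: "?b \<in> cone_over P" by (rule in_cone_over) (simp add: P)
  have lin: "linear (snd :: (real ^ 'e) \<times> real \<Rightarrow> real)" by (rule linearI) auto
  have C: "z = snd z *\<^sub>R ?b \<and> 0 \<le> snd z" if "z \<in> cone_over P" for z
  proof -
    have "cone_over P \<subseteq> {z. z = snd z *\<^sub>R ?b \<and> 0 \<le> snd z}"
      unfolding cone_over_def
    proof (rule hull_minimal)
      show "convex_cone {z. z = snd z *\<^sub>R ?b \<and> 0 \<le> snd z}"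
        unfolding convex_cone_iff by (auto simp: prod_eq_iff scaleR_add_left)
    qed (simp add: P)
    then show ?thesis using that by auto
  qed
  have zset: "{z \<in> cone_over P. snd z = 0} = {0}"
    using C convex_cone_contains_0[OF convex_cone_cone_over] by (fastforce simp: zero_prod_def)
  have "{z \<in> cone_over P. snd z = 0} facet_of cone_over P"
  proof (rule facet_of_convex_coneI[OF convex_cone_cone_over lin _ bC])
    fix g :: "(real ^ 'e) \<times> real \<Rightarrow> real" assume g: "linear g"
    have "g z = g ?b * snd z" if "z \<in> cone_over P" for z
      using C[OF that] linear_scale[OF g, of "snd z" ?b] by simp
    then show "\<exists>\<kappa>. \<forall>z\<in>cone_over P. g z = \<kappa> * snd z" by blast
  qed (use C in auto)
  then have facet: "{0} facet_of cone_over P" using zset by simp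
  show ?thesis
  proof
    assume "gorenstein \<delta> P"
    then obtain v h where v: "v \<in> (\<lambda>p. real \<delta> *\<^sub>R p) ` P" and h: "reduced_equation P {0} h" "h (v, real \<delta>) = 1"
      unfolding gorenstein_def using facet by blast
    have "(v, real \<delta>) = real \<delta> *\<^sub>R ?b" using v by (simp add: P)
    moreover have "linear h" "h ?b \<in> \<int>" using h bL
      by (auto simp: reduced_equation_def primitive_form_def integral_form_def)
    moreover then obtain k where k: "h ?b = of_int k" by (auto elim: Ints_cases)
    ultimately have "real \<delta> * of_int k = 1" using h(2) linear_scale[of h "real \<delta>" ?b] by simp
    then have "of_int (int \<delta> * k) = (of_int 1 :: real)" by simp
    then have "int \<delta> * k = 1" by (metis of_int_eq_iff)
    then have "int \<delta> dvd 1" by (metis dvd_triv_left)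
    then show "\<delta> = 1" by simp
  next
    assume \<delta>1: "\<delta> = 1"
    show "gorenstein \<delta> P"
      unfolding gorenstein_def
    proof (rule exI[of _ "indicator_vec {e}"], intro conjI allI impI)
      show "indicator_vec {e} \<in> (\<lambda>p. real \<delta> *\<^sub>R p) ` P" by (simp add: P \<delta>1)
      show "(indicator_vec {e}, real \<delta>) \<in> cone_lattice P" using bL by (simp add: \<delta>1)
      fix \<Phi> assume F: "\<Phi> facet_of cone_over P"
      note face = facet_of_imp_face_of[OF F]
      have "0 \<in> \<Phi>" by (rule zero_mem_face_of_convex_cone[OF convex_cone_cone_over face]) (use F in \<open>simp add: facet_of_def\<close>)
      \<comment> \<open>A face of the ray with a nonzero point is the whole ray, so no facet but the
        apex exists.\<close>
      moreover have "z = 0" if z: "z \<in> \<Phi>" for z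
      proof (rule ccontr)
        assume z0: "z \<noteq> 0"
        have zC: "z \<in> cone_over P" using z face by (auto simp: face_of_def)
        have pos: "0 < snd z" using C[OF zC] z0 by (metis less_eq_real_def scaleR_zero_left)
        have "x \<in> \<Phi>" if x: "x \<in> cone_over P" for x
        proof -
          define y where "y = (2 * snd z + snd x) *\<^sub>R ?b"
          have sx: "0 \<le> snd x" "x = snd x *\<^sub>R ?b" using C[OF x] by auto
          have "y \<in> cone_over P" unfolding y_def
            using sx pos by (intro convex_cone_scaleR[OF convex_cone_cone_over _ bC]) simp
          show ?thesis
          proof (cases "snd x = 0")
            case True
            then have "x = 0" using sx by (metis scaleR_zero_left)
            then show ?thesis using \<open>0 \<in> \<Phi>\<close> by simp
          next
            case False
            \<comment> \<open>\<open>?w\<close> lies beyond \<open>z\<close> and \<open>x\<close> on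
              the ray: \<open>z\<close> is inside the segment from \<open>0\<close> to
              \<open>?w\<close>, so the face contains \<open>?w\<close>, and by convexity
              \<open>x\<close>.\<close>
            let ?w = "(snd z + snd x) *\<^sub>R ?b"
            have wC: "?w \<in> cone_over P"
              using sx pos by (intro convex_cone_scaleR[OF convex_cone_cone_over _ bC]) simp
            have zeq: "z = snd z *\<^sub>R ?b" using C[OF zC] by simp
            define t where "t = snd z / (snd z + snd x)"
            have t: "0 < t" "t < 1" using pos sx False by (auto simp: t_def field_simps)
            have "t * (snd z + snd x) = snd z" using pos sx by (simp add: t_def)
            then have "z = (1 - t) *\<^sub>R 0 + t *\<^sub>R ?w" using zeq by simp
            moreover have "0 \<noteq> ?w" using pos sx by (simp add: zero_prod_def)
            ultimately have "z \<in> open_segment 0 ?w" using t unfolding in_segment by blast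
            then have wF: "?w \<in> \<Phi>"
              using face z wC convex_cone_contains_0[OF convex_cone_cone_over] unfolding face_of_def by blast
            define s where "s = snd x / (snd z + snd x)"
            have s: "0 \<le> s" "s \<le> 1" "s * (snd z + snd x) = snd x" using pos sx by (auto simp: s_def)
            have "convex \<Phi>" using face by (simp add: face_of_def)
            then have "(1 - s) *\<^sub>R 0 + s *\<^sub>R ?w \<in> \<Phi>"
              using s \<open>0 \<in> \<Phi>\<close> wF unfolding convex_alt by blast
            then show ?thesis using s sx by simp
          qed
        qed
        then have "\<Phi> = cone_over P" using face by (auto simp: face_of_def)
        then show False using F by simp
      qed
      ultimately have \<Phi>: "\<Phi> = {0}" by auto
      have "m = 1" if g: "integral_form (cone_lattice P) g" "\<forall>z\<in>cone_lattice P. snd z = real m * g z" for m g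
      proof -
        have "g ?b \<in> \<int>" using g bL by (auto simp: integral_form_def)
        then obtain k where "g ?b = of_int k" by (auto elim: Ints_cases)
        then have "1 = real m * of_int k" using g(2) bL by (metis snd_conv)
        then have "of_int 1 = (of_int (int m * k) :: real)" by simp
        then have "int m * k = 1" by (metis of_int_eq_iff)
        then have "int m dvd 1" by (metis dvd_triv_left)
        then show ?thesis by simp
      qed
      moreover have "integral_form (cone_lattice P) snd"
        using lin Lform by (fastforce simp: integral_form_def)
      ultimately have "primitive_form (cone_lattice P) snd"
        unfolding primitive_form_def by blast
      then have "reduced_equation P \<Phi> snd"
        unfolding reduced_equation_def using C zset \<Phi> by auto
      then show "\<exists>h. reduced_equation P \<Phi> h \<and> h (indicator_vec {e}, real \<delta>) = 1"
        using \<delta>1 by (intro exI[of _ snd]) simp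
    qed
  qed
qed

end

section \<open>The graphic matroid\<close>

text \<open>Increments diminish: as \<open>cl\<close> is monotone, an element that adds to the rank
  of a set also adds to that of every smaller one. Adding a set \<open>Z\<close> element by element
  to \<open>X\<close> and to a larger \<open>Y\<close> therefore gives submodularity.\<close>

lemma matroid_of_closure:
  fixes E :: "'a set" and r :: "'a set \<Rightarrow> nat" and cl :: "'a set \<Rightarrow> 'a set"
  assumes fin: "finite E" and empty: "r {} = 0"
    and insert: "\<And>X e. X \<subseteq> E \<Longrightarrow> e \<in> E \<Longrightarrow> r (insert e X) = r X + (if e \<in> cl X then 0 else 1)"
    and mono: "\<And>X Y. X \<subseteq> Y \<Longrightarrow> cl X \<subseteq> cl Y"
  shows "matroid E r"
proof
  show "finite E" "r {} = 0" by (fact fin, fact empty)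
  show "r (insert e X) \<le> Suc (r X)" if "X \<subseteq> E" "e \<in> E" for X e
    using insert[OF that] by simp
  have fin_sub: "finite Z" if "Z \<subseteq> E" for Z using fin that finite_subset by blast
  have incr: "r X \<le> r (X \<union> Z)" if "X \<subseteq> E" "Z \<subseteq> E" for X Z
    using fin_sub[OF that(2)] that
  proof (induction Z)
    case (insert e Z)
    have "r (insert e (X \<union> Z)) = r (X \<union> Z) + (if e \<in> cl (X \<union> Z) then 0 else 1)"
      using insert.prems by (intro assms(3)) auto
    then show ?case using insert by simp
  qed simp
  show "r X \<le> r Y" if "X \<subseteq> Y" "Y \<subseteq> E" for X Y
  proof -
    have "X \<union> Y = Y" "X \<subseteq> E" using that by auto
    then show ?thesis using incr[of X Y] that by simp
  qed
  have sub: "r (Y \<union> Z) + r X \<le> r (X \<union> Z) + r Y" if "X \<subseteq> Y" "Y \<subseteq> E" "Z \<subseteq> E" for X Y Z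
    using fin_sub[OF that(3)] that
  proof (induction Z)
    case (insert e Z)
    have "r (insert e (X \<union> Z)) = r (X \<union> Z) + (if e \<in> cl (X \<union> Z) then 0 else 1)"
      "r (insert e (Y \<union> Z)) = r (Y \<union> Z) + (if e \<in> cl (Y \<union> Z) then 0 else 1)"
      using insert.prems by (intro assms(3); blast)+
    moreover have "cl (X \<union> Z) \<subseteq> cl (Y \<union> Z)" using insert.prems by (intro mono) auto
    then have "(if e \<in> cl (Y \<union> Z) then 0 else 1) \<le> (if e \<in> cl (X \<union> Z) then 0 else (1::nat))" by auto
    moreover have "r (Y \<union> Z) + r X \<le> r (X \<union> Z) + r Y" using insert by simp
    ultimately show ?case by simp
  qed simp
  show "r (X \<union> Y) + r (X \<inter> Y) \<le> r X + r Y" if "X \<subseteq> E" "Y \<subseteq> E" for X Y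
  proof -
    have "(X \<inter> Y) \<union> X = X" by auto
    then show ?thesis using sub[of "X \<inter> Y" Y X] that by (simp add: Un_commute)
  qed
qed

section \<open>Walks along a set of edges\<close>

definition reach :: "('v, 'e) mgraph \<Rightarrow> 'e set \<Rightarrow> ('v \<times> 'v) set" where
  "reach G F = {(x, y). \<exists>e\<in>F. ends G e = {x, y}}\<^sup>*"

lemma joined_eq_reach: "joined G = reach G (edges G)"
  by (simp add: joined_def reach_def)

lemma joined_subgraph_on: "joined (subgraph_on G W F) = reach G F"
  by (simp add: joined_def reach_def subgraph_on_def)

lemma reach_refl [simp]: "(x, x) \<in> reach G F"
  by (simp add: reach_def)

lemma reach_trans: "(x, y) \<in> reach G F \<Longrightarrow> (y, z) \<in> reach G F \<Longrightarrow> (x, z) \<in> reach G F"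
  unfolding reach_def by (rule rtrancl_trans)

lemma reach_sym: "(x, y) \<in> reach G F \<Longrightarrow> (y, x) \<in> reach G F"
proof -
  have "sym {(x, y). \<exists>e\<in>F. ends G e = {x, y}}" by (auto simp: sym_def insert_commute)
  then show "(x, y) \<in> reach G F \<Longrightarrow> (y, x) \<in> reach G F"
    unfolding reach_def by (rule symD[OF sym_rtrancl])
qed

lemma reach_edge: "e \<in> F \<Longrightarrow> ends G e = {x, y} \<Longrightarrow> (x, y) \<in> reach G F"
  unfolding reach_def by (rule r_into_rtrancl) auto

lemma reach_mono: "F \<subseteq> F' \<Longrightarrow> reach G F \<subseteq> reach G F'"
  unfolding reach_def by (rule rtrancl_mono) auto

lemma reach_induct [consumes 1, case_names refl step]:
  assumes "(x, y) \<in> reach G F" and "P x"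
    and "\<And>y z e. (x, y) \<in> reach G F \<Longrightarrow> P y \<Longrightarrow> e \<in> F \<Longrightarrow> ends G e = {y, z} \<Longrightarrow> P z"
  shows "P y"
  using assms(1) unfolding reach_def
proof (induction rule: rtrancl_induct)
  case (step y z)
  then obtain e where "e \<in> F" "ends G e = {y, z}" by auto
  then show ?case using assms(3)[of y e z] step by (simp add: reach_def)
qed (rule assms(2))

lemma reach_insert_same:
  assumes "ends G e = {a, b}" "(a, b) \<in> reach G F"
  shows "reach G (insert e F) = reach G F"
proof
  show "reach G (insert e F) \<subseteq> reach G F"
  proof (rule subrelI)
    fix x y assume "(x, y) \<in> reach G (insert e F)"
    then show "(x, y) \<in> reach G F"
    proof (induction rule: reach_induct)
      case (step y z d)
      have "(y, z) \<in> reach G F"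
      proof (cases "d = e")
        case True
        then have "y = a \<and> z = b \<or> y = b \<and> z = a" using step assms by (auto simp: doubleton_eq_iff)
        then show ?thesis using assms(2) reach_sym by metis
      next
        case False then show ?thesis using step by (intro reach_edge[of d]) auto
      qed
      then show ?case using step reach_trans by metis
    qed simp
  qed
qed (rule reach_mono, auto)

lemma reach_insert:
  assumes "ends G e = {a, b}"
  shows "(x, y) \<in> reach G (insert e F) \<longleftrightarrow> (x, y) \<in> reach G F \<or>
    (x, a) \<in> reach G F \<and> (b, y) \<in> reach G F \<or> (x, b) \<in> reach G F \<and> (a, y) \<in> reach G F"
    (is "_ \<longleftrightarrow> ?R y")
proof
  assume "(x, y) \<in> reach G (insert e F)"
  then show "?R y"
  proof (induction rule: reach_induct)
    case (step y z d)
    show ?case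
    proof (cases "d = e")
      case True
      then have "y = a \<and> z = b \<or> y = b \<and> z = a" using step assms by (auto simp: doubleton_eq_iff)
      then show ?thesis using step.IH reach_refl reach_sym reach_trans by metis
    next
      case False
      then have "(y, z) \<in> reach G F" using step by (intro reach_edge[of d]) auto
      then show ?thesis using step.IH reach_trans by metis
    qed
  qed simp
next
  assume R: "?R y"
  have F: "(u, v) \<in> reach G F \<Longrightarrow> (u, v) \<in> reach G (insert e F)" for u v
    using reach_mono[of F "insert e F" G] by auto
  have "(a, b) \<in> reach G (insert e F)" using assms by (intro reach_edge[of e]) auto
  then show "(x, y) \<in> reach G (insert e F)" using R F reach_sym reach_trans by metis
qed

section \<open>The rank function of the graphic matroid\<close>

definition vset :: "('v, 'e) mgraph \<Rightarrow> 'e set \<Rightarrow> 'v set" where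
  "vset G F = \<Union>(ends G ` F)"

lemma vset_mono: "F \<subseteq> F' \<Longrightarrow> vset G F \<subseteq> vset G F'"
  by (auto simp: vset_def)

lemma reach_in_vset:
  assumes "(x, y) \<in> reach G F"
  shows "x = y \<or> x \<in> vset G F \<and> y \<in> vset G F"
  using assms
proof (induction rule: reach_induct)
  case (step y z e)
  then have "y \<in> vset G F" "z \<in> vset G F" by (auto simp: vset_def)
  then show ?case using step by auto
qed simp

definition cls :: "('v, 'e) mgraph \<Rightarrow> 'e set \<Rightarrow> 'v \<Rightarrow> 'v set" where
  "cls G F x = {y \<in> verts G. (x, y) \<in> reach G F}"

lemma cls_eq_iff: "x \<in> verts G \<Longrightarrow> y \<in> verts G \<Longrightarrow> cls G F x = cls G F y \<longleftrightarrow> (x, y) \<in> reach G F"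
proof
  assume "x \<in> verts G" "y \<in> verts G" "cls G F x = cls G F y"
  then have "y \<in> cls G F x" by (simp add: cls_def)
  then show "(x, y) \<in> reach G F" by (simp add: cls_def)
next
  assume "(x, y) \<in> reach G F"
  then have "(x, z) \<in> reach G F \<longleftrightarrow> (y, z) \<in> reach G F" for z using reach_sym reach_trans by metis
  then show "cls G F x = cls G F y" by (simp add: cls_def)
qed

text \<open>The rank in the graphic matroid: a forest with \<open>c\<close> components on
  \<open>n\<close> vertices has \<open>n - c\<close> edges.\<close>

definition grank :: "('v, 'e) mgraph \<Rightarrow> 'e set \<Rightarrow> nat" where
  "grank G F = card (verts G) - card (cls G F ` verts G)"

definition spanned :: "('v, 'e) mgraph \<Rightarrow> 'e set \<Rightarrow> 'e set" where
  "spanned G F = {e. \<forall>x\<in>ends G e. \<forall>y\<in>ends G e. (x, y) \<in> reach G F}"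

lemma spanned_mono: "F \<subseteq> F' \<Longrightarrow> spanned G F \<subseteq> spanned G F'"
  using reach_mono[of F F' G] unfolding spanned_def by blast

lemma spanned_iff: "ends G e = {a, b} \<Longrightarrow> e \<in> spanned G F \<longleftrightarrow> (a, b) \<in> reach G F"
  using reach_sym[of a b] by (auto simp: spanned_def)

text \<open>Made to hold for \<open>G\<close> and for its contractions by \<open>E(S)\<close>, which
  may have parallel edges but no loops.\<close>

locale loopless =
  fixes G :: "('v, 'e) mgraph"
  assumes finite_verts: "finite (verts G)" and finite_edges: "finite (edges G)"
    and ends_subset: "e \<in> edges G \<Longrightarrow> ends G e \<subseteq> verts G"
    and card_ends: "e \<in> edges G \<Longrightarrow> card (ends G e) = 2"
begin

lemma ends_cases:
  assumes "e \<in> edges G"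
  obtains a b where "ends G e = {a, b}" "a \<noteq> b" "a \<in> verts G" "b \<in> verts G"
proof -
  obtain a b where ab: "ends G e = {a, b}" "a \<noteq> b" using card_ends[OF assms] unfolding card_2_iff by blast
  then have "a \<in> verts G" "b \<in> verts G" using ends_subset[OF assms] by auto
  then show ?thesis using that ab by blast
qed

lemma ends_cases_at:
  assumes "e \<in> edges G" "a \<in> ends G e"
  obtains b where "ends G e = {a, b}" "a \<noteq> b" "b \<in> verts G"
proof -
  obtain c d where cd: "ends G e = {c, d}" "c \<noteq> d" "c \<in> verts G" "d \<in> verts G" by (rule ends_cases[OF assms(1)])
  show ?thesis
  proof (cases "a = c")
    case True then show ?thesis using that[of d] cd by simp
  next
    case False
    then have "a = d" using assms(2) cd by simp
    then show ?thesis using that[of c] cd by (simp add: insert_commute)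
  qed
qed

lemma vset_subset: "F \<subseteq> edges G \<Longrightarrow> vset G F \<subseteq> verts G"
  using ends_subset by (fastforce simp: vset_def)

lemma card_cls_le: "card (cls G F ` verts G) \<le> card (verts G)"
  by (rule card_image_le[OF finite_verts])

text \<open>An edge between two different classes merges these two and leaves the others alone; any
  other edge changes no class.\<close>

lemma grank_insert:
  assumes e: "e \<in> edges G"
  shows "grank G (insert e F) = grank G F + (if e \<in> spanned G F then 0 else 1)"
proof -
  obtain a b where ab: "ends G e = {a, b}" "a \<noteq> b" "a \<in> verts G" "b \<in> verts G" by (rule ends_cases[OF e])
  show ?thesis
  proof (cases "(a, b) \<in> reach G F")
    case True
    then have "cls G (insert e F) = cls G F" using reach_insert_same[OF ab(1) True] by (simp add: cls_def fun_eq_iff)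
    then show ?thesis using True spanned_iff[OF ab(1)] by (simp add: grank_def)
  next
    case False
    let ?A = "cls G F a" and ?B = "cls G F b" and ?V = "verts G"
    have AB: "?A \<noteq> ?B" using cls_eq_iff[OF ab(3,4)] False by simp
    have new: "cls G (insert e F) x = (if x \<in> ?A \<union> ?B then ?A \<union> ?B else cls G F x)" if x: "x \<in> ?V" for x
    proof -
      have ri: "(x, y) \<in> reach G (insert e F) \<longleftrightarrow> (x, y) \<in> reach G F \<or>
        (a, x) \<in> reach G F \<and> (b, y) \<in> reach G F \<or> (b, x) \<in> reach G F \<and> (a, y) \<in> reach G F" for y
        unfolding reach_insert[OF ab(1)] using reach_sym by metis
      show ?thesis
      proof (cases "x \<in> ?A \<union> ?B")
        case True
        then have "(a, x) \<in> reach G F \<or> (b, x) \<in> reach G F" by (auto simp: cls_def)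
        then have "(x, y) \<in> reach G (insert e F) \<longleftrightarrow> (a, y) \<in> reach G F \<or> (b, y) \<in> reach G F" for y
          unfolding ri using reach_sym reach_trans by metis
        then have "cls G (insert e F) x = ?A \<union> ?B" by (auto simp: cls_def)
        then show ?thesis using True by simp
      next
        case False
        then have "(a, x) \<notin> reach G F" "(b, x) \<notin> reach G F" using x by (auto simp: cls_def)
        then have "(x, y) \<in> reach G (insert e F) \<longleftrightarrow> (x, y) \<in> reach G F" for y unfolding ri by simp
        then have "cls G (insert e F) x = cls G F x" by (simp add: cls_def)
        then show ?thesis using False by simp
      qed
    qed
    have self: "x \<in> cls G F x" if "x \<in> ?V" for x using that by (simp add: cls_def)
    have in_cls: "cls G F x = cls G F y" if "x \<in> cls G F y" "y \<in> ?V" for x y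
    proof -
      have "x \<in> ?V" "(y, x) \<in> reach G F" using that by (auto simp: cls_def)
      then show ?thesis using cls_eq_iff[of y G x F] that by simp
    qed
    have img: "cls G (insert e F) ` ?V = insert (?A \<union> ?B) (cls G F ` ?V - {?A, ?B})" (is "?L = ?R")
    proof
      show "?L \<subseteq> ?R"
      proof
        fix C assume "C \<in> ?L"
        then obtain x where x: "x \<in> ?V" "C = cls G (insert e F) x" by auto
        show "C \<in> ?R"
        proof (cases "x \<in> ?A \<union> ?B")
          case True then show ?thesis using x new[OF x(1)] by simp
        next
          case False
          then have "C = cls G F x" using x new[OF x(1)] by simp
          moreover have "x \<in> cls G F x" by (rule self[OF x(1)])
          ultimately show ?thesis using x False by auto
        qed
      qed
      show "?R \<subseteq> ?L"
      proof
        fix C assume "C \<in> ?R"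
        then consider "C = ?A \<union> ?B" | "C \<in> cls G F ` ?V" "C \<noteq> ?A" "C \<noteq> ?B" by auto
        then show "C \<in> ?L"
        proof cases
          case 1
          then have "C = cls G (insert e F) a" using new[OF ab(3)] self[OF ab(3)] by simp
          then show ?thesis using ab by blast
        next
          case 2
          then obtain x where x: "x \<in> ?V" "C = cls G F x" by auto
          then have "x \<notin> ?A \<union> ?B" using in_cls[OF _ ab(3), of x] in_cls[OF _ ab(4), of x] 2 by auto
          then have "C = cls G (insert e F) x" using x new[OF x(1)] by simp
          then show ?thesis using x by blast
        qed
      qed
    qed
    have notin: "?A \<union> ?B \<notin> cls G F ` ?V - {?A, ?B}"
    proof
      assume "?A \<union> ?B \<in> cls G F ` ?V - {?A, ?B}"
      then obtain x where x: "x \<in> ?V" "?A \<union> ?B = cls G F x" "cls G F x \<noteq> ?A" by auto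
      then have "a \<in> cls G F x" using self[OF ab(3)] by blast
      then show False using in_cls[OF _ x(1)] x(3) by blast
    qed
    let ?c = "card (cls G F ` ?V)"
    have "{?A, ?B} \<subseteq> cls G F ` ?V" using ab by auto
    then have c: "card (cls G F ` ?V - {?A, ?B}) = ?c - 2" "2 \<le> ?c"
      using card_Diff_subset[of "{?A, ?B}" "cls G F ` ?V"] AB
        card_mono[of "cls G F ` ?V" "{?A, ?B}"] finite_verts by auto
    have "card (cls G (insert e F) ` ?V) = Suc (?c - 2)"
      unfolding img using notin finite_verts c by (subst card_insert_disjoint) auto
    then have "grank G (insert e F) = Suc (grank G F)"
      using c card_cls_le[of F] by (simp add: grank_def)
    then show ?thesis using False spanned_iff[OF ab(1)] by simp
  qed
qed

lemma grank_empty: "grank G {} = 0"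
proof -
  have "reach G {} = Id" by (simp add: reach_def)
  then have "cls G {} x = {x}" if "x \<in> verts G" for x using that by (auto simp: cls_def)
  then have "cls G {} ` verts G = (\<lambda>x. {x}) ` verts G" by (rule image_cong[OF refl])
  then have "card (cls G {} ` verts G) = card (verts G)" by (simp add: card_image)
  then show ?thesis by (simp add: grank_def)
qed

sublocale matroid "edges G" "grank G"
  by (rule matroid_of_closure[where cl = "spanned G"])
    (simp_all add: finite_edges grank_empty grank_insert spanned_mono)

lemma spanned_iff_rank: "e \<in> edges G \<Longrightarrow> e \<in> spanned G F \<longleftrightarrow> grank G (insert e F) = grank G F"
  by (simp add: grank_insert)

text \<open>Collapsing all vertices of \<open>A\<close> to \<open>z\<close> maps walks in
  \<open>A \<union> B'\<close> to walks in \<open>B'\<close> and fixes the vertices of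
  \<open>B\<close>. So the edges of \<open>A\<close> do not help to span an edge of
  \<open>B\<close>.\<close>

lemma grank_share_vertex:
  assumes A: "A \<subseteq> edges G" and B: "B \<subseteq> edges G" and share: "vset G A \<inter> vset G B \<subseteq> {z}"
  shows "grank G (A \<union> B) = grank G A + grank G B"
proof -
  have "grank G (A \<union> B') = grank G A + grank G B'" if "B' \<subseteq> B" for B'
  proof -
    have "finite B'" using that B finite_edges by (meson finite_subset)
    then show ?thesis using that
    proof (induction B')
      case empty then show ?case by (simp add: grank_empty)
    next
      case (insert b B')
      have b: "b \<in> edges G" using insert B by auto
      obtain p q where pq: "ends G b = {p, q}" using ends_cases[OF b] by metis
      define \<phi> where "\<phi> u = (if u \<in> vset G A then z else u)" for u
      have id: "\<phi> u = u" if "u \<in> vset G B" for u using that share by (auto simp: \<phi>_def)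
      have "(\<phi> p, \<phi> y) \<in> reach G B'" if "(p, y) \<in> reach G (A \<union> B')" for y
        using that
      proof (induction rule: reach_induct)
        case (step y z e)
        have "(\<phi> y, \<phi> z) \<in> reach G B'"
        proof (cases "e \<in> A")
          case True
          then have "y \<in> vset G A" "z \<in> vset G A" using step by (auto simp: vset_def)
          then show ?thesis by (simp add: \<phi>_def)
        next
          case False
          then have "e \<in> B'" using step by simp
          moreover have "y \<in> vset G B" "z \<in> vset G B" using step \<open>e \<in> B'\<close> insert.prems by (auto simp: vset_def)
          ultimately show ?thesis using step id by (simp add: reach_edge)
        qed
        then show ?case using step reach_trans by metis
      qed simp
      moreover have "p \<in> vset G B" "q \<in> vset G B" using pq insert.prems by (auto simp: vset_def)
      ultimately have "(p, q) \<in> reach G (A \<union> B') \<Longrightarrow> (p, q) \<in> reach G B'" using id by metis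
      moreover have "(p, q) \<in> reach G B' \<Longrightarrow> (p, q) \<in> reach G (A \<union> B')" using reach_mono[of B' "A \<union> B'" G] by auto
      ultimately have "b \<in> spanned G (A \<union> B') \<longleftrightarrow> b \<in> spanned G B'" using spanned_iff[OF pq] by metis
      then show ?case using grank_insert[OF b, of "A \<union> B'"] grank_insert[OF b, of B'] insert by simp
    qed
  qed
  then show ?thesis by simp
qed

section \<open>2-connected subgraphs and rank-connected edge sets\<close>

lemma cut_vertex_subgraph_on:
  "cut_vertex (subgraph_on G W F) z \<longleftrightarrow> z \<in> W \<and> (\<exists>x\<in>W - {z}. \<exists>y\<in>W - {z}.
     (x, y) \<in> reach G F \<and> (x, y) \<notin> reach G {e\<in>F. ends G e \<subseteq> W - {z}})"
proof -
  have "joined (induced (subgraph_on G W F) (W - {z})) = reach G {e\<in>F. ends G e \<subseteq> W - {z}}"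
    by (simp add: induced_def subgraph_on_def edges_within_def joined_def reach_def)
  then show ?thesis by (simp add: cut_vertex_def joined_subgraph_on) (simp add: subgraph_on_def)
qed

lemma two_connected_subgraph_on:
  "two_connected (subgraph_on G W F) \<longleftrightarrow> (\<forall>x\<in>W. \<forall>y\<in>W. (x, y) \<in> reach G F) \<and> 2 \<le> card W \<and>
    (\<forall>z\<in>W. \<forall>x\<in>W - {z}. \<forall>y\<in>W - {z}. (x, y) \<in> reach G {e\<in>F. ends G e \<subseteq> W - {z}})"
proof -
  have "verts (subgraph_on G W F) = W" by (simp add: subgraph_on_def)
  moreover have "2 \<le> card W \<Longrightarrow> W \<noteq> {}" by auto
  ultimately show ?thesis
    unfolding two_connected_def connected_graph_def cut_vertex_subgraph_on joined_subgraph_on by auto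
qed

text \<open>If \<open>A\<close> and \<open>F - A\<close> separated \<open>F\<close>, take edges \<open>wx\<close> and \<open>wy\<close> on different sides. As \<open>w\<close> is no cut
  vertex, \<open>wy\<close> is spanned by \<open>wx\<close> and edges avoiding \<open>w\<close>, hence by edges of its own side that avoid
  \<open>w\<close>, which is impossible.\<close>

lemma two_connected_imp_rank_connected:
  assumes F: "F \<subseteq> edges G" and W: "W \<subseteq> verts G" "vset G F \<subseteq> W" and tc: "two_connected (subgraph_on G W F)"
  shows "F \<noteq> {}" "W = vset G F" "rank_connected (grank G) F"
proof -
  have conn: "\<And>x y. x \<in> W \<Longrightarrow> y \<in> W \<Longrightarrow> (x, y) \<in> reach G F" and card: "2 \<le> card W"
    and nocut: "\<And>z x y. z \<in> W \<Longrightarrow> x \<in> W - {z} \<Longrightarrow> y \<in> W - {z} \<Longrightarrow> (x, y) \<in> reach G {e\<in>F. ends G e \<subseteq> W - {z}}"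
    using tc unfolding two_connected_subgraph_on by auto
  have in_vset: "x \<in> vset G F" if x: "x \<in> W" for x
  proof -
    have "W \<noteq> {x}" using card by auto
    then obtain y where "y \<in> W" "y \<noteq> x" using x by blast
    then show ?thesis using reach_in_vset[OF conn[OF x]] by blast
  qed
  then show WF: "W = vset G F" using W by auto
  moreover have "W \<noteq> {}" using card by auto
  ultimately show Fne: "F \<noteq> {}" by (auto simp: vset_def)
  show "rank_connected (grank G) F"
  proof (rule ccontr)
    assume "\<not> ?thesis"
    then obtain A where A: "A \<subset> F" "A \<noteq> {}" "grank G A + grank G (F - A) \<le> grank G F"
      using Fne unfolding rank_connected_def by (meson not_less)
    define B where "B = F - A"
    have AB: "A \<subseteq> F" "A \<subseteq> edges G" "B \<subseteq> edges G" "B \<noteq> {}" "A \<union> B = F" using A F by (auto simp: B_def)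
    have eq: "grank G A + grank G (F - A) = grank G F"
      using A(3) rank_union_le[OF AB(2,3)] AB(5) unfolding B_def by simp
    \<comment> \<open>Otherwise a walk starting at an end of an edge of \<open>A\<close> could never
      leave the vertices of \<open>A\<close>, although \<open>F\<close> connects all of
      \<open>W\<close>.\<close>
    have "vset G A \<inter> vset G B \<noteq> {}"
    proof
      assume disj: "vset G A \<inter> vset G B = {}"
      obtain e f where ef: "e \<in> A" "f \<in> B" using A AB by auto
      then have "e \<in> edges G" "f \<in> edges G" using AB by auto
      then obtain a b where ab: "a \<in> ends G e" "b \<in> ends G f" using ends_cases by (metis insertI1)
      then have abv: "a \<in> vset G A" "b \<in> vset G B" using ef by (auto simp: vset_def)
      then have "a \<in> W" "b \<in> W" using WF AB(1) vset_mono[of A F G] vset_mono[of B F G] by (auto simp: B_def)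
      then have "(a, b) \<in> reach G F" by (rule conn)
      then have "b \<in> vset G A"
      proof (induction rule: reach_induct)
        case (step y z e)
        then have "e \<notin> B" using disj by (auto simp: vset_def)
        then have "e \<in> A" using step AB by auto
        then show ?case using step by (auto simp: vset_def)
      qed (rule abv)
      then show False using disj abv by auto
    qed
    then obtain w e f where w: "w \<in> ends G e" "w \<in> ends G f" "e \<in> A" "f \<in> B" by (auto simp: vset_def)
    have ef: "e \<in> edges G" "f \<in> edges G" "e \<in> F" "f \<in> F" "f \<notin> A" using w AB by (auto simp: B_def)
    obtain x where x: "ends G e = {w, x}" "w \<noteq> x" by (rule ends_cases_at[OF ef(1) w(1)])
    obtain y where y: "ends G f = {w, y}" "w \<noteq> y" by (rule ends_cases_at[OF ef(2) w(2)])
    have inW: "w \<in> W" "x \<in> W" "y \<in> W" using WF x y ef by (auto simp: vset_def)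
    \<comment> \<open>The edges of \<open>F\<close> avoiding \<open>w\<close>. They join
      \<open>x\<close> to \<open>y\<close>, so together with \<open>e\<close> they span
      \<open>f\<close>.\<close>
    define X where "X = {d\<in>F. ends G d \<subseteq> W - {w}}"
    have "(x, y) \<in> reach G X" unfolding X_def using nocut[OF inW(1)] inW x y by simp
    then have "(x, y) \<in> reach G (insert e X)" using reach_mono[of X "insert e X" G] by auto
    moreover have "(w, x) \<in> reach G (insert e X)" using x by (intro reach_edge[of e]) auto
    ultimately have "(w, y) \<in> reach G (insert e X)" using reach_trans by metis
    then have "f \<in> spanned G (insert e X)" using spanned_iff[OF y(1)] by simp
    then have rk: "grank G (insert f (insert e X)) = grank G (insert e X)" using spanned_iff_rank[OF ef(2)] by simp
    have XF: "X \<subseteq> F" by (auto simp: X_def)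
    \<comment> \<open>The separation restricts to both sets; \<open>e\<close> counts on the side of
      \<open>A\<close> and \<open>f\<close> on the other, so \<open>f\<close> adds nothing to
      \<open>X - A\<close>.\<close>
    have s1: "grank G (insert f (insert e X)) = grank G (insert f (insert e X) \<inter> A) + grank G (insert f (insert e X) - A)"
      by (rule rank_separation_restrict[OF F AB(1) eq]) (use XF ef in auto)
    have s2: "grank G (insert e X) = grank G (insert e X \<inter> A) + grank G (insert e X - A)"
      by (rule rank_separation_restrict[OF F AB(1) eq]) (use XF ef in auto)
    have "insert f (insert e X) \<inter> A = insert e X \<inter> A" "insert f (insert e X) - A = insert f (X - A)" "insert e X - A = X - A"
      using w ef by auto
    then have "grank G (insert f (X - A)) = grank G (X - A)" using s1 s2 rk by simp
    then have "f \<in> spanned G (X - A)" using spanned_iff_rank[OF ef(2)] by simp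
    then have "(w, y) \<in> reach G (X - A)" using spanned_iff[OF y(1)] by simp
    then have "w \<in> vset G (X - A)" using reach_in_vset y by metis
    then show False by (auto simp: vset_def X_def)
  qed
qed

text \<open>A component, or a part that a cut vertex \<open>z\<close> separates from the rest, has
  an edge set sharing at most one vertex with the other edges, and by
  \<open>grank_share_vertex\<close> ranks would add up.\<close>

lemma rank_connected_imp_two_connected:
  assumes F: "F \<subseteq> edges G" and conn: "rank_connected (grank G) F"
  shows "two_connected (subgraph_on G (vset G F) F)"
proof -
  let ?W = "vset G F"
  have Fne: "F \<noteq> {}" using conn by (simp add: rank_connected_def)
  have Wfin: "finite ?W" using vset_subset[OF F] finite_verts finite_subset by blast
  have no_share: False if A: "A \<subset> F" "A \<noteq> {}" and sh: "vset G A \<inter> vset G (F - A) \<subseteq> {z}" for A z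
  proof -
    have "grank G (A \<union> (F - A)) = grank G A + grank G (F - A)"
      using A F by (intro grank_share_vertex[OF _ _ sh]) auto
    moreover have "A \<union> (F - A) = F" using A by auto
    ultimately show False using rank_connectedD[OF conn A] by simp
  qed
  have "2 \<le> card ?W"
  proof -
    obtain e where e: "e \<in> F" using Fne by auto
    then have "ends G e \<subseteq> ?W" "card (ends G e) = 2" using F card_ends by (auto simp: vset_def)
    then show ?thesis using card_mono[OF Wfin] by metis
  qed
  moreover have reachF: "(x, y) \<in> reach G F" if x: "x \<in> ?W" and y: "y \<in> ?W" for x y
  proof (rule ccontr)
    assume n: "(x, y) \<notin> reach G F"
    define A where "A = {e\<in>F. \<exists>u\<in>ends G e. (x, u) \<in> reach G F}"
    obtain e where e: "e \<in> F" "x \<in> ends G e" using x by (auto simp: vset_def)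
    obtain f where f: "f \<in> F" "y \<in> ends G f" using y by (auto simp: vset_def)
    have all: "(x, v) \<in> reach G F" if eA: "e \<in> A" and v: "v \<in> ends G e" for e v
    proof -
      obtain u where u: "e \<in> F" "u \<in> ends G e" "(x, u) \<in> reach G F" using eA by (auto simp: A_def)
      have eE: "e \<in> edges G" using u F by auto
      obtain u' where u': "ends G e = {u, u'}" by (rule ends_cases_at[OF eE u(2)])
      have "(u, u') \<in> reach G F" by (rule reach_edge[OF u(1) u'])
      then have "(x, u') \<in> reach G F" using u reach_trans by metis
      then show ?thesis using v u u' by auto
    qed
    have "e \<in> A" unfolding A_def using e by (blast intro: reach_refl)
    moreover have "f \<notin> A" using all[of f y] f n by auto
    ultimately have "A \<subset> F" "A \<noteq> {}" using f by (auto simp: A_def)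
    moreover have "vset G A \<inter> vset G (F - A) \<subseteq> {x}"
      using all by (auto simp: vset_def A_def)
    ultimately show False by (rule no_share)
  qed
  moreover have "(x, y) \<in> reach G {e\<in>F. ends G e \<subseteq> ?W - {z}}"
    if z: "z \<in> ?W" and x: "x \<in> ?W - {z}" and y: "y \<in> ?W - {z}" for x y z
  proof (rule ccontr)
    define X where "X = {e\<in>F. ends G e \<subseteq> ?W - {z}}"
    assume "(x, y) \<notin> reach G {e\<in>F. ends G e \<subseteq> ?W - {z}}"
    then have n: "(x, y) \<notin> reach G X" by (simp add: X_def)
    have nz: "(x, z) \<notin> reach G X"
    proof
      assume "(x, z) \<in> reach G X"
      then have "z \<in> vset G X" using reach_in_vset[of x z] x by auto
      then show False by (auto simp: vset_def X_def)
    qed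
    \<comment> \<open>The edges meeting the component of \<open>x\<close> after the removal of
      \<open>z\<close>; an end of such an edge outside this component can only be
      \<open>z\<close>.\<close>
    define A where "A = {e\<in>F. \<exists>u\<in>ends G e. (x, u) \<in> reach G X}"
    have all: "v = z \<or> (x, v) \<in> reach G X" if eA: "e \<in> A" and v: "v \<in> ends G e" for e v
    proof -
      obtain u where u: "e \<in> F" "u \<in> ends G e" "(x, u) \<in> reach G X" using eA by (auto simp: A_def)
      have eE: "e \<in> edges G" using u F by auto
      obtain u' where u': "ends G e = {u, u'}" by (rule ends_cases_at[OF eE u(2)])
      have "u \<noteq> z" using u nz by auto
      show ?thesis
      proof (cases "u' = z")
        case True then show ?thesis using v u u' by auto
      next
        case False
        have "u \<in> ?W" "u' \<in> ?W" using u u' by (auto simp: vset_def)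
        then have "e \<in> X" using u u' False \<open>u \<noteq> z\<close> by (simp add: X_def)
        then have "(u, u') \<in> reach G X" by (rule reach_edge[OF _ u'])
        then have "(x, u') \<in> reach G X" using u reach_trans by metis
        then show ?thesis using v u u' by auto
      qed
    qed
    obtain e where e: "e \<in> F" "x \<in> ends G e" using x by (auto simp: vset_def)
    obtain f where f: "f \<in> F" "y \<in> ends G f" using y by (auto simp: vset_def)
    have "e \<in> A" unfolding A_def using e by (blast intro: reach_refl)
    moreover have "f \<notin> A" using all[of f y] f n y by auto
    ultimately have "A \<subset> F" "A \<noteq> {}" using f by (auto simp: A_def)
    moreover have "vset G A \<inter> vset G (F - A) \<subseteq> {z}"
      using all by (fastforce simp: vset_def A_def)
    ultimately show False by (rule no_share)
  qed
  ultimately show ?thesis unfolding two_connected_subgraph_on by blast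
qed

text \<open>A 2-connected subgraph has no isolated vertices, so its edges determine it, and blocks
  become maximal rank-connected sets.\<close>

lemma two_connected_subgraph_iff:
  "two_connected_subgraph G W F \<longleftrightarrow> F \<subseteq> edges G \<and> W = vset G F \<and> rank_connected (grank G) F"
proof
  assume "two_connected_subgraph G W F"
  then have t: "W \<subseteq> verts G" "F \<subseteq> edges G" "vset G F \<subseteq> W" "two_connected (subgraph_on G W F)"
    by (auto simp: two_connected_subgraph_def edges_within_def vset_def)
  then show "F \<subseteq> edges G \<and> W = vset G F \<and> rank_connected (grank G) F"
    using two_connected_imp_rank_connected[OF t(2,1,3,4)] by simp
next
  assume a: "F \<subseteq> edges G \<and> W = vset G F \<and> rank_connected (grank G) F"
  then show "two_connected_subgraph G W F"
    using rank_connected_imp_two_connected[of F] vset_subset[of F]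
    by (auto simp: two_connected_subgraph_def edges_within_def vset_def)
qed

lemma grank_two_connected:
  assumes F: "F \<subseteq> edges G" and W: "W \<subseteq> verts G" "vset G F \<subseteq> W" "W \<noteq> {}"
    and conn: "\<And>x y. x \<in> W \<Longrightarrow> y \<in> W \<Longrightarrow> (x, y) \<in> reach G F"
  shows "grank G F = card W - 1"
proof -
  have in_W: "cls G F x = W" if "x \<in> W" for x
  proof
    show "cls G F x \<subseteq> W"
    proof
      fix y assume "y \<in> cls G F x"
      then have "(x, y) \<in> reach G F" by (simp add: cls_def)
      from reach_in_vset[OF this] show "y \<in> W" using W(2) that by auto
    qed
    show "W \<subseteq> cls G F x" using conn that W(1) by (auto simp: cls_def)
  qed
  have out_W: "cls G F x = {x}" if x: "x \<in> verts G - W" for x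
  proof
    show "cls G F x \<subseteq> {x}"
    proof
      fix y assume "y \<in> cls G F x"
      then have "(x, y) \<in> reach G F" by (simp add: cls_def)
      from reach_in_vset[OF this] show "y \<in> {x}" using W(2) x by auto
    qed
  qed (use x in \<open>auto simp: cls_def\<close>)
  have un: "W \<union> (verts G - W) = verts G" using W(1) by auto
  have "cls G F ` verts G = cls G F ` W \<union> cls G F ` (verts G - W)"
    using image_Un[of "cls G F" W "verts G - W"] unfolding un .
  also have "cls G F ` W = {W}" using in_W W(3) by auto
  also have "cls G F ` (verts G - W) = (\<lambda>x. {x}) ` (verts G - W)" using out_W by (rule image_cong[OF refl])
  finally have img: "cls G F ` verts G = insert W ((\<lambda>x. {x}) ` (verts G - W))" by simp
  have "W \<notin> (\<lambda>x. {x}) ` (verts G - W)" by auto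
  then have "card (cls G F ` verts G) = Suc (card (verts G - W))"
    unfolding img using finite_verts by (simp add: card_image)
  moreover have finW: "finite W" using W finite_verts finite_subset by blast
  then have "card (verts G - W) = card (verts G) - card W" using W by (simp add: card_Diff_subset)
  moreover have "card W \<le> card (verts G)" using W finite_verts by (simp add: card_mono)
  moreover have "0 < card W" using W finW by (simp add: card_gt_0_iff)
  ultimately show ?thesis by (simp add: grank_def)
qed

lemma blocks_eq:
  assumes P: "partition_on (edges G) \<P>" "\<And>C. C \<in> \<P> \<Longrightarrow> rank_connected (grank G) C"
    and r: "grank G (edges G) = (\<Sum>C\<in>\<P>. grank G C)"
  shows "card (blocks G) = card \<P>"
proof -
  have max: "{X. X \<subseteq> edges G \<and> rank_connected (grank G) X \<and>
           (\<forall>Y. Y \<subseteq> edges G \<and> rank_connected (grank G) Y \<and> X \<subseteq> Y \<longrightarrow> Y = X)} = \<P>"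
    by (rule maximal_rank_connected_eq_partition[OF subset_refl P r])
  have "blocks G = (\<lambda>C. (vset G C, C)) ` \<P>"
    unfolding blocks_def two_connected_subgraph_iff max[symmetric]
    using vset_mono[of _ _ G] by (auto simp: image_iff)
  moreover have "inj_on (\<lambda>C. (vset G C, C)) \<P>" by (simp add: inj_on_def)
  ultimately show ?thesis by (simp add: card_image)
qed

end

section \<open>Cycles, spanning forests and bases\<close>

lemma reach_path:
  assumes "(x, y) \<in> reach G F"
  shows "\<exists>vs es. vs \<noteq> [] \<and> hd vs = x \<and> last vs = y \<and> length vs = Suc (length es) \<and> distinct vs \<and>
    (\<forall>i<length es. es ! i \<in> F \<and> ends G (es ! i) = {vs ! i, vs ! Suc i})"
  using assms
proof (induction rule: reach_induct)
  case refl
  show ?case by (intro exI[of _ "[x]"] exI[of _ "[]"]) simp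
next
  case (step y z e)
  then obtain vs es where p: "vs \<noteq> []" "hd vs = x" "last vs = y" "length vs = Suc (length es)" "distinct vs"
    "\<forall>i<length es. es ! i \<in> F \<and> ends G (es ! i) = {vs ! i, vs ! Suc i}" by blast
  show ?case
  proof (cases "z \<in> set vs")
    case True
    then obtain k where k: "k < length vs" "vs ! k = z" by (auto simp: in_set_conv_nth)
    show ?thesis
    proof (intro exI[of _ "take (Suc k) vs"] exI[of _ "take k es"] conjI)
      show "last (take (Suc k) vs) = z" using k by (simp add: take_Suc_conv_app_nth)
    qed (use p k in auto)
  next
    case False
    have "vs ! length es = y" using p by (simp add: last_conv_nth)
    then show ?thesis using p step False
      by (intro exI[of _ "vs @ [z]"] exI[of _ "es @ [e]"]) (auto simp: nth_append less_Suc_eq)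
  qed
qed

context loopless
begin

lemma rank_drop_iff_spanned:
  assumes "F \<subseteq> edges G" "e \<in> F"
  shows "grank G (F - {e}) = grank G F \<longleftrightarrow> e \<in> spanned G (F - {e})"
proof -
  have "e \<in> edges G" "insert e (F - {e}) = F" using assms by auto
  then show ?thesis using spanned_iff_rank[of e "F - {e}"] by auto
qed

text \<open>The last edge joins two vertices that the rest of the cycle already joins; for a loop
  the two coincide.\<close>

lemma is_cycle_imp_spanned:
  assumes c: "is_cycle (subgraph_on G (verts G) F) vs es"
  obtains e where "e \<in> F" "e \<in> spanned G (F - {e})"
proof -
  define n where "n = length es - 1"
  have len: "length es = Suc n" "length vs = Suc n" and dist: "distinct es" and sub: "set es \<subseteq> F"
    and ends: "\<And>i. i < Suc n \<Longrightarrow> ends G (es ! i) = {vs ! i, vs ! (Suc i mod Suc n)}"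
    using c by (auto simp: is_cycle_def subgraph_on_def n_def)
  let ?e = "es ! n"
  have e: "?e \<in> F" using sub len by auto
  have "(vs ! 0, vs ! i) \<in> reach G (F - {?e})" if "i \<le> n" for i
    using that
  proof (induction i)
    case (Suc i)
    have "ends G (es ! i) = {vs ! i, vs ! Suc i}" using ends[of i] Suc.prems by simp
    moreover have "es ! i \<in> F" using sub len Suc.prems by auto
    moreover have "es ! i \<noteq> ?e" using dist len Suc.prems by (simp add: nth_eq_iff_index_eq)
    ultimately have "(vs ! i, vs ! Suc i) \<in> reach G (F - {?e})" by (intro reach_edge[of "es ! i"]) auto
    then show ?case using reach_trans[of "vs ! 0" "vs ! i" G "F - {?e}" "vs ! Suc i"] Suc by simp
  qed simp
  from this[of n] have "(vs ! n, vs ! 0) \<in> reach G (F - {?e})" using reach_sym by auto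
  moreover have "ends G ?e = {vs ! n, vs ! 0}" using ends[of n] by simp
  ultimately have "?e \<in> spanned G (F - {?e})" by (simp add: spanned_iff)
  then show ?thesis using that e by blast
qed

lemma spanned_imp_is_cycle:
  assumes F: "F \<subseteq> edges G" and e: "e \<in> F" "e \<in> spanned G (F - {e})"
  shows "\<exists>vs es. is_cycle (subgraph_on G (verts G) F) vs es"
proof -
  have eE: "e \<in> edges G" using F e by auto
  obtain a b where ab: "ends G e = {a, b}" "a \<noteq> b" "a \<in> verts G" "b \<in> verts G" by (rule ends_cases[OF eE])
  have "(a, b) \<in> reach G (F - {e})" using e(2) spanned_iff[OF ab(1)] by simp
  from reach_path[OF this] obtain vs es where p: "vs \<noteq> []" "hd vs = a" "last vs = b"
    "length vs = Suc (length es)" "distinct vs"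
    and edge: "\<And>i. i < length es \<Longrightarrow> es ! i \<in> F - {e}" "\<And>i. i < length es \<Longrightarrow> ends G (es ! i) = {vs ! i, vs ! Suc i}"
    by blast
  have v0: "vs ! 0 = a" and vn: "vs ! length es = b" using p by (simp_all add: hd_conv_nth last_conv_nth)
  have vinj: "vs ! i = vs ! j \<longleftrightarrow> i = j" if "i \<le> length es" "j \<le> length es" for i j
    using p that by (simp add: nth_eq_iff_index_eq)
  have "distinct es"
    unfolding distinct_conv_nth
  proof (intro allI impI)
    fix i j assume ij: "i < length es" "j < length es" "i \<noteq> j"
    show "es ! i \<noteq> es ! j"
    proof
      assume "es ! i = es ! j"
      then have "{vs ! i, vs ! Suc i} = {vs ! j, vs ! Suc j}" using edge(2) ij by metis
      then have "vs ! i = vs ! j \<or> vs ! i = vs ! Suc j \<and> vs ! Suc i = vs ! j" by (auto simp: doubleton_eq_iff)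
      then show False using vinj[of i j] vinj[of i "Suc j"] vinj[of "Suc i" j] ij by auto
    qed
  qed
  moreover have "set es \<subseteq> F - {e}"
  proof
    fix d assume "d \<in> set es"
    then obtain i where "i < length es" "d = es ! i" by (auto simp: in_set_conv_nth)
    then show "d \<in> F - {e}" using edge(1) by simp
  qed
  moreover have "set vs \<subseteq> verts G"
  proof
    fix v assume "v \<in> set vs"
    then obtain i where i: "i \<le> length es" "v = vs ! i" using p by (auto simp: in_set_conv_nth less_Suc_eq_le)
    show "v \<in> verts G"
    proof (cases "i = length es")
      case True then show ?thesis using i vn ab by simp
    next
      case False
      then have il: "i < length es" using i by simp
      then have "es ! i \<in> edges G" using edge(1)[of i] F by auto
      then show ?thesis using ends_subset edge(2)[OF il] i by auto
    qed
  qed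
  moreover have "ends G ((es @ [e]) ! i) = {vs ! i, vs ! (Suc i mod length (es @ [e]))}" if "i < length (es @ [e])" for i
  proof (cases "i = length es")
    case True then show ?thesis using v0 vn ab by (simp add: insert_commute)
  next
    case False then show ?thesis using that edge(2)[of i] by (simp add: nth_append)
  qed
  ultimately have "is_cycle (subgraph_on G (verts G) F) vs (es @ [e])"
    using p e by (auto simp: is_cycle_def subgraph_on_def)
  then show ?thesis by blast
qed

lemma reach_eq_iff_rank_eq:
  assumes F: "F \<subseteq> edges G"
  shows "reach G F = reach G (edges G) \<longleftrightarrow> grank G F = grank G (edges G)"
proof
  assume "reach G F = reach G (edges G)"
  then show "grank G F = grank G (edges G)" by (simp add: grank_def cls_def)
next
  assume eq: "grank G F = grank G (edges G)"
  have edge: "e \<in> spanned G F" if e: "e \<in> edges G" for e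
  proof -
    have "grank G F \<le> grank G (insert e F)" "grank G (insert e F) \<le> grank G (edges G)"
      by (rule rank_mono; use F e in blast)+
    then show ?thesis using eq spanned_iff_rank[OF e] by simp
  qed
  have "(x, y) \<in> reach G F" if "(x, y) \<in> reach G (edges G)" for x y
    using that
  proof (induction rule: reach_induct)
    case (step y z e)
    then have "(y, z) \<in> reach G F" using edge[of e] spanned_iff by metis
    then show ?case using step reach_trans by metis
  qed simp
  then show "reach G F = reach G (edges G)" using reach_mono[OF F, of G] by auto
qed

text \<open>Acyclic means that no edge is spanned by the others, which is independence; having the
  components of \<open>G\<close> means having full rank.\<close>

lemma spanning_forest_iff_basis: "spanning_forest G F \<longleftrightarrow> basis F"
proof (cases "F \<subseteq> edges G")
  case True
  have "(\<nexists>vs es. is_cycle (subgraph_on G (verts G) F) vs es) \<longleftrightarrow> (\<forall>e\<in>F. e \<notin> spanned G (F - {e}))"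
    using is_cycle_imp_spanned spanned_imp_is_cycle[OF True] by metis
  also have "\<dots> \<longleftrightarrow> indep F"
    unfolding indep_iff_rank_drop[OF True] using rank_drop_iff_spanned[OF True] by simp
  finally show ?thesis
    using True reach_eq_iff_rank_eq[OF True]
    by (simp add: spanning_forest_def basis_def joined_subgraph_on joined_eq_reach[of G])
next
  case False
  then show ?thesis by (simp add: spanning_forest_def basis_def indep_def)
qed

section \<open>Contractions\<close>

lemma contract_eq:
  "contract G T = \<lparr>verts = cls G T ` verts G, edges = edges G - T, ends = (\<lambda>e. cls G T ` ends G e)\<rparr>"
proof -
  have "component_of (subgraph_on G (verts G) T) = cls G T"
    unfolding component_of_def cls_def joined_subgraph_on by (simp add: subgraph_on_def)
  then show ?thesis by (simp add: contract_def Let_def)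
qed

lemma reach_contract:
  assumes T: "T \<subseteq> edges G" and F: "F \<subseteq> edges G" and x: "x \<in> verts G" and y: "y \<in> verts G"
  shows "(cls G T x, cls G T y) \<in> reach (contract G T) F \<longleftrightarrow> (x, y) \<in> reach G (F \<union> T)"
proof
  assume "(cls G T x, cls G T y) \<in> reach (contract G T) F"
  \<comment> \<open>Stated for every representative of the class \<open>Y\<close>, since consecutive
    edges of a walk in the contraction may meet the class in different vertices; a walk in
    \<open>T\<close> bridges them.\<close>
  moreover have "\<forall>y\<in>verts G. Y = cls G T y \<longrightarrow> (x, y) \<in> reach G (F \<union> T)"
    if "(cls G T x, Y) \<in> reach (contract G T) F" for Y
    using that
  proof (induction rule: reach_induct)
    case refl
    show ?case
    proof (intro ballI impI)
      fix y assume "y \<in> verts G" "cls G T x = cls G T y"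
      then have "(x, y) \<in> reach G T" using cls_eq_iff[OF x] by metis
      then show "(x, y) \<in> reach G (F \<union> T)" using reach_mono[of T "F \<union> T" G] by auto
    qed
  next
    case (step Y Z e)
    have e: "e \<in> edges G" using step F by auto
    obtain a b where ab: "ends G e = {a, b}" "a \<in> verts G" "b \<in> verts G" by (rule ends_cases[OF e])
    have "{Y, Z} = {cls G T a, cls G T b}" using step ab by (simp add: contract_eq)
    then obtain p q where pq: "Y = cls G T p" "Z = cls G T q" "p \<in> verts G" "q \<in> verts G" "ends G e = {p, q}"
      using ab by (auto simp: doubleton_eq_iff insert_commute)
    have "(x, p) \<in> reach G (F \<union> T)" using step.IH pq by simp
    moreover have "(p, q) \<in> reach G (F \<union> T)" using step pq by (intro reach_edge[of e]) auto
    ultimately have xq: "(x, q) \<in> reach G (F \<union> T)" by (rule reach_trans)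
    show ?case
    proof (intro ballI impI)
      fix z assume z: "z \<in> verts G" "Z = cls G T z"
      then have "(q, z) \<in> reach G T" using cls_eq_iff[OF pq(4) z(1)] pq(2) by metis
      then have "(q, z) \<in> reach G (F \<union> T)" using reach_mono[of T "F \<union> T" G] by auto
      then show "(x, z) \<in> reach G (F \<union> T)" using xq reach_trans by metis
    qed
  qed
  ultimately show "(x, y) \<in> reach G (F \<union> T)" using y by blast
next
  assume "(x, y) \<in> reach G (F \<union> T)"
  then show "(cls G T x, cls G T y) \<in> reach (contract G T) F"
  proof (induction rule: reach_induct)
    case (step y z e)
    have e: "e \<in> edges G" using step T F by auto
    have yz: "y \<in> verts G" "z \<in> verts G" using ends_subset[OF e] step by auto
    have "(cls G T y, cls G T z) \<in> reach (contract G T) F"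
    proof (cases "e \<in> T")
      case True
      then have "(y, z) \<in> reach G T" using step by (intro reach_edge) auto
      then have "cls G T y = cls G T z" using cls_eq_iff[OF yz] by metis
      then show ?thesis by simp
    next
      case False
      then have "e \<in> F" using step by simp
      moreover have "ends (contract G T) e = {cls G T y, cls G T z}" using step by (simp add: contract_eq)
      ultimately show ?thesis by (rule reach_edge)
    qed
    then show ?case using step reach_trans by metis
  qed simp
qed

lemma edges_within_subset: "edges_within G S \<subseteq> edges G"
  by (auto simp: edges_within_def)

text \<open>Two different vertices joined inside \<open>E(S)\<close> both lie in \<open>S\<close>,
  so an edge between them has itself been contracted.\<close>

lemma loopless_contract_within: "loopless (contract G (edges_within G S))"
proof
  let ?T = "edges_within G S" and ?H = "contract G (edges_within G S)"
  show "finite (verts ?H)" "finite (edges ?H)" using finite_verts finite_edges by (simp_all add: contract_eq)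
  fix e assume "e \<in> edges ?H"
  then have e: "e \<in> edges G" "e \<notin> ?T" by (auto simp: contract_eq)
  obtain a b where ab: "ends G e = {a, b}" "a \<noteq> b" "a \<in> verts G" "b \<in> verts G" by (rule ends_cases[OF e(1)])
  show "ends ?H e \<subseteq> verts ?H" using ab by (auto simp: contract_eq)
  have "(a, b) \<notin> reach G ?T"
  proof
    assume "(a, b) \<in> reach G ?T"
    then have "a \<in> vset G ?T" "b \<in> vset G ?T" using reach_in_vset ab(2) by metis+
    then have "a \<in> S" "b \<in> S" by (auto simp: vset_def edges_within_def)
    then show False using e ab by (auto simp: edges_within_def)
  qed
  then have "cls G ?T a \<noteq> cls G ?T b" using cls_eq_iff[OF ab(3,4)] by metis
  then show "card (ends ?H e) = 2" using ab by (simp add: contract_eq)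
qed

text \<open>By \<open>reach_contract\<close> an edge is spanned by \<open>F\<close> in the
  contraction exactly if it is spanned by \<open>F \<union> T\<close> in \<open>G\<close>, so both
  ranks grow together.\<close>

lemma grank_contract:
  assumes H: "loopless (contract G T)" and T: "T \<subseteq> edges G" and F: "F \<subseteq> edges G - T"
  shows "grank (contract G T) F = grank G (F \<union> T) - grank G T"
proof -
  interpret H: loopless "contract G T" by (rule H)
  have "finite F" using F finite_edges finite_subset by blast
  then show ?thesis using F
  proof (induction F)
    case empty then show ?case by (simp add: H.grank_empty)
  next
    case (insert e F)
    have e: "e \<in> edges G" "e \<in> edges (contract G T)" using insert by (auto simp: contract_eq)
    obtain a b where ab: "ends G e = {a, b}" "a \<in> verts G" "b \<in> verts G" by (rule ends_cases[OF e(1)])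
    have ends: "ends (contract G T) e = {cls G T a, cls G T b}" using ab by (simp add: contract_eq)
    have "F \<subseteq> edges G" using insert by auto
    then have "e \<in> spanned (contract G T) F \<longleftrightarrow> e \<in> spanned G (F \<union> T)"
      using reach_contract[OF T _ ab(2,3)] spanned_iff[OF ends] spanned_iff[OF ab(1)] by simp
    moreover have "grank G T \<le> grank G (F \<union> T)" by (rule rank_mono) (use insert T in auto)
    ultimately show ?case using insert H.grank_insert[OF e(2), of F] grank_insert[OF e(1), of "F \<union> T"] by simp
  qed
qed

section \<open>Induced 2-connected subgraphs and the blocks of their contractions\<close>

lemma two_connected_induced:
  assumes tc: "two_connected (subgraph_on G S F)" and F: "F \<subseteq> edges_within G S"
  shows "two_connected (induced G S)"
proof -
  let ?T = "edges_within G S"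
  have "reach G F \<subseteq> reach G ?T" by (rule reach_mono[OF F])
  moreover have "reach G {e\<in>F. ends G e \<subseteq> S - {z}} \<subseteq> reach G {e\<in>?T. ends G e \<subseteq> S - {z}}" for z
    by (rule reach_mono) (use F in auto)
  ultimately show ?thesis using tc unfolding induced_def two_connected_subgraph_on by blast
qed

lemma induced_two_connected_rank:
  assumes S: "S \<subseteq> verts G" and tc: "two_connected (induced G S)"
  shows "rank_connected (grank G) (edges_within G S)" "grank G (edges_within G S) = card S - 1"
    "vset G (edges_within G S) = S"
proof -
  let ?T = "edges_within G S"
  have T: "?T \<subseteq> edges G" "vset G ?T \<subseteq> S" by (auto simp: edges_within_def vset_def)
  have tc': "two_connected (subgraph_on G S ?T)" using tc by (simp add: induced_def)
  note rc = two_connected_imp_rank_connected[OF T(1) S T(2) tc']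
  show "rank_connected (grank G) ?T" "vset G ?T = S" using rc by auto
  have "2 \<le> card S" "\<And>x y. x \<in> S \<Longrightarrow> y \<in> S \<Longrightarrow> (x, y) \<in> reach G ?T"
    using tc' unfolding two_connected_subgraph_on by auto
  then show "grank G ?T = card S - 1" using grank_two_connected[OF T(1) S T(2)] by fastforce
qed

text \<open>Passing from a connected \<open>F\<close> to all edges inside its vertex set keeps the
  rank, which depends on the number of vertices only. This lets the equations of sets
  \<open>S\<close> bound other edge sets.\<close>

lemma rank_connected_induced:
  assumes F: "F \<subseteq> edges G" and conn: "rank_connected (grank G) F"
  shows "F \<subseteq> edges_within G (vset G F)" "two_connected (induced G (vset G F))"
    "grank G F = card (vset G F) - 1"
proof -
  let ?S = "vset G F"
  have tc: "two_connected (subgraph_on G ?S F)" by (rule rank_connected_imp_two_connected[OF F conn])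
  show sub: "F \<subseteq> edges_within G ?S" using F by (auto simp: edges_within_def vset_def)
  show "two_connected (induced G ?S)" by (rule two_connected_induced[OF tc sub])
  have "2 \<le> card ?S" "\<And>x y. x \<in> ?S \<Longrightarrow> y \<in> ?S \<Longrightarrow> (x, y) \<in> reach G F"
    using tc unfolding two_connected_subgraph_on by auto
  then show "grank G F = card ?S - 1" using grank_two_connected[OF F vset_subset[OF F] subset_refl] by fastforce
qed

text \<open>The blocks are the components of the contraction by \<open>T\<close>, in which the rank
  of \<open>C\<close> is \<open>r(E) - r(E - C)\<close>. The flacets and the sum serve the direction
  from Gorenstein to the equations, the last clause the converse, where the contraction by a flacet
  has a single block.\<close>

lemma contraction_blocks:
  assumes conn: "rank_connected (grank G) (edges G)" and S: "S \<subseteq> verts G"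
    and tc: "two_connected (induced G S)" and T: "T = edges_within G S"
  obtains \<P> where "partition_on (edges G - T) \<P>" "card (blocks (contract G T)) = card \<P>"
    "\<And>C. C \<in> \<P> \<Longrightarrow> flacet (edges G - C)"
    "(\<Sum>C\<in>\<P>. grank G (edges G) - grank G (edges G - C)) = grank G (edges G) - grank G T"
    "rank_connected (\<lambda>X. grank G (X \<union> T) - grank G T) (edges G - T) \<Longrightarrow> \<P> = {edges G - T}"
proof -
  let ?E = "edges G" and ?H = "contract G T"
  let ?rT = "\<lambda>X. grank G (X \<union> T) - grank G T"
  have TE: "T \<subseteq> ?E" using edges_within_subset by (simp add: T)
  have cT: "rank_connected (grank G) T" using induced_two_connected_rank(1)[OF S tc] by (simp add: T)
  have HL: "loopless ?H" unfolding T by (rule loopless_contract_within)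
  interpret H: loopless ?H by (rule HL)
  have EH: "edges ?H = ?E - T" by (simp add: contract_eq)
  have rk: "grank ?H X = ?rT X" if "X \<subseteq> ?E - T" for X by (rule grank_contract[OF HL TE that])
  obtain \<P> where P: "partition_on (edges ?H) \<P>" "\<And>C. C \<in> \<P> \<Longrightarrow> rank_connected (grank ?H) C"
    and r: "grank ?H (edges ?H) = (\<Sum>C\<in>\<P>. grank ?H C)"
    using H.rank_connected_partition[of "edges ?H"] by blast
  have Csub: "C \<subseteq> ?E - T" if "C \<in> \<P>" for C using P(1) that EH by (auto simp: partition_on_def)
  have split: "grank G (C \<union> T) + grank G (?E - C) = grank G ?E + grank G T" if C: "C \<in> \<P>" for C
  proof (rule rank_complement_contraction_component[OF TE Csub[OF C]])
    have "grank ?H C + grank ?H (?E - T - C) = grank ?H (?E - T)"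
      using H.rank_partition_split[OF subset_refl P(1) r C] by (simp add: EH)
    then show "?rT C + ?rT (?E - T - C) = ?rT (?E - T)" using rk Csub[OF C] by simp
  qed
  show ?thesis
  proof (rule that)
    show "partition_on (?E - T) \<P>" using P(1) EH by simp
    show "card (blocks ?H) = card \<P>" by (rule H.blocks_eq[OF P r])
    show "flacet (?E - C)" if C: "C \<in> \<P>" for C
    proof (rule flacet_complement_contraction_component[OF conn TE cT Csub[OF C] _ split[OF C]])
      show "rank_connected ?rT C"
        using P(2)[OF C] rank_connected_cong[of C "grank ?H" ?rT] rk Csub[OF C] by (metis order.trans)
    qed
    have "(\<Sum>C\<in>\<P>. grank G ?E - grank G (?E - C)) = (\<Sum>C\<in>\<P>. grank ?H C)"
    proof (rule sum.cong[OF refl])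
      fix C assume C: "C \<in> \<P>"
      show "grank G ?E - grank G (?E - C) = grank ?H C" using split[OF C] rk[OF Csub[OF C]] by simp
    qed
    also have "\<dots> = grank ?H (?E - T)" using r EH by simp
    also have "\<dots> = grank G ?E - grank G T" using rk[of "?E - T"] TE by (simp add: Un_absorb2)
    finally show "(\<Sum>C\<in>\<P>. grank G ?E - grank G (?E - C)) = grank G ?E - grank G T" .
    assume "rank_connected ?rT (?E - T)"
    then have "rank_connected (grank ?H) (edges ?H)" unfolding EH using rank_connected_cong[of "?E - T" "grank ?H" ?rT] rk by metis
    from H.connected_partition_singleton[OF subset_refl this P(1) r] show "\<P> = {?E - T}" by (simp add: EH)
  qed
qed

end

lemma simple_graph_loopless: "simple_graph G \<Longrightarrow> loopless G"
  by unfold_locales (auto simp: simple_graph_def)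

lemma base_polytope_eq:
  assumes "loopless G"
  shows "base_polytope G = matroid_polytope.P (edges G) (grank G)"
proof -
  interpret loopless G by (rule assms)
  interpret matroid_polytope "edges G" "grank G" ..
  show ?thesis unfolding base_polytope_def P_def spanning_forest_iff_basis by (rule refl)
qed

section \<open>The equations of 2-connected induced subgraphs\<close>

text \<open>An edge inside the vertex set of a flacet \<open>F\<close> but outside \<open>F\<close> is a loop of the connected
  contraction by \<open>F\<close>, so it is the only edge outside \<open>F\<close>.\<close>

lemma (in loopless) flacet_cases:
  assumes vE: "vset G (edges G) = verts G" and fl: "flacet F"
  obtains "F = edges_within G (vset G F)"
  | e where "e \<in> edges G" "F = edges G - {e}" "vset G F = verts G"
proof -
  let ?S = "vset G F" and ?T = "edges_within G (vset G F)"
  have F: "F \<subset> edges G" "rank_connected (grank G) F"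
    and co: "\<And>A. F \<subset> A \<Longrightarrow> A \<subset> edges G \<Longrightarrow>
      grank G (edges G) + grank G F < grank G A + grank G (F \<union> (edges G - A))"
    using fl by (auto simp: flacet_def)
  have FE: "F \<subseteq> edges G" using F by auto
  note rci = rank_connected_induced[OF FE F(2)]
  have rT: "grank G ?T = grank G F"
    using induced_two_connected_rank(2)[OF vset_subset[OF FE] rci(2)] rci(3) by simp
  show ?thesis
  proof (cases "F = ?T")
    case True then show ?thesis by (rule that(1))
  next
    case False
    then obtain e where e: "e \<in> ?T" "e \<notin> F" using rci(1) by auto
    have eE: "e \<in> edges G" using e edges_within_subset by auto
    have "edges G = insert e F"
    proof (rule ccontr)
      assume "edges G \<noteq> insert e F"
      then have A: "F \<subset> insert e F" "insert e F \<subset> edges G" using FE eE e(2) by auto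
      have "grank G (insert e F) \<le> grank G ?T" by (rule rank_mono) (use e rci(1) edges_within_subset in auto)
      moreover have "grank G (F \<union> (edges G - insert e F)) \<le> grank G (edges G)" by (rule rank_mono) (use FE in auto)
      ultimately show False using co[OF A] rT by simp
    qed
    then have E: "F = edges G - {e}" "edges G \<subseteq> ?T" using e rci(1) by auto
    have "vset G (edges G) \<subseteq> vset G ?T" by (rule vset_mono[OF E(2)])
    also have "vset G ?T \<subseteq> ?S" by (auto simp: vset_def edges_within_def)
    finally have "verts G \<subseteq> ?S" using vE by simp
    then have "?S = verts G" using vset_subset[OF FE] by auto
    then show ?thesis using that(2)[OF eE E(1)] by simp
  qed
qed

section \<open>2-connected simple graphs and their weights\<close>

locale two_connected_simple = loopless G
  for G :: "('v, 'e::finite) mgraph" +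
  assumes simple: "simple_graph G" and two_conn: "two_connected G"
begin

sublocale matroid_polytope "edges G" "grank G" ..

lemma subgraph_on_all: "subgraph_on G (verts G) (edges G) = G"
  by (simp add: subgraph_on_def)

lemma vset_edges: "vset G (edges G) = verts G"
  and edges_ne: "edges G \<noteq> {}"
  and conn: "rank_connected (grank G) (edges G)"
proof -
  have "two_connected (subgraph_on G (verts G) (edges G))" using two_conn by (simp add: subgraph_on_all)
  note rc = two_connected_imp_rank_connected[OF subset_refl subset_refl vset_subset[OF subset_refl] this]
  show "vset G (edges G) = verts G" by (rule rc(2)[symmetric])
  show "edges G \<noteq> {}" "rank_connected (grank G) (edges G)" by (fact rc(1), fact rc(3))
qed

lemma edges_within_verts: "edges_within G (verts G) = edges G"
  using ends_subset by (auto simp: edges_within_def)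

lemma induced_verts: "induced G (verts G) = G"
  by (simp add: induced_def edges_within_verts subgraph_on_all)

lemma grank_edges: "grank G (edges G) = card (verts G) - 1"
  using induced_two_connected_rank(2)[of "verts G"] two_conn by (simp add: induced_verts edges_within_verts)

lemma blocks_contract_all: "card (blocks (contract G (edges G))) = 0"
proof -
  obtain \<P> where "partition_on (edges G - edges G) \<P>" "card (blocks (contract G (edges G))) = card \<P>"
    using contraction_blocks[OF conn subset_refl, of "edges G"] two_conn
    by (metis induced_verts edges_within_verts)
  then show ?thesis by (simp add: partition_on_empty)
qed

text \<open>Here simplicity enters: contracting one edge is contracting all edges inside its pair of
  ends, so it creates no loops.\<close>

lemma edges_within_ends: "e \<in> edges G \<Longrightarrow> edges_within G (ends G e) = {e}"
proof -
  assume e: "e \<in> edges G"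
  have "d = e" if d: "d \<in> edges G" "ends G d \<subseteq> ends G e" for d
  proof -
    have "finite (ends G e)" using card_ends[OF e] by (metis card.infinite zero_neq_numeral)
    then have "ends G d = ends G e" using card_subset_eq[OF _ d(2)] card_ends[OF e] card_ends[OF d(1)] by simp
    moreover have "inj_on (ends G) (edges G)" using simple by (simp add: simple_graph_def)
    ultimately show "d = e" using d(1) e by (simp add: inj_on_eq_iff)
  qed
  then show "edges_within G (ends G e) = {e}" using e by (auto simp: edges_within_def)
qed

text \<open>\<open>e\<close> is no coloop, so deleting it keeps the rank; as the rank counts the
  covered vertices, all vertices remain covered.\<close>

lemma two_connected_delete_edge:
  assumes two: "2 \<le> card (edges G)" and e: "e \<in> edges G" and c: "rank_connected (grank G) (edges G - {e})"
  shows "two_connected (delete_edge G e)"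
proof -
  let ?F = "edges G - {e}"
  have F: "?F \<subseteq> edges G" by auto
  have "grank G ?F = card (vset G ?F) - 1" by (rule rank_connected_induced(3)[OF F c])
  then have eq: "card (vset G ?F) - 1 = card (verts G) - 1"
    using rank_singleton_connected(2)[OF conn two e] grank_edges by simp
  have sub: "vset G ?F \<subseteq> verts G" by (rule vset_subset[OF F])
  have tc: "two_connected (subgraph_on G (vset G ?F) ?F)" by (rule rank_connected_imp_two_connected[OF F c])
  then have "2 \<le> card (vset G ?F)" by (simp add: two_connected_subgraph_on)
  moreover have "card (vset G ?F) \<le> card (verts G)" by (rule card_mono[OF finite_verts sub])
  ultimately have "card (vset G ?F) = card (verts G)" using eq by linarith
  then have "vset G ?F = verts G" by (rule card_subset_eq[OF finite_verts sub])
  then show ?thesis using tc by (simp add: delete_edge_def)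
qed

text \<open>Connectedness of the contracted matroid gives 2-connectedness on the covered vertices
  only; comparing the rank with the number of classes shows that every vertex of the contraction is
  covered.\<close>

lemma two_connected_contract_edge:
  assumes two: "2 \<le> card (edges G)" and fl: "flacet {e}"
  shows "two_connected (contract G {e})"
proof -
  let ?H = "contract G {e}" and ?F = "edges G - {e}"
  have e: "e \<in> edges G" using fl by (auto simp: flacet_def)
  have HL: "loopless ?H" using loopless_contract_within[of "ends G e"] by (simp add: edges_within_ends[OF e])
  interpret H: loopless ?H by (rule HL)
  have EH: "edges ?H = ?F" by (simp add: contract_eq)
  have sub: "{e} \<subseteq> edges G" using e by simp
  have rk: "grank ?H X = grank G (X \<union> {e}) - grank G {e}" if "X \<subseteq> ?F" for X
    by (rule grank_contract[OF HL sub that])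
  have c: "rank_connected (grank ?H) (edges ?H)"
    using flacet_contraction_connected[OF fl]
      rank_connected_cong[of ?F "grank ?H" "\<lambda>X. grank G (X \<union> {e}) - grank G {e}", OF rk]
    by (simp add: EH)
  have tc: "two_connected (subgraph_on ?H (vset ?H (edges ?H)) (edges ?H))"
    by (rule H.rank_connected_imp_two_connected[OF subset_refl c])
  have r1: "grank G {e} = 1" by (rule rank_singleton_connected(1)[OF conn two e])
  have "grank ?H (edges ?H) = grank G (edges G) - 1"
    using rk[of ?F] r1 e by (simp add: EH insert_absorb)
  then have "card (vset ?H (edges ?H)) - 1 = card (verts G) - 1 - 1"
    using H.rank_connected_induced(3)[OF subset_refl c] grank_edges by simp
  moreover have "card (verts ?H) = card (verts G) - 1"
    using r1 card_cls_le[of "{e}"] unfolding grank_def by (simp add: contract_eq)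
  moreover have "2 \<le> card (vset ?H (edges ?H))" using tc unfolding H.two_connected_subgraph_on by simp
  moreover have vsub: "vset ?H (edges ?H) \<subseteq> verts ?H" by (rule H.vset_subset[OF subset_refl])
  moreover have "card (vset ?H (edges ?H)) \<le> card (verts ?H)" by (rule card_mono[OF H.finite_verts vsub])
  ultimately have "card (vset ?H (edges ?H)) = card (verts ?H)" by linarith
  then have "vset ?H (edges ?H) = verts ?H" by (rule card_subset_eq[OF H.finite_verts vsub])
  moreover have "subgraph_on ?H (verts ?H) (edges ?H) = ?H" by (simp add: subgraph_on_def)
  ultimately show ?thesis using tc by simp
qed

context
  fixes w :: "'e \<Rightarrow> nat" and \<delta> :: nat
  assumes delta: "1 \<le> \<delta>"
    and w_delete: "\<And>e. e \<in> edges G \<Longrightarrow> two_connected (delete_edge G e) \<Longrightarrow> w e = 1"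
    and w_contract: "\<And>e. e \<in> edges G \<Longrightarrow> two_connected (contract G {e}) \<Longrightarrow> w e = \<delta> - 1"
    and two: "2 \<le> card (edges G)"
begin

text \<open>If \<open>v\<close> satisfies the equations of the flacets, then \<open>v(C) = \<delta> (r(E) - r(E - C)) + 1\<close> for every
  block \<open>C\<close> of the contraction by \<open>E(S)\<close>; summing over the blocks gives \<open>v(E(S))\<close>.\<close>

lemma gorenstein_imp_block_equation:
  assumes gor: "gorenstein \<delta> P" and S: "S \<subseteq> verts G" "two_connected (induced G S)"
  shows "(\<Sum>e \<in> edges_within G S. w e) + card (blocks (contract G (edges_within G S))) = \<delta> * (card S - 1)"
proof -
  let ?E = "edges G"
  define T where "T = edges_within G S"
  obtain v :: "real ^ 'e" where tot: "(\<Sum>e\<in>?E. v $ e) = real \<delta> * real (grank G ?E)"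
    and "\<forall>F. flacet F \<longrightarrow> (\<Sum>e\<in>F. v $ e) = real \<delta> * real (grank G F) - 1"
    using gorenstein_imp_flacet_equations[OF conn gor] by metis
  then have fl: "\<And>F. flacet F \<Longrightarrow> (\<Sum>e\<in>F. v $ e) = real \<delta> * real (grank G F) - 1" by blast
  \<comment> \<open>The total \<open>v(E)\<close> attains its bound and \<open>v(E - C)\<close> is
    one below its own, so \<open>v(C)\<close> is one above the difference of the bounds.\<close>
  have compl: "(\<Sum>e\<in>C. v $ e) = real \<delta> * real (grank G ?E - grank G (?E - C)) + 1"
    if C: "C \<subseteq> ?E" "flacet (?E - C)" for C
  proof -
    have "(\<Sum>e\<in>?E. v $ e) = (\<Sum>e\<in>?E - C. v $ e) + (\<Sum>e\<in>C. v $ e)"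
      by (rule sum.subset_diff[OF C(1) finite_edges])
    moreover have "grank G (?E - C) \<le> grank G ?E" by (rule rank_mono) auto
    ultimately show ?thesis using tot fl[OF C(2)] by (simp add: of_nat_diff algebra_simps)
  qed
  \<comment> \<open>The flacet \<open>?E - {e}\<close> forces the value 1, the flacet
    \<open>{e}\<close> the value \<open>\<delta> - 1\<close>; in either case the corresponding graph
    is 2-connected and \<open>w\<close> is bound to the same value.\<close>
  have vw: "v $ e = real (w e)" if e: "e \<in> ?E" for e
    using flacet_delete_or_contract[OF conn two e]
  proof
    assume F: "flacet (?E - {e})"
    have "v $ e = 1" using compl[of "{e}"] F e rank_singleton_connected(2)[OF conn two e] by simp
    moreover have "two_connected (delete_edge G e)"
      by (rule two_connected_delete_edge[OF two e]) (use F in \<open>simp add: flacet_def\<close>)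
    ultimately show ?thesis using w_delete[OF e] by simp
  next
    assume F: "flacet {e}"
    have "v $ e = real \<delta> - 1" using fl[OF F] rank_singleton_connected(1)[OF conn two e] by simp
    moreover have "two_connected (contract G {e})" by (rule two_connected_contract_edge[OF two F])
    \<comment> \<open>The weight \<open>\<delta> - 1\<close> is a difference of natural numbers; it
      is the real one because \<open>1 \<le> \<delta>\<close>.\<close>
    ultimately show ?thesis using w_contract[OF e] delta by (simp add: of_nat_diff)
  qed
  have TE: "T \<subseteq> ?E" using edges_within_subset by (simp add: T_def)
  obtain \<P> where P: "partition_on (?E - T) \<P>" "card (blocks (contract G T)) = card \<P>"
    and flP: "\<forall>C\<in>\<P>. flacet (?E - C)"
    and sumP: "(\<Sum>C\<in>\<P>. grank G ?E - grank G (?E - C)) = grank G ?E - grank G T"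
    by (rule contraction_blocks[OF conn S T_def]) blast
  have "finite (?E - T)" using finite_edges by simp
  then have "(\<Sum>e\<in>?E - T. v $ e) = (\<Sum>C\<in>\<P>. \<Sum>e\<in>C. v $ e)"
    using sum.Union_disjoint_sets[of \<P> "\<lambda>e. v $ e"] P(1) by (auto simp: partition_on_def)
  also have "\<dots> = (\<Sum>C\<in>\<P>. real \<delta> * real (grank G ?E - grank G (?E - C)) + 1)"
  proof (rule sum.cong[OF refl])
    fix C assume "C \<in> \<P>"
    then show "(\<Sum>e\<in>C. v $ e) = real \<delta> * real (grank G ?E - grank G (?E - C)) + 1"
      using P(1) flP by (intro compl) (auto simp: partition_on_def)
  qed
  also have "\<dots> = real \<delta> * real (\<Sum>C\<in>\<P>. grank G ?E - grank G (?E - C)) + real (card \<P>)"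
    by (simp add: sum.distrib sum_distrib_left)
  also have "\<dots> = real \<delta> * real (grank G ?E - grank G T) + real (card \<P>)" unfolding sumP ..
  finally have rest: "(\<Sum>e\<in>?E - T. v $ e) = real \<delta> * real (grank G ?E - grank G T) + real (card \<P>)" .
  have "(\<Sum>e\<in>?E. v $ e) = (\<Sum>e\<in>?E - T. v $ e) + (\<Sum>e\<in>T. v $ e)"
    by (rule sum.subset_diff[OF TE finite_edges])
  moreover have "grank G T \<le> grank G ?E" by (rule rank_mono[OF TE subset_refl])
  ultimately have "(\<Sum>e\<in>T. v $ e) + real (card \<P>) = real \<delta> * real (grank G T)"
    using rest tot by (simp add: of_nat_diff algebra_simps)
  moreover have "(\<Sum>e\<in>T. v $ e) = (\<Sum>e\<in>T. real (w e))" by (rule sum.cong[OF refl]) (use vw TE in auto)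
  ultimately have "real ((\<Sum>e\<in>T. w e) + card \<P>) = real (\<delta> * grank G T)" by simp
  then have "(\<Sum>e\<in>T. w e) + card \<P> = \<delta> * grank G T" by (simp only: of_nat_eq_iff)
  then show ?thesis using P(2) induced_two_connected_rank(2)[OF S] by (simp add: T_def)
qed

lemma block_equations_imp_gorenstein:
  assumes eq: "\<And>S. S \<subseteq> verts G \<Longrightarrow> two_connected (induced G S) \<Longrightarrow>
    (\<Sum>e \<in> edges_within G S. w e) + card (blocks (contract G (edges_within G S))) = \<delta> * (card S - 1)"
  shows "gorenstein \<delta> P"
proof -
  let ?E = "edges G"
  define v where "v e = (if e \<in> ?E then int (w e) else 0)" for e
  have vsum: "(\<Sum>e\<in>F. v e) = int (\<Sum>e\<in>F. w e)" if "F \<subseteq> ?E" for F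
    unfolding of_nat_sum by (rule sum.cong[OF refl]) (use that in \<open>auto simp: v_def\<close>)
  have wE: "(\<Sum>e\<in>?E. w e) = \<delta> * grank G ?E"
    using eq[OF subset_refl] two_conn grank_edges blocks_contract_all by (simp add: induced_verts edges_within_verts)
  \<comment> \<open>Each component \<open>C\<close> of the restriction to \<open>F\<close> lies in
    \<open>E(S)\<close> for its vertex set \<open>S\<close> and has the same rank; the equation of
    \<open>S\<close> bounds the weight of \<open>C\<close>, as weights and \<open>k(S)\<close> are
    nonnegative.\<close>
  have le: "(\<Sum>e\<in>F. w e) \<le> \<delta> * grank G F" if F: "F \<subseteq> ?E" for F
  proof -
    obtain \<P> where P: "partition_on F \<P>" "\<forall>C\<in>\<P>. rank_connected (grank G) C"
      "grank G F = (\<Sum>C\<in>\<P>. grank G C)"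
      by (rule rank_connected_partition[OF F]) blast
    have "(\<Sum>e\<in>F. w e) = (\<Sum>C\<in>\<P>. \<Sum>e\<in>C. w e)"
      using sum.Union_disjoint_sets[of \<P> w] P(1) by (auto simp: partition_on_def)
    also have "\<dots> \<le> (\<Sum>C\<in>\<P>. \<delta> * grank G C)"
    proof (rule sum_mono)
      fix C assume C: "C \<in> \<P>"
      have CE: "C \<subseteq> ?E" using C P(1) F by (auto simp: partition_on_def)
      note rci = rank_connected_induced[OF CE bspec[OF P(2) C]]
      have "(\<Sum>e\<in>C. w e) \<le> (\<Sum>e\<in>edges_within G (vset G C). w e)"
        by (rule sum_mono2) (use rci(1) in auto)
      also have "\<dots> \<le> \<delta> * (card (vset G C) - 1)" using eq[OF vset_subset[OF CE] rci(2)] by simp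
      finally show "(\<Sum>e\<in>C. w e) \<le> \<delta> * grank G C" using rci(3) by simp
    qed
    finally show ?thesis using P(3) by (simp add: sum_distrib_left)
  qed
  have flacet_eq: "(\<Sum>e\<in>F. w e) + 1 = \<delta> * grank G F" if fl: "flacet F" for F
  proof -
    have F: "F \<subset> ?E" "rank_connected (grank G) F" using fl by (auto simp: flacet_def)
    have FE: "F \<subseteq> ?E" using F by auto
    note rci = rank_connected_induced[OF FE F(2)]
    show ?thesis
    proof (rule flacet_cases[OF vset_edges fl])
      \<comment> \<open>The contraction by \<open>F\<close> is connected, so \<open>k(S) = 1\<close>
        provides the \<open>1\<close> of the flacet equation.\<close>
      assume FT: "F = edges_within G (vset G F)"
      obtain \<P> where P: "card (blocks (contract G F)) = card \<P>"
        "rank_connected (\<lambda>X. grank G (X \<union> F) - grank G F) (?E - F) \<longrightarrow> \<P> = {?E - F}"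
        by (rule contraction_blocks[OF conn vset_subset[OF FE] rci(2) FT]) blast
      then have "card (blocks (contract G F)) = 1" using flacet_contraction_connected[OF fl] by simp
      moreover have "(\<Sum>e\<in>F. w e) + card (blocks (contract G F)) = \<delta> * (card (vset G F) - 1)"
        using eq[OF vset_subset[OF FE] rci(2)] FT by simp
      ultimately show ?thesis using rci(3) by simp
    next
      \<comment> \<open>Here the vertex set is all of \<open>V\<close> and \<open>k(V) = 0\<close>;
        the \<open>1\<close> is the weight of the deleted edge.\<close>
      fix e assume e: "e \<in> ?E" "F = ?E - {e}" "vset G F = verts G"
      have "two_connected (delete_edge G e)"
        by (rule two_connected_delete_edge[OF two e(1)]) (use F(2) e(2) in simp)
      then have "w e = 1" by (rule w_delete[OF e(1)])
      moreover have "(\<Sum>e\<in>?E. w e) = w e + (\<Sum>e\<in>F. w e)" unfolding e(2) by (rule sum.remove[OF finite_edges e(1)])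
      moreover have "grank G F = grank G ?E" using rci(3) e(3) grank_edges by simp
      ultimately show ?thesis using wE by simp
    qed
  qed
  show ?thesis
  proof (rule gorenstein_if_flacet_equations[OF conn two delta])
    show "v e = 0" if "e \<notin> ?E" for e using that by (simp add: v_def)
    show "(\<Sum>e\<in>?E. v e) = int \<delta> * int (grank G ?E)" using vsum[OF subset_refl] wE by simp
    show "(\<Sum>e\<in>F. v e) \<le> int \<delta> * int (grank G F)" if "F \<subseteq> ?E" for F
      unfolding vsum[OF that] using le[OF that] by (simp flip: of_nat_mult of_nat_sum)
    show "(\<Sum>e\<in>F. v e) = int \<delta> * int (grank G F) - 1" if fl: "flacet F" for F
    proof -
      have "F \<subseteq> ?E" using fl by (auto simp: flacet_def)
      from vsum[OF this] show ?thesis using arg_cong[OF flacet_eq[OF fl], of int] by simp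
    qed
  qed
qed

end

text \<open>Only \<open>S = V\<close> occurs, and its equation reads \<open>w e = \<delta>\<close>.
  As \<open>w e\<close> is \<open>1\<close> or \<open>\<delta> - 1\<close>, this means
  \<open>\<delta> = 1\<close> and \<open>w e = 1\<close>, whereas the Gorenstein property means
  \<open>\<delta> = 1\<close>; \<open>excl\<close> removes the one case in which they
  differ.\<close>

lemma single_edge_equivalence:
  fixes w :: "'e \<Rightarrow> nat"
  assumes delta: "1 \<le> \<delta>" and w: "\<And>e. e \<in> edges G \<Longrightarrow> w e \<in> {1, \<delta> - 1}"
    and one: "card (edges G) = 1" and excl: "\<not> (\<delta> = 1 \<and> (\<forall>e\<in>edges G. w e = 0))"
  shows "gorenstein \<delta> P \<longleftrightarrow> (\<forall>S. S \<subseteq> verts G \<and> two_connected (induced G S) \<longrightarrow>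
    (\<Sum>e \<in> edges_within G S. w e) + card (blocks (contract G (edges_within G S))) = \<delta> * (card S - 1))"
    (is "_ \<longleftrightarrow> (\<forall>S. ?cond S \<longrightarrow> ?eq S)")
proof -
  obtain e where E: "edges G = {e}" using one by (auto simp: card_1_singleton_iff)
  have cv: "card (verts G) = 2" using vset_edges E card_ends[of e] by (simp add: vset_def)
  have "S = verts G" if S: "?cond S" for S
  proof -
    have "2 \<le> card S" using S unfolding induced_def two_connected_subgraph_on by simp
    moreover have "card S \<le> card (verts G)" by (rule card_mono[OF finite_verts]) (use S in simp)
    ultimately have "card S = card (verts G)" using cv by simp
    then show ?thesis using S finite_verts by (simp add: card_subset_eq)
  qed
  moreover have "?cond (verts G)" using two_conn by (simp add: induced_verts)
  ultimately have "(\<forall>S. ?cond S \<longrightarrow> ?eq S) \<longleftrightarrow> ?eq (verts G)" by metis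
  also have "\<dots> \<longleftrightarrow> w e = \<delta>" using blocks_contract_all cv by (simp add: edges_within_verts) (simp add: E)
  also have "\<dots> \<longleftrightarrow> \<delta> = 1" using w[of e] excl delta E by auto
  also have "\<dots> \<longleftrightarrow> gorenstein \<delta> P"
    using gorenstein_coloop[OF E _ delta] grank_edges cv by simp
  finally show ?thesis by simp
qed

end

theorem theorem3p4:
  fixes G :: "('v, 'e::finite) mgraph" and w :: "'e \<Rightarrow> nat" and \<delta> :: nat
  assumes "1 \<le> \<delta>"
    and "simple_graph G" and "two_connected G"
    and "\<And>e. e \<in> edges G \<Longrightarrow> w e \<in> {1, \<delta> - 1}"
    and "\<And>e. e \<in> edges G \<Longrightarrow> two_connected (delete_edge G e) \<Longrightarrow> w e = 1"
    and "\<And>e. e \<in> edges G \<Longrightarrow> two_connected (contract G {e}) \<Longrightarrow> w e = \<delta> - 1"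
    and \<comment> \<open>for a single edge, \<open>w\<close> is not determined by the conditions above, and the equivalence
          fails for \<open>\<delta> = 1\<close> and \<open>w = 0\<close>\<close>
      "\<not> (card (edges G) = 1 \<and> \<delta> = 1 \<and> (\<forall>e \<in> edges G. w e = 0))"
  shows "gorenstein \<delta> (base_polytope G) \<longleftrightarrow>
    (\<forall>S. S \<subseteq> verts G \<and> two_connected (induced G S) \<longrightarrow>
       (\<Sum>e \<in> edges_within G S. w e) + card (blocks (contract G (edges_within G S)))
         = \<delta> * (card S - 1))"
proof -
  have ll: "loopless G" by (rule simple_graph_loopless[OF assms(2)])
  interpret two_connected_simple G
    using ll assms(2,3) by (simp add: two_connected_simple_def two_connected_simple_axioms_def)
  have P: "base_polytope G = P" by (rule base_polytope_eq[OF ll])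
  have "card (edges G) \<noteq> 0" using edges_ne finite_edges by simp
  then consider "card (edges G) = 1" | "2 \<le> card (edges G)" by linarith
  then show ?thesis
  proof cases
    case 1
    then show ?thesis unfolding P using single_edge_equivalence[OF assms(1,4) 1] assms(7) by simp
  next
    case 2
    show ?thesis
      unfolding P
    proof (intro iffI allI impI)
      fix S assume "gorenstein \<delta> P" and S: "S \<subseteq> verts G \<and> two_connected (induced G S)"
      with assms(1,5,6) 2 show "(\<Sum>e \<in> edges_within G S. w e) + card (blocks (contract G (edges_within G S)))
          = \<delta> * (card S - 1)"
        by (intro gorenstein_imp_block_equation[where w = w]) simp_all
    next
      assume "\<forall>S. S \<subseteq> verts G \<and> two_connected (induced G S) \<longrightarrow>
        (\<Sum>e \<in> edges_within G S. w e) + card (blocks (contract G (edges_within G S))) = \<delta> * (card S - 1)"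
      with assms(1,5,6) 2 show "gorenstein \<delta> P"
        by (intro block_equations_imp_gorenstein[where w = w]) simp_all
    qed
  qed
qed

end
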